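(* Let $n\ge1$ and let $a=a(\xi)\in C^\infty(\mathbb{R}^n)$ be real-valued with $\nabla a(\xi)\ne0$ for all $\xi\in\mathbb{R}^n$. Assume that $a(\xi)=a_1(\xi)+a_0(\xi)$ for large $\xi$, where $a_1\in C^\infty(\mathbb{R}^n\setminus0)$ is positively homogeneous of order $1$ (i.e. $a_1(\lambda\xi)=\lambda a_1(\xi)$ for all $\lambda>0$, $\xi\ne0$) and satisfies $\nabla a_1(\xi)\ne0$ for all $\xi\ne0$, and $a_0\in C^\infty(\mathbb{R}^n)$ is a symbol of order zero, i.e. for every multi-index $\alpha$ there is $C_\alpha>0$ with $|\partial^\alpha a_0(\xi)|\le C_\alpha\langle\xi\rangle^{-|\alpha|}$ for all $\xi\in\mathbb{R}^n$. Let $u=u(t,x)$ be the solution of the Cauchy problem $$i\partial_tu-a(D_x)u=0,\qquad u(0,x)=u_0(x).$$ Then for every $s>1/2$ and all $k=0,1,2,\ldots$ we have $$\|t^k\langle x\rangle^{-k}\langle x\rangle^{-s}u\|_{L^2(\mathbb{R}_t\times\mathbb{R}^n_x)}\le C_k\|\langle x\rangle^ku_0\|_{L^2(\mathbb{R}^n_x)},$$ where the constant $C_k$ is independent of the Cauchy data $u_0$.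
   Context: $\langle x\rangle=(1+|x|^2)^{1/2}$. $a(D_x)$ is the Fourier multiplier with symbol $a(\xi)$, with $D_x=-i\partial_x$. *)

theory Defs
  imports "HOL-Analysis.Analysis"
begin

definition japanese :: "real ^ 'n \<Rightarrow> real" ("\<langle>_\<rangle>")
  where "\<langle>x\<rangle> = sqrt (1 + (norm x)\<^sup>2)"

subsection \<open>Smoothness and symbols\<close>

definition partial :: "'n \<Rightarrow> (real ^ 'n \<Rightarrow> 'b::real_normed_vector) \<Rightarrow> real ^ 'n \<Rightarrow> 'b"
  where "partial i f x = frechet_derivative f (at x) (axis i 1)"

text \<open>A multi-index is given as the list \<open>[i\<^sub>1, \<dots>, i\<^sub>m]\<close> of the variables in which one
  differentiates, so its order \<open>|\<alpha>|\<close> is the length of the list. For smooth functions the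
  entries may be permuted, so quantifying over all lists is the same as quantifying over all
  exponent vectors.\<close>

primrec partials :: "'n list \<Rightarrow> (real ^ 'n \<Rightarrow> 'b::real_normed_vector) \<Rightarrow> real ^ 'n \<Rightarrow> 'b"
  where
    "partials [] f = f"
  | "partials (i # \<alpha>) f = partial i (partials \<alpha> f)"

text \<open>Only used for open \<open>S\<close>. Differentiability of all iterated partial derivatives
  includes their continuity, so this is \<open>f \<in> C\<^sup>\<infinity>(S)\<close>.\<close>

definition smooth_on :: "(real ^ 'n) set \<Rightarrow> (real ^ 'n \<Rightarrow> 'b::real_normed_vector) \<Rightarrow> bool"
  where "smooth_on S f \<longleftrightarrow> (\<forall>\<alpha>. \<forall>x\<in>S. partials \<alpha> f differentiable (at x))"

definition grad :: "(real ^ 'n \<Rightarrow> real) \<Rightarrow> real ^ 'n \<Rightarrow> real ^ 'n"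
  where "grad f x = (\<chi> i. partial i f x)"

definition homogeneous_order_one :: "(real ^ 'n \<Rightarrow> real) \<Rightarrow> bool"
  where "homogeneous_order_one f \<longleftrightarrow>
    (\<forall>r>0. \<forall>\<xi>. \<xi> \<noteq> 0 \<longrightarrow> f (r *\<^sub>R \<xi>) = r * f \<xi>)"

definition symbol_order_zero :: "(real ^ 'n \<Rightarrow> real) \<Rightarrow> bool"
  where "symbol_order_zero f \<longleftrightarrow> smooth_on UNIV f \<and>
    (\<forall>\<alpha>. \<exists>C>0. \<forall>\<xi>. \<bar>partials \<alpha> f \<xi>\<bar> \<le> C * \<langle>\<xi>\<rangle> powr (- real (length \<alpha>)))"

subsection \<open>The space \<open>L\<^sup>2\<close>\<close>

definition in_L2 :: "'a measure \<Rightarrow> ('a \<Rightarrow> complex) \<Rightarrow> bool"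
  where "in_L2 M f \<longleftrightarrow> f \<in> borel_measurable M \<and> integrable M (\<lambda>x. (norm (f x))\<^sup>2)"

text \<open>Meaningful only for functions satisfying \<open>in_L2\<close>; otherwise the integral may be the
  default value 0.\<close>

definition L2_norm :: "'a measure \<Rightarrow> ('a \<Rightarrow> complex) \<Rightarrow> real"
  where "L2_norm M f = sqrt (LINT x|M. (norm (f x))\<^sup>2)"

definition L2_pairing :: "(real ^ 'n \<Rightarrow> complex) \<Rightarrow> (real ^ 'n \<Rightarrow> complex) \<Rightarrow> complex"
  where "L2_pairing f g = (LINT x|lborel. f x * cnj (g x))"

subsection \<open>Fourier multipliers and the Cauchy problem\<close>

definition schwartz :: "(real ^ 'n \<Rightarrow> complex) \<Rightarrow> bool"
  where "schwartz \<phi> \<longleftrightarrow> smooth_on UNIV \<phi> \<and>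
    (\<forall>\<alpha> N. \<exists>C. \<forall>x. \<langle>x\<rangle> ^ N * norm (partials \<alpha> \<phi> x) \<le> C)"

definition fourier :: "(real ^ 'n \<Rightarrow> complex) \<Rightarrow> real ^ 'n \<Rightarrow> complex"
  where "fourier \<phi> \<xi> = (LINT x|lborel. cis (- (x \<bullet> \<xi>)) * \<phi> x)"

text \<open>The operator \<open>a(D)\<close>, \<open>D = -i\<partial>\<close>, on Schwartz functions.\<close>

definition fourier_multiplier ::
    "(real ^ 'n \<Rightarrow> real) \<Rightarrow> (real ^ 'n \<Rightarrow> complex) \<Rightarrow> real ^ 'n \<Rightarrow> complex"
  where "fourier_multiplier a \<phi> x =
    (LINT \<xi>|lborel. cis (x \<bullet> \<xi>) * complex_of_real (a \<xi>) * fourier \<phi> \<xi>)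
      / complex_of_real ((2 * pi) ^ CARD('n))"

text \<open>For \<open>v \<in> L\<^sup>2\<close> and a symbol \<open>a\<close> of order one, \<open>a(D)v\<close> is in general only a tempered
  distribution. It is defined by duality; as \<open>a\<close> is real-valued, \<open>a(D)\<close> is its own formal
  adjoint, whence \<open>(a(D)v, \<phi>) = (v, a(D)\<phi>)\<close>.\<close>

definition fourier_multiplier_distr ::
    "(real ^ 'n \<Rightarrow> real) \<Rightarrow> (real ^ 'n \<Rightarrow> complex) \<Rightarrow> (real ^ 'n \<Rightarrow> complex) \<Rightarrow> complex"
  where "fourier_multiplier_distr a v \<phi> = L2_pairing v (fourier_multiplier a \<phi>)"

text \<open>The solution of \<open>i\<partial>\<^sub>tu - a(D)u = 0\<close>, \<open>u(0) = u\<^sub>0\<close>, in \<open>C(\<real>; L\<^sup>2)\<close>: the equation holds in the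
  sense of tempered distributions in \<open>x\<close>, for every time \<open>t\<close>. Elements of \<open>L\<^sup>2\<close> are represented
  by functions, hence the initial condition holds almost everywhere, and joint measurability
  expresses that a representative on space-time has been chosen.\<close>

definition cauchy_solution ::
    "(real ^ 'n \<Rightarrow> real) \<Rightarrow> (real ^ 'n \<Rightarrow> complex) \<Rightarrow> (real \<Rightarrow> real ^ 'n \<Rightarrow> complex) \<Rightarrow> bool"
  where "cauchy_solution a u0 u \<longleftrightarrow>
    (\<lambda>(t, x). u t x) \<in> borel_measurable lborel \<and>
    (\<forall>t. in_L2 lborel (u t)) \<and>
    (\<forall>t. ((\<lambda>\<tau>. L2_norm lborel (\<lambda>x. u \<tau> x - u t x)) \<longlongrightarrow> 0) (at t)) \<and>
    (\<forall>\<phi> t. schwartz \<phi> \<longrightarrow>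
      (\<exists>d. ((\<lambda>\<tau>. L2_pairing (u \<tau>) \<phi>) has_vector_derivative d) (at t) \<and>
           \<i> * d - fourier_multiplier_distr a (u t) \<phi> = 0)) \<and>
    (AE x in lborel. u 0 x = u0 x)"

end

theory Submission
  imports Defs "HOL-Probability.Characteristic_Functions"
begin

text \<open>For smooth data with Fourier transform \<open>g\<close> the solution is the inverse Fourier transform of
  \<open>exp(-ita) g\<close>. Let first \<open>k = 0\<close>. Frequency space is covered by finitely many balls and convex
  cones, on each of which some \<open>\<partial>\<^sub>i a\<close> is bounded away from zero, so that replacing the coordinate
  \<open>\<xi>\<^sub>i\<close> by \<open>a(\<xi>)\<close> defines a map \<open>\<Phi>\<close> with \<open>|\<Phi>(\<xi>) - \<Phi>(\<eta>)| \<ge> c |\<xi> - \<eta>|\<close>. With the integrable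
  weight \<open>(1 + x\<^sub>i\<^sup>2) powr (-s)\<close> in \<open>x\<^sub>i\<close> and Gaussian weights in \<open>t\<close> and in the other \<open>x\<^sub>j\<close>, the
  kernel of \<open>T\<^sup>* T\<close> for \<open>T : g \<mapsto> u\<close> is at most a multiple of the Gaussian \<open>exp(-|\<Phi>(\<xi>) - \<Phi>(\<eta>)|\<^sup>2 / 2\<epsilon>)\<close>,
  hence of a convolution kernel whose mass does not depend on \<open>\<epsilon>\<close>, and the Schur test bounds \<open>T\<close>
  uniformly as \<open>\<epsilon> \<rightarrow> 0\<close>. For \<open>k > 0\<close> integrate by parts in \<open>\<xi>\<close> along the bounded vector field
  \<open>\<nabla>a / |\<nabla>a|\<^sup>2\<close>: each factor \<open>t\<close> becomes a factor \<open>x\<close>, absorbed by the weight, or a derivative of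
  \<open>g\<close>, that is, a factor \<open>x\<close> on the data. Finally the data are approximated by Schwartz functions, and
  a weak solution depends continuously on its data because the equation can be tested with the
  solution of the adjoint problem.\<close>

subsection \<open>Smooth functions with controlled derivatives\<close>

text \<open>For fixed x_i the solution is, in the n variables t and x_j with j \<noteq> i, a Fourier
  integral in the coordinates \<Phi>(\<xi>). Its L2 norm in these variables is thus bounded
  uniformly in x_i, and integrating over x_i costs the integral of the weight, finite because s >
  1/2. The Gaussian weights replace the change of variables: neither surjectivity nor the Jacobian
  of \<Phi> enters, only its lower Lipschitz bound. The n Gaussian integrals, one in t and n - 1 in
  the x_j, contribute \<epsilon>^(-n/2), and exp(-c^2 |\<zeta>|^2 / 2\<epsilon>) has mass of order
  \<epsilon>^(n/2) in n variables, so \<epsilon> cancels. Constants are uniform because \<nabla>a_1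
  is homogeneous of degree 0: a compact sphere of directions and a compact ball account for all
  frequencies. In the last step the obstacle is that weak solutions are compared with smooth ones in
  L2 at each time, without decay in t, while t^k is unbounded; the comparison is therefore made on
  |t| \<le> T, with a final constant independent of T.\<close>

lemma partial_eqI: "(f has_derivative f') (at x) \<Longrightarrow> partial i f x = f' (axis i 1)"
  unfolding partial_def using frechet_derivative_at by metis

lemma partials_append: "partials (\<alpha> @ \<beta>) f = partials \<alpha> (partials \<beta> f)"
  by (induction \<alpha>) auto

lemma partial_add:
  assumes "f differentiable at x" "g differentiable at x"
  shows "partial i (\<lambda>y. f y + g y) x = partial i f x + partial i g x"
proof -
  have "((\<lambda>y. f y + g y) has_derivative
      (\<lambda>h. frechet_derivative f (at x) h + frechet_derivative g (at x) h)) (at x)"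
    using assms by (intro has_derivative_add) (simp_all add: frechet_derivative_works)
  from partial_eqI[OF this] show ?thesis by (simp add: partial_def)
qed

lemma partial_mult:
  fixes f g :: "real ^ 'n \<Rightarrow> 'b::real_normed_field"
  assumes "f differentiable at x" "g differentiable at x"
  shows "partial i (\<lambda>y. f y * g y) x = f x * partial i g x + partial i f x * g x"
proof -
  have "((\<lambda>y. f y * g y) has_derivative
      (\<lambda>h. f x * frechet_derivative g (at x) h + frechet_derivative f (at x) h * g x)) (at x)"
    using assms by (intro has_derivative_mult) (simp_all add: frechet_derivative_works)
  from partial_eqI[OF this] show ?thesis by (simp add: partial_def)
qed

lemma partial_bounded_linear:
  assumes "bounded_linear L" "f differentiable at x"
  shows "partial i (\<lambda>y. L (f y)) x = L (partial i f x)"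
proof -
  have "((\<lambda>y. L (f y)) has_derivative (\<lambda>h. L (frechet_derivative f (at x) h))) (at x)"
    using assms by (intro bounded_linear.has_derivative[OF assms(1)]) (simp add: frechet_derivative_works)
  from partial_eqI[OF this] show ?thesis by (simp add: partial_def)
qed

lemma partial_const [simp]: "partial i (\<lambda>y. c) = (\<lambda>y. 0)"
  by (rule ext, subst partial_eqI[where f' = "\<lambda>_. 0"]) auto

lemma partial_component: "partial i (\<lambda>y. y $ j) = (\<lambda>y. axis i 1 $ j)"
  by (rule ext, subst partial_eqI[where f' = "\<lambda>h. h $ j"])
     (auto intro!: bounded_linear_imp_has_derivative bounded_linear_vec_nth)

lemma partial_cong_open:
  assumes "open S" "x \<in> S" "\<And>y. y \<in> S \<Longrightarrow> f y = g y"
  shows "partial i f x = partial i g x"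
proof -
  \<comment> \<open>\<open>frechet_derivative\<close> chooses from the set of all derivatives at the
    point, so equality of these sets gives the same choice, whether or not a derivative
    exists.\<close>
  have "(f has_derivative D) (at x) \<longleftrightarrow> (g has_derivative D) (at x)" for D
    using assms has_derivative_transform_within_open by metis
  then show ?thesis unfolding partial_def frechet_derivative_def by simp
qed

text \<open>A scheme shared by three classes: with \<open>Q\<close> bounded, of polynomial growth or
  rapidly decreasing it gives the tame, slow and Schwartz functions, so that closure properties can
  be proved for a general \<open>Q\<close>.\<close>

definition smooth_with ::
    "((real ^ 'n \<Rightarrow> 'b::real_normed_vector) \<Rightarrow> bool) \<Rightarrow> (real ^ 'n \<Rightarrow> 'b) \<Rightarrow> bool"
  where "smooth_with Q f \<longleftrightarrow>
    (\<forall>\<alpha>. (\<forall>x. partials \<alpha> f differentiable (at x)) \<and> Q (partials \<alpha> f))"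

text \<open>Smoothness with control is the greatest property stable under \<open>partial\<close>, so
  it suffices to exhibit a family that contains f and is closed under first derivatives. Formulas
  for higher derivatives never appear; the smoothness proofs below consist in finding such a
  family.\<close>

lemma smooth_with_coinduct:
  assumes "f \<in> X"
    and "\<And>g. g \<in> X \<Longrightarrow> (\<forall>x. g differentiable (at x)) \<and> Q g \<and> (\<forall>i. partial i g \<in> X)"
  shows "smooth_with Q f"
proof -
  have "partials \<alpha> f \<in> X" for \<alpha>
    by (induction \<alpha>) (use assms in auto)
  then show ?thesis using assms(2) unfolding smooth_with_def by blast
qed

lemma smooth_with_partials: "smooth_with Q f \<Longrightarrow> smooth_with Q (partials \<alpha> f)"
  unfolding smooth_with_def by (simp flip: partials_append)

lemma smooth_with_partial: "smooth_with Q f \<Longrightarrow> smooth_with Q (partial i f)"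
  using smooth_with_partials[of Q f "[i]"] by simp

lemma smooth_withD:
  assumes "smooth_with Q f"
  shows "f differentiable (at x)" "Q f" "continuous_on A f"
proof -
  have *: "partials [] f differentiable (at x)" for x
    using assms unfolding smooth_with_def by blast
  then show "f differentiable (at x)" by simp
  show "continuous_on A f"
    using * by (auto intro!: continuous_at_imp_continuous_on differentiable_imp_continuous_within)
  have "Q (partials [] f)" using assms unfolding smooth_with_def by blast
  then show "Q f" by simp
qed

lemma smooth_with_mono: "smooth_with Q f \<Longrightarrow> (\<And>g. Q g \<Longrightarrow> R g) \<Longrightarrow> smooth_with R f"
  unfolding smooth_with_def by blast

lemma smooth_with_measurable [measurable_dest]: "smooth_with Q f \<Longrightarrow> f \<in> borel_measurable borel"
  by (rule borel_measurable_continuous_onI, erule smooth_withD(3))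

lemma smooth_with_bounded_linear:
  assumes "smooth_with Q f" "bounded_linear L" "\<And>g. Q g \<Longrightarrow> R (\<lambda>x. L (g x))"
  shows "smooth_with R (\<lambda>x. L (f x))"
proof (rule smooth_with_coinduct[where X = "{\<lambda>x. L (g x) | g. smooth_with Q g}"], goal_cases)
  case 1 show ?case using assms(1) by (intro CollectI exI[of _ f] conjI refl)
next
  case (2 h)
  then obtain g where g: "smooth_with Q g" "h = (\<lambda>x. L (g x))" by auto
  have "partial i h = (\<lambda>x. L (partial i g x))" for i
    unfolding g(2) using smooth_withD(1)[OF g(1)] assms(2) by (intro ext partial_bounded_linear) auto
  moreover have "h differentiable (at x)" for x
  proof -
    have "(g has_derivative frechet_derivative g (at x)) (at x)"
      using smooth_withD(1)[OF g(1)] by (simp add: frechet_derivative_works)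
    from bounded_linear.has_derivative[OF assms(2) this] show ?thesis
      unfolding g(2) differentiable_def by (intro exI)
  qed
  moreover have "R h" unfolding g(2) by (intro assms(3) smooth_withD(2)[OF g(1)])
  ultimately show ?case using smooth_with_partial[OF g(1)] by (intro conjI allI CollectI exI) auto
qed

lemma smooth_with_add:
  assumes "smooth_with Q f" "smooth_with Q g"
    and "\<And>f g. Q f \<Longrightarrow> Q g \<Longrightarrow> Q (\<lambda>x. f x + g x)"
  shows "smooth_with Q (\<lambda>x. f x + g x)"
proof (rule smooth_with_coinduct[where X = "{\<lambda>x. f x + g x | f g. smooth_with Q f \<and> smooth_with Q g}"],
    goal_cases)
  case 1 show ?case using assms(1,2) by (intro CollectI exI[of _ f] exI[of _ g] conjI refl)
next
  case (2 h)
  then obtain f g where g: "smooth_with Q f" "smooth_with Q g" "h = (\<lambda>x. f x + g x)" by auto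
  have "partial i h = (\<lambda>x. partial i f x + partial i g x)" for i
    unfolding g(3) using smooth_withD(1)[OF g(1)] smooth_withD(1)[OF g(2)]
    by (intro ext partial_add) auto
  moreover have "h differentiable (at x)" for x
    unfolding g(3) using smooth_withD(1)[OF g(1)] smooth_withD(1)[OF g(2)] by simp
  moreover have "Q h" unfolding g(3) by (intro assms(3) smooth_withD(2)[OF g(1)] smooth_withD(2)[OF g(2)])
  ultimately show ?case using smooth_with_partial[OF g(1)] smooth_with_partial[OF g(2)]
    by (intro conjI allI CollectI exI) auto
qed

text \<open>The factors may belong to different classes, because polynomial growth times rapid decay
  is the case needed for multipliers on Schwartz functions. \<open>T\<close> must be closed under
  sums since the Leibniz rule turns a product into a sum.\<close>

lemma smooth_with_mult:
  fixes f g :: "real ^ 'n \<Rightarrow> 'b::real_normed_field"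
  assumes "smooth_with Q f" "smooth_with R g"
    and QR: "\<And>f g. Q f \<Longrightarrow> R g \<Longrightarrow> T (\<lambda>x. f x * g x)"
    and T: "\<And>f g. T f \<Longrightarrow> T g \<Longrightarrow> T (\<lambda>x. f x + g x)"
  shows "smooth_with T (\<lambda>x. f x * g x)"
proof -
  \<comment> \<open>\<open>X n\<close> consists of sums of \<open>2\<^sup>n\<close> products, so the Leibniz rule maps \<open>X n\<close> into \<open>X (Suc n)\<close>.\<close>
  define X where "X = rec_nat {\<lambda>x. f x * g x | f g. smooth_with Q f \<and> smooth_with R g}
    (\<lambda>_ X. {\<lambda>x. f x + g x | f g. f \<in> X \<and> g \<in> X})"
  have X0: "X 0 = {\<lambda>x. f x * g x | f g. smooth_with Q f \<and> smooth_with R g}"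
    and XS: "X (Suc n) = {\<lambda>x. f x + g x | f g. f \<in> X n \<and> g \<in> X n}" for n
    by (simp_all add: X_def)
  have *: "(\<forall>x. h differentiable (at x)) \<and> T h \<and> (\<forall>i. partial i h \<in> X (Suc n))" if "h \<in> X n" for n h
    using that
  proof (induction n arbitrary: h)
    case 0
    then obtain f g where g: "smooth_with Q f" "smooth_with R g" "h = (\<lambda>x. f x * g x)"
      by (auto simp: X0)
    have "partial i h = (\<lambda>x. f x * partial i g x + partial i f x * g x)" for i
      unfolding g(3) using smooth_withD(1)[OF g(1)] smooth_withD(1)[OF g(2)]
      by (intro ext partial_mult) auto
    moreover have "(\<lambda>x. f x * partial i g x) \<in> X 0" for i
      unfolding X0 using g(1) smooth_with_partial[OF g(2)]
      by (intro CollectI exI[of _ f] exI[of _ "partial i g"] conjI refl)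
    moreover have "(\<lambda>x. partial i f x * g x) \<in> X 0" for i
      unfolding X0 using g(2) smooth_with_partial[OF g(1)]
      by (intro CollectI exI[of _ "partial i f"] exI[of _ g] conjI refl)
    ultimately have "partial i h \<in> X (Suc 0)" for i
      unfolding XS by (intro CollectI exI conjI) auto
    moreover have "h differentiable (at x)" for x
      unfolding g(3) using smooth_withD(1)[OF g(1)] smooth_withD(1)[OF g(2)] by simp
    moreover have "T h" unfolding g(3) by (intro QR smooth_withD(2)[OF g(1)] smooth_withD(2)[OF g(2)])
    ultimately show ?case by simp
  next
    case (Suc n)
    then obtain f g where g: "f \<in> X n" "g \<in> X n" "h = (\<lambda>x. f x + g x)" by (auto simp: XS)
    note f' = Suc.IH[OF g(1)] and g' = Suc.IH[OF g(2)]
    have "partial i h = (\<lambda>x. partial i f x + partial i g x)" for i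
      unfolding g(3) using f' g' by (intro ext partial_add) auto
    then have "partial i h \<in> X (Suc (Suc n))" for i
      using f' g' unfolding XS[of "Suc n"] by (intro CollectI exI conjI) auto
    moreover have "h differentiable (at x)" for x
      unfolding g(3) using f' g' by simp
    moreover have "T h" unfolding g(3) using f' g' by (intro T) auto
    ultimately show ?case by simp
  qed
  show ?thesis
  proof (rule smooth_with_coinduct[where X = "\<Union>n. X n"])
    have "(\<lambda>x. f x * g x) \<in> X 0" unfolding X0 using assms(1,2) by (intro CollectI exI[of _ f] exI[of _ g] conjI refl)
    then show "(\<lambda>x. f x * g x) \<in> (\<Union>n. X n)" by blast
  qed (use * in blast)
qed

section \<open>Growth conditions measured by the weight \<langle>x\<rangle>\<close>

lemma japanese_ge_1: "1 \<le> \<langle>x\<rangle>" and japanese_pos: "0 < \<langle>x\<rangle>" and japanese_ge_norm: "norm x \<le> \<langle>x\<rangle>"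
  and japanese_nonneg: "0 \<le> \<langle>x\<rangle>" and japanese_sq: "\<langle>x\<rangle>\<^sup>2 = 1 + (norm x)\<^sup>2"
proof -
  show *: "1 \<le> \<langle>x\<rangle>" unfolding japanese_def by simp
  show "0 < \<langle>x\<rangle>" "0 \<le> \<langle>x\<rangle>" using * by linarith+
  show "norm x \<le> \<langle>x\<rangle>" unfolding japanese_def by (rule real_le_rsqrt) simp
  show "\<langle>x\<rangle>\<^sup>2 = 1 + (norm x)\<^sup>2" unfolding japanese_def by (simp add: add_nonneg_nonneg)
qed

lemma japanese_measurable [measurable]: "japanese \<in> borel_measurable borel"
  unfolding japanese_def by measurable

lemma continuous_on_japanese [continuous_intros]:
  "continuous_on A f \<Longrightarrow> continuous_on A (\<lambda>x. \<langle>f x\<rangle>)"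
  unfolding japanese_def by (intro continuous_intros)

text \<open>In lemma names, \<open>tame\<close> and \<open>slow\<close> refer to smooth functions all of whose derivatives are
  bounded, respectively of polynomial growth.\<close>

definition bdd_fun :: "(real ^ 'n \<Rightarrow> 'b::real_normed_vector) \<Rightarrow> bool"
  where "bdd_fun f \<longleftrightarrow> (\<exists>C. \<forall>x. norm (f x) \<le> C)"

definition poly_fun :: "(real ^ 'n \<Rightarrow> 'b::real_normed_vector) \<Rightarrow> bool"
  where "poly_fun f \<longleftrightarrow> (\<exists>C N. \<forall>x. norm (f x) \<le> C * \<langle>x\<rangle> ^ N)"

definition rapid_fun :: "(real ^ 'n \<Rightarrow> 'b::real_normed_vector) \<Rightarrow> bool"
  where "rapid_fun f \<longleftrightarrow> (\<forall>N. \<exists>C. \<forall>x. \<langle>x\<rangle> ^ N * norm (f x) \<le> C)"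

lemma bdd_funE:
  assumes "bdd_fun f" obtains C where "C > 0" "\<And>x. norm (f x) \<le> C"
proof -
  obtain C where C: "\<And>x. norm (f x) \<le> C" using assms unfolding bdd_fun_def by blast
  show ?thesis by (rule that[of "max C 1"]) (use C in \<open>auto intro: max.coboundedI1\<close>)
qed

lemma poly_funE:
  assumes "poly_fun f" obtains C N where "C > 0" "\<And>x. norm (f x) \<le> C * \<langle>x\<rangle> ^ N"
proof -
  obtain C N where C: "\<And>x. norm (f x) \<le> C * \<langle>x\<rangle> ^ N" using assms unfolding poly_fun_def by blast
  have "norm (f x) \<le> max C 1 * \<langle>x\<rangle> ^ N" for x
    using C[of x] by (rule order.trans) (intro mult_right_mono zero_le_power japanese_nonneg; simp)
  then show ?thesis by (intro that[of "max C 1"]) auto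
qed

lemma rapid_funE:
  assumes "rapid_fun f" obtains C where "C > 0" "\<And>x. \<langle>x\<rangle> ^ N * norm (f x) \<le> C"
proof -
  obtain C where C: "\<And>x. \<langle>x\<rangle> ^ N * norm (f x) \<le> C" using assms unfolding rapid_fun_def by blast
  show ?thesis by (rule that[of "max C 1"]) (use C in \<open>auto intro: max.coboundedI1\<close>)
qed

lemma bdd_fun_add: "bdd_fun f \<Longrightarrow> bdd_fun g \<Longrightarrow> bdd_fun (\<lambda>x. f x + g x)"
  by (elim bdd_funE, unfold bdd_fun_def) (rule exI, rule allI, rule norm_triangle_mono)

lemma poly_fun_add:
  assumes "poly_fun f" "poly_fun g" shows "poly_fun (\<lambda>x. f x + g x)"
proof -
  obtain C N where C: "C > 0" "\<And>x. norm (f x) \<le> C * \<langle>x\<rangle> ^ N" using assms poly_funE by blast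
  obtain D M where D: "D > 0" "\<And>x. norm (g x) \<le> D * \<langle>x\<rangle> ^ M" using assms poly_funE by blast
  have "norm (f x + g x) \<le> (C + D) * \<langle>x\<rangle> ^ (max N M)" for x
  proof -
    have "C * \<langle>x\<rangle> ^ N \<le> C * \<langle>x\<rangle> ^ (max N M)" "D * \<langle>x\<rangle> ^ M \<le> D * \<langle>x\<rangle> ^ (max N M)"
      using C(1) D(1) by (auto intro!: power_increasing japanese_ge_1)
    then show ?thesis using C(2)[of x] D(2)[of x] norm_triangle_ineq[of "f x" "g x"]
      unfolding distrib_right by linarith
  qed
  then show ?thesis unfolding poly_fun_def by blast
qed

lemma rapid_fun_add:
  assumes "rapid_fun f" "rapid_fun g" shows "rapid_fun (\<lambda>x. f x + g x)"
  unfolding rapid_fun_def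
proof
  fix N
  obtain C where C: "\<And>x. \<langle>x\<rangle> ^ N * norm (f x) \<le> C" using assms rapid_funE by blast
  obtain D where D: "\<And>x. \<langle>x\<rangle> ^ N * norm (g x) \<le> D" using assms rapid_funE by blast
  have "\<langle>x\<rangle> ^ N * norm (f x + g x) \<le> \<langle>x\<rangle> ^ N * (norm (f x) + norm (g x))" for x
    by (intro mult_left_mono norm_triangle_ineq zero_le_power japanese_nonneg)
  then have "\<langle>x\<rangle> ^ N * norm (f x + g x) \<le> C + D" for x
    using C[of x] D[of x] unfolding distrib_left by (meson add_mono order.trans)
  then show "\<exists>C. \<forall>x. \<langle>x\<rangle> ^ N * norm (f x + g x) \<le> C" by blast
qed

lemma bdd_fun_mult:
  fixes f g :: "real ^ 'n \<Rightarrow> 'b::real_normed_field"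
  assumes "bdd_fun f" "bdd_fun g" shows "bdd_fun (\<lambda>x. f x * g x)"
proof -
  obtain C where C: "C > 0" "\<And>x. norm (f x) \<le> C" using assms bdd_funE by blast
  obtain D where D: "D > 0" "\<And>x. norm (g x) \<le> D" using assms bdd_funE by blast
  have "norm (f x * g x) \<le> C * D" for x unfolding norm_mult
    by (intro mult_mono) (use C D in \<open>auto intro: less_imp_le\<close>)
  then show ?thesis unfolding bdd_fun_def by blast
qed

lemma poly_fun_mult:
  fixes f g :: "real ^ 'n \<Rightarrow> 'b::real_normed_field"
  assumes "poly_fun f" "poly_fun g" shows "poly_fun (\<lambda>x. f x * g x)"
proof -
  obtain C N where C: "C > 0" "\<And>x. norm (f x) \<le> C * \<langle>x\<rangle> ^ N" using assms poly_funE by blast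
  obtain D M where D: "D > 0" "\<And>x. norm (g x) \<le> D * \<langle>x\<rangle> ^ M" using assms poly_funE by blast
  have "norm (f x * g x) \<le> (C * D) * \<langle>x\<rangle> ^ (N + M)" for x
  proof -
    have "norm (f x * g x) \<le> (C * \<langle>x\<rangle> ^ N) * (D * \<langle>x\<rangle> ^ M)"
      unfolding norm_mult using C D japanese_nonneg[of x] by (intro mult_mono) auto
    then show ?thesis by (simp add: power_add mult_ac)
  qed
  then show ?thesis unfolding poly_fun_def by blast
qed

lemma rapid_fun_mult:
  fixes f g :: "real ^ 'n \<Rightarrow> 'b::real_normed_field"
  assumes "poly_fun f" "rapid_fun g" shows "rapid_fun (\<lambda>x. f x * g x)"
  unfolding rapid_fun_def
proof
  fix N
  obtain C M where C: "C > 0" "\<And>x. norm (f x) \<le> C * \<langle>x\<rangle> ^ M" using assms poly_funE by blast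
  obtain D where D: "\<And>x. \<langle>x\<rangle> ^ (N + M) * norm (g x) \<le> D" using assms rapid_funE by blast
  have "\<langle>x\<rangle> ^ N * norm (f x * g x) \<le> C * D" for x
  proof -
    have "\<langle>x\<rangle> ^ N * norm (f x * g x) \<le> \<langle>x\<rangle> ^ N * ((C * \<langle>x\<rangle> ^ M) * norm (g x))"
      unfolding norm_mult using C japanese_nonneg[of x] by (intro mult_left_mono mult_right_mono) auto
    also have "\<dots> = C * (\<langle>x\<rangle> ^ (N + M) * norm (g x))" by (simp add: power_add mult_ac)
    also have "\<dots> \<le> C * D" using C(1) D by simp
    finally show ?thesis .
  qed
  then show "\<exists>C. \<forall>x. \<langle>x\<rangle> ^ N * norm (f x * g x) \<le> C" by blast
qed

lemma poly_fun_bdd_fun: "bdd_fun f \<Longrightarrow> poly_fun f"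
  unfolding poly_fun_def bdd_fun_def by (erule exE, rule_tac x = C in exI, rule exI[of _ 0]) simp

lemma bdd_fun_rapid_fun: "rapid_fun f \<Longrightarrow> bdd_fun f"
  unfolding bdd_fun_def rapid_fun_def by (drule spec[of _ 0]) simp

section \<open>Basic slow and tame functions\<close>

lemma smooth_with_const: "Q (\<lambda>x. c) \<Longrightarrow> Q (\<lambda>x. 0) \<Longrightarrow> smooth_with Q (\<lambda>x. c)"
  by (rule smooth_with_coinduct[where X = "{\<lambda>x. c, \<lambda>x. 0}"]) auto

lemma slow_const: "smooth_with poly_fun (\<lambda>x. c)"
  by (rule smooth_with_const) (auto intro!: poly_fun_bdd_fun simp: bdd_fun_def)

lemma slow_component: "smooth_with poly_fun (\<lambda>x::real ^ 'n. x $ i)"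
proof (rule smooth_with_coinduct[where X = "insert (\<lambda>x. x $ i) (range (\<lambda>c x. c))"], goal_cases)
  case 1 then show ?case by simp
next
  case (2 g)
  have "poly_fun (\<lambda>x::real^'n. x $ i)" unfolding poly_fun_def
    by (rule exI[of _ 1], rule exI[of _ 1])
       (simp, metis component_le_norm_cart japanese_ge_norm order.trans)
  moreover have "poly_fun (\<lambda>x::real^'n. c)" for c :: real
    by (auto intro!: poly_fun_bdd_fun simp: bdd_fun_def)
  moreover have "(\<lambda>x. x $ i) differentiable (at x)" for x :: "real^'n"
    using bounded_linear_vec_nth[of i] bounded_linear_imp_differentiable by blast
  ultimately show ?case using 2 by (auto simp: partial_component)
qed

lemma smooth_with_of_real:
  fixes f :: "real ^ 'n \<Rightarrow> real"
  assumes "smooth_with Q f" "\<And>g. Q g \<Longrightarrow> R (\<lambda>x. complex_of_real (g x))"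
  shows "smooth_with R (\<lambda>x. complex_of_real (f x))"
  by (rule smooth_with_bounded_linear[OF assms(1) bounded_linear_of_real]) (rule assms(2))

lemma slow_of_real:
  "smooth_with poly_fun f \<Longrightarrow> smooth_with poly_fun (\<lambda>x. complex_of_real (f x))"
  by (erule smooth_with_of_real) (simp add: poly_fun_def)

lemma tame_of_real:
  "smooth_with bdd_fun f \<Longrightarrow> smooth_with bdd_fun (\<lambda>x. complex_of_real (f x))"
  by (erule smooth_with_of_real) (simp add: bdd_fun_def)

lemmas slow_add = smooth_with_add[where Q = poly_fun, OF _ _ poly_fun_add]
lemmas slow_mult = smooth_with_mult[where Q = poly_fun and R = poly_fun, OF _ _ poly_fun_mult poly_fun_add]
lemmas tame_add = smooth_with_add[where Q = bdd_fun, OF _ _ bdd_fun_add]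
lemmas tame_mult = smooth_with_mult[where Q = bdd_fun and R = bdd_fun, OF _ _ bdd_fun_mult bdd_fun_add]

lemma slow_tame: "smooth_with bdd_fun f \<Longrightarrow> smooth_with poly_fun f"
  by (erule smooth_with_mono) (rule poly_fun_bdd_fun)

text \<open>The products b cis(ta) with slow b form a family closed under differentiation: only the
  amplitude changes, to \<partial>_i b + it (\<partial>_i a) b. This makes exp(-ita) a multiplier on
  Schwartz functions.\<close>

lemma slow_cis:
  fixes a :: "real ^ 'n \<Rightarrow> real"
  assumes a: "smooth_with poly_fun a"
  shows "smooth_with poly_fun (\<lambda>x. cis (t * a x))"
proof (rule smooth_with_coinduct[where X = "{\<lambda>x. b x * cis (t * a x) | b. smooth_with poly_fun b}"], goal_cases)
  case 1 show ?case using slow_const[of 1] by force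
next
  case (2 h)
  then obtain b where b: "smooth_with poly_fun b" "h = (\<lambda>x. b x * cis (t * a x))" by auto
  have pc: "((\<lambda>x. cis (t * a x)) has_derivative
      (\<lambda>h. (\<i> * t * frechet_derivative a (at x) h) * cis (t * a x))) (at x)" for x
  proof -
    have "(a has_derivative frechet_derivative a (at x)) (at x)"
      using smooth_withD(1)[OF a] by (simp add: frechet_derivative_works)
    then have "((\<lambda>x. \<i> * of_real (t * a x)) has_derivative
        (\<lambda>h. \<i> * of_real (t * frechet_derivative a (at x) h))) (at x)"
      by (intro has_derivative_mult_right has_derivative_of_real)
    from has_derivative_compose[OF this, of exp "\<lambda>h. h * exp (\<i> * of_real (t * a x))"]
    show ?thesis unfolding cis_conv_exp
      by (simp add: mult_ac has_field_derivative_imp_has_derivative[OF DERIV_exp, unfolded mult.commute[of "exp _"]])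
  qed
  have "h differentiable (at x)" for x unfolding b(2)
    by (intro differentiable_mult smooth_withD(1)[OF b(1)]) (use pc in \<open>auto simp: differentiable_def\<close>)
  moreover have "partial i h = (\<lambda>x. (partial i b x + \<i> * t * partial i a x * b x) * cis (t * a x))" for i
    unfolding b(2)
  proof
    fix x
    have d: "(\<lambda>x. cis (t * a x)) differentiable (at x)" using pc unfolding differentiable_def by blast
    show "partial i (\<lambda>x. b x * cis (t * a x)) x =
        (partial i b x + \<i> * t * partial i a x * b x) * cis (t * a x)"
      unfolding partial_mult[OF smooth_withD(1)[OF b(1)] d] partial_eqI[OF pc]
      by (simp add: partial_def algebra_simps)
  qed
  moreover have "smooth_with poly_fun (\<lambda>x. partial i b x + \<i> * t * partial i a x * b x)" for i
    by (intro slow_add slow_mult slow_const slow_of_real smooth_with_partial a b)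
  moreover have "poly_fun h" unfolding b(2)
    by (intro poly_fun_mult smooth_withD(2)[OF b(1)] poly_fun_bdd_fun) (auto simp: bdd_fun_def)
  ultimately show ?case by (intro conjI allI CollectI exI) auto
qed

text \<open>The family consists of b f^(-m) with tame b and arbitrary m. Differentiation raises m by
  one and keeps the numerator tame, and the lower bound c makes every power of 1/f bounded.\<close>

lemma tame_inverse:
  fixes f :: "real ^ 'n \<Rightarrow> real"
  assumes f: "smooth_with bdd_fun f" and c: "c > 0" "\<And>x. f x \<ge> c"
  shows "smooth_with bdd_fun (\<lambda>x. inverse (f x))"
proof (rule smooth_with_coinduct[where X = "{\<lambda>x. b x * inverse (f x) ^ m | b m. smooth_with bdd_fun b}"],
    goal_cases)
  case 1
  have "smooth_with bdd_fun (\<lambda>x::real^'n. 1::real)" by (rule smooth_with_const) (auto simp: bdd_fun_def)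
  moreover have "(\<lambda>x. inverse (f x)) = (\<lambda>x. 1 * inverse (f x) ^ 1)" by simp
  ultimately show ?case by (intro CollectI exI conjI)
next
  case (2 h)
  then obtain b m where b: "smooth_with bdd_fun b" "h = (\<lambda>x. b x * inverse (f x) ^ m)" by auto
  have f0: "f x \<noteq> 0" for x using c(1) c(2)[of x] by auto
  have pc: "((\<lambda>x. inverse (f x) ^ m) has_derivative
      (\<lambda>h. - (real m * frechet_derivative f (at x) h) * inverse (f x) ^ (Suc m))) (at x)" for x
  proof -
    have "(f has_derivative frechet_derivative f (at x)) (at x)"
      using smooth_withD(1)[OF f] by (simp add: frechet_derivative_works)
    then show ?thesis
      by (auto intro!: derivative_eq_intros simp: f0 fun_eq_iff)
         (cases m; simp add: f0 field_simps)
  qed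
  have "h differentiable (at x)" for x unfolding b(2)
    by (intro differentiable_mult smooth_withD(1)[OF b(1)]) (use pc in \<open>auto simp: differentiable_def\<close>)
  moreover have "partial i h = (\<lambda>x. (partial i b x * f x + (- real m) * (partial i f x * b x)) * inverse (f x) ^ (Suc m))" for i
    unfolding b(2)
  proof
    fix x
    have d: "(\<lambda>x. inverse (f x) ^ m) differentiable (at x)" using pc unfolding differentiable_def by blast
    show "partial i (\<lambda>x. b x * inverse (f x) ^ m) x =
        (partial i b x * f x + (- real m) * (partial i f x * b x)) * inverse (f x) ^ (Suc m)"
      unfolding partial_mult[OF smooth_withD(1)[OF b(1)] d] partial_eqI[OF pc]
      by (simp add: partial_def f0 field_simps)
  qed
  moreover have "smooth_with bdd_fun (\<lambda>x. partial i b x * f x + (- real m) * (partial i f x * b x))" for i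
    by (intro tame_add tame_mult smooth_with_partial f b smooth_with_const) (auto simp: bdd_fun_def)
  moreover have "bdd_fun h"
  proof -
    have "bdd_fun (\<lambda>x. inverse (f x) ^ m)" unfolding bdd_fun_def
    proof (intro exI allI)
      fix x
      have "inverse (f x) \<le> inverse c" "0 \<le> inverse (f x)" using c(1) c(2)[of x] by (auto intro: le_imp_inverse_le)
      then show "norm (inverse (f x) ^ m) \<le> inverse c ^ m"
        by (simp add: power_abs[symmetric] power_mono abs_of_nonneg del: power_inverse inverse_nonnegative_iff_nonnegative)
    qed
    then show ?thesis unfolding b(2) using smooth_withD(2)[OF b(1)] bdd_fun_mult by blast
  qed
  ultimately show ?case by (intro conjI allI CollectI exI) assumption+
qed

section \<open>Closure properties of Schwartz functions\<close>

lemma schwartz_iff: "schwartz f \<longleftrightarrow> smooth_with rapid_fun f"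
  unfolding schwartz_def smooth_with_def smooth_on_def rapid_fun_def by (simp add: all_conj_distrib)

lemma schwartz_add: "schwartz f \<Longrightarrow> schwartz g \<Longrightarrow> schwartz (\<lambda>x. f x + g x)"
  unfolding schwartz_iff by (rule smooth_with_add) (auto intro: rapid_fun_add)

lemma schwartz_slow_mult: "smooth_with poly_fun b \<Longrightarrow> schwartz f \<Longrightarrow> schwartz (\<lambda>x. b x * f x)"
  unfolding schwartz_iff
  by (rule smooth_with_mult[where Q = poly_fun and R = rapid_fun]) (auto intro: rapid_fun_add rapid_fun_mult)

lemma schwartz_cmult: "schwartz f \<Longrightarrow> schwartz (\<lambda>x. c * f x)"
  by (intro schwartz_slow_mult slow_const)

lemma schwartz_partial: "schwartz f \<Longrightarrow> schwartz (partial i f)"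
  unfolding schwartz_iff by (rule smooth_with_partial)

lemma schwartz_measurable [measurable_dest]: "schwartz f \<Longrightarrow> f \<in> borel_measurable borel"
  unfolding schwartz_iff by (rule smooth_with_measurable)

lemma schwartz_differentiable: "schwartz f \<Longrightarrow> f differentiable (at x)"
  unfolding schwartz_iff by (erule smooth_withD(1))

lemma schwartz_rapid: "schwartz f \<Longrightarrow> rapid_fun f"
  unfolding schwartz_iff by (erule smooth_withD(2))

lemma schwartz_continuous: "schwartz f \<Longrightarrow> continuous_on A f"
  unfolding schwartz_iff by (erule smooth_withD(3))

lemma schwartz_zero: "schwartz (\<lambda>x. 0)"
  unfolding schwartz_iff by (rule smooth_with_const) (auto simp: rapid_fun_def)

lemma schwartz_sum: "(\<And>i. i \<in> I \<Longrightarrow> schwartz (f i)) \<Longrightarrow> schwartz (\<lambda>x. \<Sum>i\<in>I. f i x)"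
  by (induction I rule: infinite_finite_induct) (auto intro: schwartz_zero schwartz_add)

subsection \<open>Gaussian integrals and integrable weights\<close>

lemma Basis_real_vec: "(Basis :: (real ^ 'n) set) = range (\<lambda>i. axis i 1)"
  by (auto simp: Basis_vec_def)

text \<open>\<open>lborel\<close> is the image of the product measure over \<open>Basis\<close>,
  whose elements are the vectors \<open>axis i 1\<close>; \<open>v\<close> recovers the index of a
  basis vector. Fubini for products of one-variable functions is thus carried over to
  coordinates.\<close>

lemma lborel_prod_fun:
  fixes w :: "'n::finite \<Rightarrow> real \<Rightarrow> complex"
  assumes w: "\<And>i. integrable lborel (w i)"
  shows "integrable lborel (\<lambda>x::real ^ 'n. \<Prod>i\<in>UNIV. w i (x $ i))" (is ?A)
    and "(LINT x|lborel. (\<Prod>i\<in>UNIV. w i ((x::real ^ 'n) $ i))) = (\<Prod>i\<in>UNIV. (LINT y|lborel. w i y))" (is ?B)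
proof -
  interpret product_sigma_finite "\<lambda>_::real^'n. lborel :: real measure" ..
  define v where "v = (\<lambda>b::real^'n. THE i. b = axis i 1)"
  have inj: "inj (\<lambda>i::'n. axis i (1::real))" by (auto simp: inj_on_def axis_eq_axis)
  have v: "v (axis i 1) = i" for i unfolding v_def by (rule the_equality) (auto simp: axis_eq_axis)
  define W where "W b = w (v b)" for b
  have [measurable]: "w i \<in> borel_measurable borel" for i using borel_measurable_integrable[OF w[of i]] by simp
  have prodW: "(\<Prod>i\<in>UNIV. w i ((\<Sum>b\<in>Basis. f b *\<^sub>R b :: real^'n) $ i)) = (\<Prod>b\<in>Basis. W b (f b))" for f
  proof -
    have "(\<Sum>b\<in>Basis. f b *\<^sub>R b :: real^'n) $ i = f (axis i 1)" for i
    proof -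
      have "(\<Sum>b\<in>Basis. f b *\<^sub>R b :: real^'n) $ i = (\<Sum>b\<in>Basis. f b *\<^sub>R b :: real^'n) \<bullet> axis i 1"
        by (simp add: cart_eq_inner_axis)
      also have "\<dots> = f (axis i 1)" by (subst inner_sum_left_Basis) auto
      finally show ?thesis .
    qed
    then show ?thesis
      by (simp add: Basis_real_vec prod.reindex[OF inj] W_def v)
  qed
  have m: "(\<lambda>f. \<Sum>b\<in>Basis. f b *\<^sub>R b :: real^'n) \<in> measurable (Pi\<^sub>M Basis (\<lambda>_. lborel)) borel" by measurable
  have W: "integrable lborel (W b)" for b unfolding W_def by (rule w)
  show ?A
    by (subst lborel_eq, subst integrable_distr_eq[OF m])
       (simp, simp only: prodW, simp add: product_integrable_prod W)
  show ?B
    by (subst lborel_eq, subst integral_distr[OF m])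
       (simp, simp only: prodW, simp add: product_integral_prod W,
        simp add: Basis_real_vec prod.reindex[OF inj] W_def v)
qed

lemma inner_vec_real: "(x::real^'n) \<bullet> y = (\<Sum>i\<in>UNIV. x $ i * y $ i)"
  by (simp add: inner_vec_def)

lemma norm_sq_vec: "(norm (x::real^'n))\<^sup>2 = (\<Sum>i\<in>UNIV. (x $ i)\<^sup>2)"
  unfolding power2_norm_eq_inner by (simp add: inner_vec_def power2_eq_square)

lemma cis_measurable [measurable]: "cis \<in> borel_measurable borel"
  by (intro borel_measurable_continuous_onI continuous_intros)

lemma cis_sum: "finite I \<Longrightarrow> cis (\<Sum>i\<in>I. f i) = (\<Prod>i\<in>I. cis (f i))"
  by (induction I rule: finite_induct) (auto simp flip: cis_mult)

lemma fourier_prod_fun: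
  fixes w :: "'n::finite \<Rightarrow> real \<Rightarrow> complex"
  assumes w: "\<And>i. integrable lborel (w i)"
  shows "(LINT x|lborel. cis (x \<bullet> \<zeta>) * (\<Prod>i\<in>UNIV. w i ((x::real ^ 'n) $ i))) =
    (\<Prod>i\<in>UNIV. (LINT y|lborel. cis (y * \<zeta> $ i) * w i y))"
proof -
  have "integrable lborel (\<lambda>y. cis (y * \<zeta> $ i) * w i y)" for i
    using w[of i] by (rule Bochner_Integration.integrable_bound)
      (use borel_measurable_integrable[OF w[of i]] in \<open>auto simp: norm_mult\<close>)
  from lborel_prod_fun(2)[of "\<lambda>i y. cis (y * \<zeta> $ i) * w i y", OF this]
  show ?thesis
    by (simp add: inner_vec_real cis_sum prod.distrib)
qed

lemma cis_eq_iexp: "cis t = iexp t" by (simp add: cis_conv_exp)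

text \<open>Apart from integrability this is the characteristic function of the standard normal
  distribution, rescaled by s = sqrt \<epsilon>.\<close>

lemma gauss_integral_1:
  assumes "\<epsilon> > 0"
  shows "integrable lborel (\<lambda>y. complex_of_real (exp (- (\<epsilon> * y\<^sup>2) / 2)))"
    and "(LINT y|lborel. cis (y * \<zeta>) * complex_of_real (exp (- (\<epsilon> * y\<^sup>2) / 2))) =
      complex_of_real (sqrt (2 * pi / \<epsilon>) * exp (- \<zeta>\<^sup>2 / (2 * \<epsilon>)))"
proof -
  have std: "(LINT x|lborel. iexp (t * x) * complex_of_real (exp (- (x\<^sup>2) / 2))) = sqrt (2 * pi) * exp (- (t\<^sup>2) / 2)" for t
  proof -
    have "complex_of_real (exp (- (t\<^sup>2) / 2)) = char std_normal_distribution t"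
      by (simp add: char_std_normal_distribution)
    also have "\<dots> = (LINT x|lborel. std_normal_density x *\<^sub>R iexp (t * x))"
      unfolding char_def by (subst integral_density) (auto simp: normal_density_nonneg)
    also have "\<dots> = (LINT x|lborel. (1 / sqrt (2 * pi)) * (iexp (t * x) * complex_of_real (exp (- (x\<^sup>2) / 2))))"
      unfolding std_normal_density_def
      by (intro Bochner_Integration.integral_cong) (auto simp: scaleR_conv_of_real)
    also have "\<dots> = (1 / sqrt (2 * pi)) * (LINT x|lborel. (iexp (t * x) * complex_of_real (exp (- (x\<^sup>2) / 2))))"
      by (rule integral_mult_right_zero)
    finally show ?thesis by (simp add: field_simps)
  qed
  define s where "s = sqrt \<epsilon>"
  have s: "s > 0" "s\<^sup>2 = \<epsilon>" using assms by (auto simp: s_def)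
  have I1: "integrable lborel (\<lambda>y. exp (- (y\<^sup>2) / 2) :: real)"
  proof -
    have "integrable lborel (\<lambda>y. sqrt (2 * pi) * std_normal_density y)"
      by (intro integrable_mult_right integrable_normal_density) auto
    then show ?thesis by (simp add: std_normal_density_def)
  qed
  from lborel_integrable_real_affine[OF this, of s 0] s
  have "integrable lborel (\<lambda>y. exp (- (\<epsilon> * y\<^sup>2) / 2))"
    by (simp add: power_mult_distrib)
  then show "integrable lborel (\<lambda>y. complex_of_real (exp (- (\<epsilon> * y\<^sup>2) / 2)))"
    by (rule integrable_of_real)
  have "sqrt (2 * pi) * exp (- ((\<zeta> / s)\<^sup>2) / 2) =
      (LINT x|lborel. iexp ((\<zeta> / s) * x) * complex_of_real (exp (- (x\<^sup>2) / 2)))"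
    by (rule std[symmetric])
  also have "\<dots> = \<bar>s\<bar> *\<^sub>R (LINT y|lborel. iexp ((\<zeta> / s) * (0 + s * y)) * complex_of_real (exp (- ((0 + s * y)\<^sup>2) / 2)))"
    by (rule lborel_integral_real_affine) (use s in auto)
  also have "\<dots> = s * (LINT y|lborel. cis (y * \<zeta>) * complex_of_real (exp (- (\<epsilon> * y\<^sup>2) / 2)))"
    using s by (simp add: scaleR_conv_of_real power_mult_distrib cis_eq_iexp mult_ac)
  finally show "(LINT y|lborel. cis (y * \<zeta>) * complex_of_real (exp (- (\<epsilon> * y\<^sup>2) / 2))) =
      complex_of_real (sqrt (2 * pi / \<epsilon>) * exp (- \<zeta>\<^sup>2 / (2 * \<epsilon>)))"
    using s assms by (simp add: real_sqrt_divide s_def[symmetric] power_divide field_simps)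
qed

lemma prod_of_real_exp:
  "(\<Prod>i\<in>UNIV. complex_of_real (exp (- (\<epsilon> * ((x::real^'n) $ i)\<^sup>2) / 2))) = complex_of_real (exp (- (\<epsilon> * (norm x)\<^sup>2) / 2))"
  by (simp add: norm_sq_vec sum_distrib_left exp_sum[symmetric] sum_negf sum_divide_distrib
      flip: of_real_prod)

lemma gauss_fourier:
  assumes "\<epsilon> > 0"
  shows "integrable lborel (\<lambda>x::real^'n. exp (- (\<epsilon> * (norm x)\<^sup>2) / 2))"
    and "(LINT x|lborel. cis ((x::real^'n) \<bullet> \<zeta>) * complex_of_real (exp (- (\<epsilon> * (norm x)\<^sup>2) / 2))) =
      complex_of_real (sqrt (2 * pi / \<epsilon>) ^ CARD('n) * exp (- (norm \<zeta>)\<^sup>2 / (2 * \<epsilon>)))"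
proof -
  have "integrable lborel (\<lambda>x::real^'n. complex_of_real (exp (- (\<epsilon> * (norm x)\<^sup>2) / 2)))"
    using lborel_prod_fun(1)[where 'n = 'n, OF gauss_integral_1(1)[OF assms]] unfolding prod_of_real_exp .
  then have "integrable lborel (\<lambda>x::real^'n. Re (complex_of_real (exp (- (\<epsilon> * (norm x)\<^sup>2) / 2))))"
    by (rule integrable_Re)
  then show "integrable lborel (\<lambda>x::real^'n. exp (- (\<epsilon> * (norm x)\<^sup>2) / 2))" by simp
  have "(\<Prod>i\<in>UNIV. complex_of_real (sqrt (2 * pi / \<epsilon>) * exp (- (\<zeta> $ i)\<^sup>2 / (2 * \<epsilon>)))) =
    complex_of_real (sqrt (2 * pi / \<epsilon>) ^ CARD('n) * exp (- (norm \<zeta>)\<^sup>2 / (2 * \<epsilon>)))"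
    unfolding of_real_prod[symmetric] prod.distrib prod_constant norm_sq_vec
    by (simp add: exp_sum[symmetric] sum_negf sum_divide_distrib)
  then show "(LINT x|lborel. cis ((x::real^'n) \<bullet> \<zeta>) * complex_of_real (exp (- (\<epsilon> * (norm x)\<^sup>2) / 2))) =
      complex_of_real (sqrt (2 * pi / \<epsilon>) ^ CARD('n) * exp (- (norm \<zeta>)\<^sup>2 / (2 * \<epsilon>)))"
    using fourier_prod_fun[where 'n = 'n and \<zeta> = \<zeta>, OF gauss_integral_1(1)[OF assms]]
    unfolding prod_of_real_exp gauss_integral_1(2)[OF assms] by simp
qed

lemma gauss_integral:
  assumes "\<epsilon> > 0"
  shows "(LINT x|lborel. exp (- (\<epsilon> * (norm (x::real^'n))\<^sup>2) / 2)) = sqrt (2 * pi / \<epsilon>) ^ CARD('n)"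
proof -
  have "complex_of_real (LINT x|lborel. exp (- (\<epsilon> * (norm (x::real^'n))\<^sup>2) / 2)) =
    (LINT x|lborel. cis ((x::real^'n) \<bullet> 0) * complex_of_real (exp (- (\<epsilon> * (norm x)\<^sup>2) / 2)))"
    by (simp flip: integral_complex_of_real)
  also have "\<dots> = complex_of_real (sqrt (2 * pi / \<epsilon>) ^ CARD('n))"
    by (subst gauss_fourier(2)[OF assms]) simp
  finally show ?thesis by (simp only: of_real_eq_iff)
qed

text \<open>The threshold 1/2: off [-1, 1] the weight is at most |x|^(-2s), which is integrable at
  infinity because 2s > 1. The left tail is the reflection of the right one.\<close>

lemma integrable_bracket_1:
  assumes "s > 1 / 2"
  shows "integrable lborel (\<lambda>y::real. (1 + y\<^sup>2) powr (- s))"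
proof -
  have hi: "((\<lambda>x. x powr (- 2 * s)) has_integral -(1 powr (- 2 * s + 1)) / (- 2 * s + 1)) {1..}"
    by (rule has_integral_powr_to_inf) (use assms in auto)
  then have "((\<lambda>x. if x \<in> {1..} then x powr (- 2 * s) else 0) has_integral -(1 powr (- 2 * s + 1)) / (- 2 * s + 1)) UNIV"
    unfolding has_integral_restrict_UNIV .
  from nn_integral_has_integral_lborel[OF _ _ this]
  have "(\<integral>\<^sup>+x. ennreal (if x \<in> {1..} then x powr (- 2 * s) else 0) \<partial>lborel) < \<infinity>"
    by simp
  then have I: "integrable lborel (\<lambda>x::real. if x \<in> {1..} then x powr (- 2 * s) else 0)"
    by (intro integrableI_nonneg) auto
  from lborel_integrable_real_affine[OF this, of "-1" 0]
  have J: "integrable lborel (\<lambda>x::real. if - x \<in> {1..} then (- x) powr (- 2 * s) else 0)" by (simp cong: if_cong)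
  have K: "integrable lborel (\<lambda>x::real. indicator {-1..1} x :: real)" by (simp add: integrable_indicator_iff)
  show ?thesis
  proof (rule Bochner_Integration.integrable_bound[OF Bochner_Integration.integrable_add[OF K Bochner_Integration.integrable_add[OF I J]]])
    show "AE x in lborel. norm ((1 + x\<^sup>2) powr - s) \<le>
      norm (indicat_real {- 1..1} x +
         ((if x \<in> {1..} then x powr (- 2 * s) else 0) + (if - x \<in> {1..} then (- x) powr (- 2 * s) else 0)))"
    proof (rule AE_I2)
      fix x :: real
      have "(1 + x\<^sup>2) powr - s \<le> (1 + x\<^sup>2) powr 0" using assms by (intro powr_mono) auto
      moreover have "1 + x\<^sup>2 \<noteq> 0" by (metis add_pos_nonneg less_irrefl zero_le_power2 zero_less_one)
      ultimately have "(1 + x\<^sup>2) powr - s \<le> 1" by simp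
      moreover have "(1 + x\<^sup>2) powr - s \<le> \<bar>x\<bar> powr (- 2 * s)" if "\<bar>x\<bar> \<ge> 1"
      proof -
        have "(1 + x\<^sup>2) powr - s \<le> (x\<^sup>2) powr - s"
          by (rule powr_mono2') (use assms that in auto)
        also have "x\<^sup>2 powr - s = (\<bar>x\<bar> powr 2) powr - s" using that by (subst powr_numeral) auto
        also have "\<dots> = \<bar>x\<bar> powr (- 2 * s)" by (rule powr_powr[THEN trans]) simp
        finally show ?thesis .
      qed
      ultimately show "norm ((1 + x\<^sup>2) powr - s) \<le>
      norm (indicat_real {- 1..1} x +
         ((if x \<in> {1..} then x powr (- 2 * s) else 0) + (if - x \<in> {1..} then (- x) powr (- 2 * s) else 0)))"
        by (auto simp: indicator_def split: if_splits)
    qed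
  qed measurable
qed

section \<open>Integrable weights and substitutions in n variables\<close>

lemma component_le_japanese: "1 + ((x::real^'n) $ i)\<^sup>2 \<le> \<langle>x\<rangle>\<^sup>2"
  unfolding japanese_sq norm_sq_vec by (simp, rule member_le_sum) auto

text \<open>Each 1 + x_i^2 is at most \<langle>x\<rangle>^2, so \<langle>x\<rangle>^(-2n) is
  dominated by the product of the one-variable weights (1 + x_i^2)^(-1).\<close>

lemma integrable_japanese:
  "integrable lborel (\<lambda>x::real^'n. inverse (\<langle>x\<rangle> ^ (2 * CARD('n))))"
proof -
  have "integrable lborel (\<lambda>y::real. complex_of_real ((1 + y\<^sup>2) powr (- 1)))"
    by (intro integrable_of_real integrable_bracket_1) simp
  from lborel_prod_fun(1)[where 'n = 'n, OF this]
  show ?thesis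
  proof (rule Bochner_Integration.integrable_bound)
    show "AE x::real^'n in lborel. norm (inverse (\<langle>x\<rangle> ^ (2 * CARD('n)))) \<le>
       norm (\<Prod>i\<in>UNIV. complex_of_real ((1 + (x $ i)\<^sup>2) powr - 1))"
    proof (rule AE_I2)
      fix x :: "real^'n"
      have pos: "1 + (x $ i)\<^sup>2 > 0" for i by (simp add: add_pos_nonneg)
      have "(\<Prod>i\<in>(UNIV::'n set). 1 + (x $ i)\<^sup>2) \<le> (\<Prod>i\<in>(UNIV::'n set). \<langle>x\<rangle>\<^sup>2)"
        by (intro prod_mono) (auto simp: component_le_japanese)
      then have "(\<Prod>i\<in>(UNIV::'n set). 1 + (x $ i)\<^sup>2) \<le> \<langle>x\<rangle> ^ (2 * CARD('n))" by (simp add: power_mult)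
      then have "inverse (\<langle>x\<rangle> ^ (2 * CARD('n))) \<le> inverse (\<Prod>i\<in>(UNIV::'n set). 1 + (x $ i)\<^sup>2)"
        by (intro le_imp_inverse_le) (auto intro!: prod_pos pos)
      also have "\<dots> = (\<Prod>i\<in>UNIV. inverse (1 + (x $ i)\<^sup>2))"
        using prod_inversef[of "\<lambda>i. 1 + (x $ i)\<^sup>2" "UNIV::'n set"] by (simp add: o_def)
      also have "\<dots> = (\<Prod>i\<in>UNIV. (1 + (x $ i)\<^sup>2) powr - 1)"
        using pos by (intro prod.cong refl) (simp add: powr_minus powr_one)
      also have "\<dots> = norm (\<Prod>i\<in>UNIV. complex_of_real ((1 + (x $ i)\<^sup>2) powr - 1))"
        unfolding prod_norm[symmetric] norm_of_real by simp
      finally show "norm (inverse (\<langle>x\<rangle> ^ (2 * CARD('n)))) \<le> norm (\<Prod>i\<in>UNIV. complex_of_real ((1 + (x $ i)\<^sup>2) powr - 1))"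
        using japanese_nonneg[of x] by simp
    qed
  qed measurable
qed

lemma integrable_rapid:
  fixes f :: "real^'n \<Rightarrow> complex"
  assumes [measurable]: "f \<in> borel_measurable borel" and "rapid_fun f"
  shows "integrable lborel f"
proof -
  obtain C where C: "C > 0" "\<And>x. \<langle>x\<rangle> ^ (2 * CARD('n)) * norm (f x) \<le> C" using assms(2) rapid_funE by blast
  have "integrable lborel (\<lambda>x::real^'n. C * inverse (\<langle>x\<rangle> ^ (2 * CARD('n))))"
    by (intro integrable_mult_right integrable_japanese)
  then show ?thesis
  proof (rule Bochner_Integration.integrable_bound)
    show "AE x in lborel. norm (f x) \<le> norm (C * inverse (\<langle>x\<rangle> ^ (2 * CARD('n))))"
    proof (rule AE_I2)
      fix x
      show "norm (f x) \<le> norm (C * inverse (\<langle>x\<rangle> ^ (2 * CARD('n))))"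
        using C(1) C(2)[of x] japanese_pos[of x] by (simp add: field_simps)
    qed
  qed measurable
qed

lemma lborel_affine_vec:
  fixes f :: "real^'n \<Rightarrow> 'b::{banach, second_countable_topology}" and g :: "real^'n \<Rightarrow> ennreal"
  assumes c: "c \<noteq> 0"
  shows "f \<in> borel_measurable borel \<Longrightarrow> integrable lborel f \<longleftrightarrow> integrable lborel (\<lambda>x. f (t + c *\<^sub>R x))"
    and "f \<in> borel_measurable borel \<Longrightarrow>
      (LINT x|lborel. f x) = \<bar>c\<bar> ^ CARD('n) *\<^sub>R (LINT x|lborel. f (t + c *\<^sub>R x))"
    and "g \<in> borel_measurable borel \<Longrightarrow>
      (\<integral>\<^sup>+x. g x \<partial>lborel) = ennreal (\<bar>c\<bar> ^ CARD('n)) * (\<integral>\<^sup>+x. g (t + c *\<^sub>R x) \<partial>lborel)"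
proof -
  have *: "lborel = density (distr lborel borel (\<lambda>x::real^'n. t + c *\<^sub>R x)) (\<lambda>_. \<bar>c\<bar> ^ CARD('n))"
    using lborel_affine[OF c, of t] by simp
  show "integrable lborel f \<longleftrightarrow> integrable lborel (\<lambda>x. f (t + c *\<^sub>R x))" if [measurable]: "f \<in> borel_measurable borel"
  proof -
    have "integrable lborel f \<longleftrightarrow> integrable lborel (\<lambda>x. \<bar>c\<bar> ^ CARD('n) *\<^sub>R f (t + c *\<^sub>R x))"
      by (subst *) (simp add: integrable_density integrable_distr_eq)
    also have "\<dots> \<longleftrightarrow> integrable lborel (\<lambda>x. f (t + c *\<^sub>R x))"
    proof
      assume "integrable lborel (\<lambda>x. \<bar>c\<bar> ^ CARD('n) *\<^sub>R f (t + c *\<^sub>R x))"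
      then have "integrable lborel (\<lambda>x. inverse (\<bar>c\<bar> ^ CARD('n)) *\<^sub>R \<bar>c\<bar> ^ CARD('n) *\<^sub>R f (t + c *\<^sub>R x))"
        by (rule integrable_scaleR_right)
      then show "integrable lborel (\<lambda>x. f (t + c *\<^sub>R x))" using c by simp
    qed (rule integrable_scaleR_right)
    finally show ?thesis .
  qed
  show "(LINT x|lborel. f x) = \<bar>c\<bar> ^ CARD('n) *\<^sub>R (LINT x|lborel. f (t + c *\<^sub>R x))" if [measurable]: "f \<in> borel_measurable borel"
    using c by (subst *) (simp add: integral_density integral_distr)
  show "(\<integral>\<^sup>+x. g x \<partial>lborel) = ennreal (\<bar>c\<bar> ^ CARD('n)) * (\<integral>\<^sup>+x. g (t + c *\<^sub>R x) \<partial>lborel)" if [measurable]: "g \<in> borel_measurable borel"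
    by (subst *) (simp add: nn_integral_density nn_integral_distr nn_integral_cmult)
qed

subsection \<open>The Schur test\<close>

lemma integrable_tensor:
  fixes f :: "'a::euclidean_space \<Rightarrow> 'b::{real_normed_field, banach, second_countable_topology}"
    and g :: "'c::euclidean_space \<Rightarrow> 'b"
  assumes f: "integrable lborel f" and g: "integrable lborel g"
  shows "integrable (lborel \<Otimes>\<^sub>M lborel) (\<lambda>(x, y). f x * g y)"
proof -
  have [measurable]: "f \<in> borel_measurable borel" "g \<in> borel_measurable borel"
    using borel_measurable_integrable[OF f] borel_measurable_integrable[OF g] by simp_all
  show ?thesis
    by (rule lborel_pair.Fubini_integrable) (use f g in \<open>auto simp: norm_mult\<close>)
qed

lemma borel_measurable_cnj [measurable (raw)]:
  "f \<in> borel_measurable M \<Longrightarrow> (\<lambda>x. cnj (f x)) \<in> borel_measurable M"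
  by (rule measurable_compose, assumption, intro borel_measurable_continuous_onI continuous_intros)

lemma nn_integral_translate:
  fixes g :: "real^'n \<Rightarrow> ennreal"
  assumes [measurable]: "g \<in> borel_measurable borel"
  shows "(\<integral>\<^sup>+y. g (x - y) \<partial>lborel) = (\<integral>\<^sup>+y. g y \<partial>lborel)"
    and "(\<integral>\<^sup>+y. g (y - x) \<partial>lborel) = (\<integral>\<^sup>+y. g y \<partial>lborel)"
  using lborel_affine_vec(3)[of "-1" g x] lborel_affine_vec(3)[of "1" g "-x"] by simp_all

text \<open>For T q(z) = \<integral> e(z,\<xi>) q(\<xi>) d\<xi> the squared norm of T q is the
  double integral of q(\<xi>) cnj q(\<eta>) against the kernel of T^* T. This kernel is dominated by
  the convolution kernel k, and |q(\<xi>) q(\<eta>)| by the mean of the two squares, so each half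
  integrates to mass of k times squared norm of q. Finiteness of \<mu> and |e| \<le> 1 justify
  Fubini, while the bound does not involve the mass of \<mu>; hence regularising weights in \<mu>
  can be removed afterwards. The kernel bound is asked for only where q is nonzero: this is how
  support in a piece of frequency space enters.\<close>

lemma TT_star_bound:
  fixes \<mu> :: "'z measure" and e :: "'z \<Rightarrow> real^'n \<Rightarrow> complex" and k :: "real^'n \<Rightarrow> real"
  assumes fin: "finite_measure \<mu>"
    and e[measurable]: "(\<lambda>(z, \<xi>). e z \<xi>) \<in> borel_measurable (\<mu> \<Otimes>\<^sub>M lborel)"
    and e1: "\<And>z \<xi>. norm (e z \<xi>) \<le> 1"
    and q: "integrable lborel q" and q2: "integrable lborel (\<lambda>\<xi>. (norm (q \<xi>))\<^sup>2)"
    and k: "integrable lborel k" "\<And>\<zeta>. k \<zeta> \<ge> 0"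
    and K: "\<And>\<xi> \<eta>. q \<xi> \<noteq> 0 \<Longrightarrow> q \<eta> \<noteq> 0 \<Longrightarrow> norm (LINT z|\<mu>. e z \<xi> * cnj (e z \<eta>)) \<le> k (\<xi> - \<eta>)"
  shows "(\<integral>\<^sup>+z. ennreal ((norm (LINT \<xi>|lborel. e z \<xi> * q \<xi>))\<^sup>2) \<partial>\<mu>)
    \<le> ennreal ((LINT \<zeta>|lborel. k \<zeta>) * (LINT \<xi>|lborel. (norm (q \<xi>))\<^sup>2))"
proof -
  interpret finite_measure \<mu> by fact
  interpret P: pair_sigma_finite \<mu> "lborel :: ((real^'n) \<times> (real^'n)) measure" ..
  have [measurable]: "q \<in> borel_measurable borel" using borel_measurable_integrable[OF q] by simp
  have [measurable]: "k \<in> borel_measurable borel" using borel_measurable_integrable[OF k(1)] by simp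
  define I where "I z = (LINT \<xi>|lborel. e z \<xi> * q \<xi>)" for z
  have ez[measurable]: "e z \<in> borel_measurable borel" if "z \<in> space \<mu>" for z
    using measurable_compose[OF measurable_Pair1'[OF that] e] by simp
  have eq: "integrable lborel (\<lambda>\<xi>. e z \<xi> * q \<xi>)" if [measurable]: "z \<in> space \<mu>" for z
    by (rule Bochner_Integration.integrable_bound[OF q])
       (use mult_right_mono[OF e1] in \<open>auto simp: norm_mult\<close>)
  have I_meas[measurable]: "I \<in> borel_measurable \<mu>" unfolding I_def by measurable
  have I_bd: "norm (I z) \<le> (LINT \<xi>|lborel. norm (q \<xi>))" if "z \<in> space \<mu>" for z
  proof -
    have "norm (I z) \<le> (LINT \<xi>|lborel. norm (e z \<xi> * q \<xi>))" unfolding I_def by (rule integral_norm_bound)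
    also have "\<dots> \<le> (LINT \<xi>|lborel. norm (q \<xi>))"
      by (rule integral_mono) (use integrable_norm[OF eq[OF that]] integrable_norm[OF q] mult_right_mono[OF e1]
            in \<open>auto simp: norm_mult\<close>)
    finally show ?thesis .
  qed
  have intI: "integrable \<mu> (\<lambda>z. (norm (I z))\<^sup>2)"
    by (rule integrable_const_bound[where B = "(LINT \<xi>|lborel. norm (q \<xi>))\<^sup>2"])
       (use I_bd in \<open>auto intro!: power_mono\<close>)
  define F where "F z p = (e z (fst p) * q (fst p)) * cnj (e z (snd p) * q (snd p))" for z p
  define h where "h p = norm (q (fst p)) * norm (q (snd p))" for p
  have q_norm: "integrable lborel (\<lambda>\<xi>. norm (q \<xi>))" using q by (rule integrable_norm)
  have h: "integrable lborel h"
    using integrable_tensor[OF q_norm q_norm] unfolding lborel_prod h_def by (simp add: case_prod_unfold)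
  have [measurable]: "h \<in> borel_measurable borel" using borel_measurable_integrable[OF h] by simp
  have Fh: "norm (F z p) \<le> h p" for z p
  proof -
    have "norm (F z p) = (norm (e z (fst p)) * norm (e z (snd p))) * h p"
      by (simp add: F_def h_def norm_mult mult_ac)
    also have "\<dots> \<le> 1 * h p"
      by (intro mult_right_mono mult_le_one) (auto simp: e1 h_def)
    finally show ?thesis by simp
  qed
  have e_fst: "(\<lambda>x. e (fst x) (fst (snd x))) \<in> borel_measurable (\<mu> \<Otimes>\<^sub>M (lborel :: ((real^'n) \<times> (real^'n)) measure))"
  proof -
    have "(\<lambda>x. (fst x, fst (snd x))) \<in> (\<mu> \<Otimes>\<^sub>M (lborel :: ((real^'n) \<times> (real^'n)) measure)) \<rightarrow>\<^sub>M (\<mu> \<Otimes>\<^sub>M lborel)"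
      unfolding lborel_prod[symmetric] by simp
    from measurable_compose[OF this e] show ?thesis by simp
  qed
  have e_snd: "(\<lambda>x. e (fst x) (snd (snd x))) \<in> borel_measurable (\<mu> \<Otimes>\<^sub>M (lborel :: ((real^'n) \<times> (real^'n)) measure))"
  proof -
    have "(\<lambda>x. (fst x, snd (snd x))) \<in> (\<mu> \<Otimes>\<^sub>M (lborel :: ((real^'n) \<times> (real^'n)) measure)) \<rightarrow>\<^sub>M (\<mu> \<Otimes>\<^sub>M lborel)"
      unfolding lborel_prod[symmetric] by simp
    from measurable_compose[OF this e] show ?thesis by simp
  qed
  have F_meas: "(\<lambda>(z, p). F z p) \<in> borel_measurable (\<mu> \<Otimes>\<^sub>M lborel)"
  proof -
    have "(\<lambda>x. q (fst (snd x))) \<in> borel_measurable (\<mu> \<Otimes>\<^sub>M (lborel \<Otimes>\<^sub>M (lborel :: (real^'n) measure)))"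
      "(\<lambda>x. q (snd (snd x))) \<in> borel_measurable (\<mu> \<Otimes>\<^sub>M ((lborel :: (real^'n) measure) \<Otimes>\<^sub>M lborel))"
      by measurable
    then show ?thesis
      unfolding F_def case_prod_unfold lborel_prod
      by (intro borel_measurable_times borel_measurable_cnj e_fst e_snd)
  qed
  have F_int: "integrable (\<mu> \<Otimes>\<^sub>M lborel) (\<lambda>(z, p). F z p)"
  proof (rule integrableI_bounded[OF F_meas])
    have "(\<integral>\<^sup>+x. ennreal (norm (case x of (z, p) \<Rightarrow> F z p)) \<partial>(\<mu> \<Otimes>\<^sub>M lborel))
        \<le> (\<integral>\<^sup>+x. ennreal (h (snd x)) \<partial>(\<mu> \<Otimes>\<^sub>M lborel))"
      by (intro nn_integral_mono ennreal_leI) (auto simp: Fh split: prod.splits)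
    also have "\<dots> = (\<integral>\<^sup>+z. (\<integral>\<^sup>+p. ennreal (h p) \<partial>lborel) \<partial>\<mu>)"
      by (subst P.nn_integral_snd[symmetric] lborel.nn_integral_fst[symmetric]; simp)
    also have "\<dots> < \<infinity>"
      using nn_integral_eq_integral[OF h]
      by (simp add: h_def ennreal_mult_less_top emeasure_eq_measure)
    finally show "(\<integral>\<^sup>+x. ennreal (norm (case x of (z, p) \<Rightarrow> F z p)) \<partial>(\<mu> \<Otimes>\<^sub>M lborel)) < \<infinity>" .
  qed
  have F_fst: "(LINT p|lborel. F z p) = I z * cnj (I z)" if "z \<in> space \<mu>" for z
  proof -
    have int: "integrable lborel (\<lambda>\<xi>. cnj (e z \<xi> * q \<xi>))" using eq[OF that] by (rule integrable_cnj)
    have "(LINT p|lborel. F z p) = (LINT p|(lborel \<Otimes>\<^sub>M lborel). (case p of (\<xi>, \<eta>) \<Rightarrow> (e z \<xi> * q \<xi>) * cnj (e z \<eta> * q \<eta>)))"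
      unfolding lborel_prod by (simp add: F_def case_prod_unfold)
    also have "\<dots> = (LINT \<xi>|lborel. (LINT \<eta>|lborel. (e z \<xi> * q \<xi>) * cnj (e z \<eta> * q \<eta>)))"
      using lborel_pair.integral_fst'[OF integrable_tensor[OF eq[OF that] int]] by simp
    also have "\<dots> = I z * cnj (I z)" by (simp add: I_def del: complex_cnj_mult)
    finally show ?thesis .
  qed
  define R where "R = (LINT z|\<mu>. (norm (I z))\<^sup>2)"
  have R0: "R \<ge> 0" unfolding R_def by simp
  \<comment> \<open>|I z|^2 = I z cnj (I z) is an integral over pairs p of frequencies. Fubini
    brings the integration in z inside, where it produces the kernel.\<close>
  have "complex_of_real R = (LINT z|\<mu>. I z * cnj (I z))"
    unfolding R_def by (simp add: complex_norm_square flip: integral_complex_of_real of_real_power)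
  also have "\<dots> = (LINT z|\<mu>. (LINT p|lborel. F z p))"
    by (intro Bochner_Integration.integral_cong) (auto simp: F_fst)
  also have "\<dots> = (LINT p|lborel. (LINT z|\<mu>. F z p))"
    by (rule P.Fubini_integral[OF F_int, symmetric])
  finally have R_eq: "complex_of_real R = (LINT p|lborel. (LINT z|\<mu>. F z p))" .
  have int_p: "integrable lborel (\<lambda>p. LINT z|\<mu>. F z p)"
    using P.integrable_snd[of F] F_int by simp
  \<comment> \<open>If q vanishes at one of the two frequencies no kernel bound is available, but
    then the integrand is zero. Otherwise \<open>K\<close> applies, and 2xy \<le> x^2 + y^2
    separates the two values of q.\<close>
  have bound: "norm (LINT z|\<mu>. F z p) \<le> ((norm (q (fst p)))\<^sup>2 / 2 + (norm (q (snd p)))\<^sup>2 / 2) * k (fst p - snd p)" for p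
  proof (cases "q (fst p) = 0 \<or> q (snd p) = 0")
    case True
    then have "F z p = 0" for z by (auto simp: F_def)
    then show ?thesis using k(2) by simp
  next
    case False
    have "F z p = (q (fst p) * cnj (q (snd p))) * (e z (fst p) * cnj (e z (snd p)))" for z
      by (simp add: F_def mult_ac)
    then have "norm (LINT z|\<mu>. F z p) = (norm (q (fst p)) * norm (q (snd p))) * norm (LINT z|\<mu>. e z (fst p) * cnj (e z (snd p)))"
      by (simp add: norm_mult)
    also have "\<dots> \<le> (norm (q (fst p)) * norm (q (snd p))) * k (fst p - snd p)"
      using False by (intro mult_left_mono K) auto
    also have "\<dots> \<le> ((norm (q (fst p)))\<^sup>2 / 2 + (norm (q (snd p)))\<^sup>2 / 2) * k (fst p - snd p)"
      by (intro mult_right_mono k) (use sum_squares_bound[of "norm (q (fst p))" "norm (q (snd p))"] in linarith)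
    finally show ?thesis .
  qed
  define Q where "Q = (LINT \<xi>|lborel. (norm (q \<xi>))\<^sup>2)"
  define L where "L = (LINT \<zeta>|lborel. k \<zeta>)"
  have Q: "(\<integral>\<^sup>+\<xi>. ennreal ((norm (q \<xi>))\<^sup>2) \<partial>lborel) = ennreal Q" "Q \<ge> 0"
    unfolding Q_def using q2 by (auto simp: nn_integral_eq_integral)
  have L: "(\<integral>\<^sup>+\<zeta>. ennreal (k \<zeta>) \<partial>lborel) = ennreal L" "L \<ge> 0"
    unfolding L_def using k by (auto simp: nn_integral_eq_integral)
  have half: "ennreal (u\<^sup>2 / 2) = ennreal (1 / 2) * ennreal (u\<^sup>2)" for u
    by (subst ennreal_mult[symmetric]) auto
  \<comment> \<open>Both marginals of k(\<xi> - \<eta>) have the same mass L, by translation and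
    reflection invariance.\<close>
  have tr: "(\<integral>\<^sup>+\<eta>. ennreal (k (\<xi> - \<eta>)) \<partial>lborel) = ennreal L"
      "(\<integral>\<^sup>+\<xi>. ennreal (k (\<xi> - \<eta>)) \<partial>lborel) = ennreal L" for \<xi> \<eta>
    using nn_integral_translate[of "\<lambda>\<zeta>. ennreal (k \<zeta>)"] by (simp_all add: L)
  have LQ: "ennreal (1/2 * L * Q) = ennreal (1/2) * ennreal L * ennreal Q"
    using L(2) Q(2) by (subst ennreal_mult, simp, simp, subst ennreal_mult) auto
  have ep: "ennreal ((A + B) * K) = ennreal A * ennreal K + ennreal B * ennreal K"
    if "A \<ge> 0" "B \<ge> 0" "K \<ge> 0" for A B K :: real
    using that by (simp add: distrib_right ennreal_mult)
  have part1: "(\<integral>\<^sup>+\<xi>. (\<integral>\<^sup>+\<eta>. ennreal ((norm (q \<xi>))\<^sup>2 / 2) * ennreal (k (\<xi> - \<eta>)) \<partial>lborel) \<partial>lborel) = ennreal (1/2 * L * Q)"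
  proof -
    have "(\<integral>\<^sup>+\<xi>. (\<integral>\<^sup>+\<eta>. ennreal ((norm (q \<xi>))\<^sup>2 / 2) * ennreal (k (\<xi> - \<eta>)) \<partial>lborel) \<partial>lborel)
      = (\<integral>\<^sup>+\<xi>. ennreal (1/2) * ennreal L * ennreal ((norm (q \<xi>))\<^sup>2) \<partial>lborel)"
      by (intro nn_integral_cong, subst nn_integral_cmult) (measurable, simp only: tr half mult_ac)
    also have "\<dots> = ennreal (1/2 * L * Q)"
      by (subst nn_integral_cmult) (measurable, simp only: Q(1) LQ)
    finally show ?thesis .
  qed
  have part2: "(\<integral>\<^sup>+\<xi>. (\<integral>\<^sup>+\<eta>. ennreal ((norm (q \<eta>))\<^sup>2 / 2) * ennreal (k (\<xi> - \<eta>)) \<partial>lborel) \<partial>lborel) = ennreal (1/2 * L * Q)"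
  proof -
    have "(\<integral>\<^sup>+\<xi>. (\<integral>\<^sup>+\<eta>. ennreal ((norm (q \<eta>))\<^sup>2 / 2) * ennreal (k (\<xi> - \<eta>)) \<partial>lborel) \<partial>lborel)
      = (\<integral>\<^sup>+\<eta>. (\<integral>\<^sup>+\<xi>. ennreal ((norm (q \<eta>))\<^sup>2 / 2) * ennreal (k (\<xi> - \<eta>)) \<partial>lborel) \<partial>lborel)"
      by (rule lborel_pair.Fubini') simp
    also have "\<dots> = (\<integral>\<^sup>+\<xi>. ennreal (1/2) * ennreal L * ennreal ((norm (q \<xi>))\<^sup>2) \<partial>lborel)"
      by (intro nn_integral_cong, subst nn_integral_cmult) (measurable, simp only: tr half mult_ac)
    also have "\<dots> = ennreal (1/2 * L * Q)"
      by (subst nn_integral_cmult) (measurable, simp only: Q(1) LQ)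
    finally show ?thesis .
  qed
  have "ennreal R = ennreal (norm (LINT p|lborel. (LINT z|\<mu>. F z p)))"
    using R0 by (simp flip: R_eq)
  also have "\<dots> \<le> (\<integral>\<^sup>+p. ennreal (norm (LINT z|\<mu>. F z p)) \<partial>lborel)"
    by (rule integral_norm_bound_ennreal[OF int_p])
  also have "\<dots> \<le> (\<integral>\<^sup>+p. ennreal (((norm (q (fst p)))\<^sup>2 / 2 + (norm (q (snd p)))\<^sup>2 / 2) * k (fst p - snd p)) \<partial>lborel)"
    by (intro nn_integral_mono ennreal_leI bound)
  also have "\<dots> = (\<integral>\<^sup>+p. ennreal ((norm (q (fst p)))\<^sup>2 / 2) * ennreal (k (fst p - snd p)) +
      ennreal ((norm (q (snd p)))\<^sup>2 / 2) * ennreal (k (fst p - snd p)) \<partial>(lborel \<Otimes>\<^sub>M lborel))"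
    unfolding lborel_prod
    by (intro nn_integral_cong ep k) auto
  also have "\<dots> = (\<integral>\<^sup>+\<xi>. (\<integral>\<^sup>+\<eta>. ennreal ((norm (q \<xi>))\<^sup>2 / 2) * ennreal (k (\<xi> - \<eta>)) +
      ennreal ((norm (q \<eta>))\<^sup>2 / 2) * ennreal (k (\<xi> - \<eta>)) \<partial>lborel) \<partial>lborel)"
    by (subst lborel.nn_integral_fst[symmetric]) simp_all
  also have "\<dots> = ennreal (1/2 * L * Q) + ennreal (1/2 * L * Q)"
    by (simp add: nn_integral_add part1 part2)
  also have "\<dots> = ennreal (L * Q)" using L Q by (simp flip: ennreal_plus)
  finally have "ennreal R \<le> ennreal (L * Q)" .
  moreover have "(\<integral>\<^sup>+z. ennreal ((norm (I z))\<^sup>2) \<partial>\<mu>) = ennreal R"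
    unfolding R_def using intI by (intro nn_integral_eq_integral) auto
  ultimately show ?thesis unfolding I_def L_def Q_def by simp
qed

subsection \<open>The Fourier transform of Schwartz functions\<close>

text \<open>The factor (2\<pi>)^(-n) of the inverse transform is omitted; it would only change
  constants. Data are parametrised by g on the frequency side, as \<open>ifourier g\<close>.\<close>

definition ifourier :: "(real ^ 'n \<Rightarrow> complex) \<Rightarrow> real ^ 'n \<Rightarrow> complex"
  where "ifourier g x = (LINT \<xi>|lborel. cis (x \<bullet> \<xi>) * g \<xi>)"

lemma schwartz_integrable: "schwartz g \<Longrightarrow> integrable lborel g"
  by (intro integrable_rapid schwartz_measurable schwartz_rapid)

lemma rapid_square:
  fixes g :: "real ^ 'n \<Rightarrow> complex"
  assumes "rapid_fun g" shows "rapid_fun (\<lambda>x. g x * cnj (g x))"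
  unfolding rapid_fun_def
proof
  fix N
  obtain C where C: "C > 0" "\<And>x. \<langle>x\<rangle> ^ N * norm (g x) \<le> C" using assms rapid_funE by blast
  obtain D where D: "D > 0" "\<And>x. \<langle>x\<rangle> ^ 0 * norm (g x) \<le> D" using assms rapid_funE by blast
  have "\<langle>x\<rangle> ^ N * norm (g x * cnj (g x)) \<le> C * D" for x
  proof -
    have "\<langle>x\<rangle> ^ N * norm (g x * cnj (g x)) = (\<langle>x\<rangle> ^ N * norm (g x)) * norm (g x)" by (simp add: norm_mult)
    also have "\<dots> \<le> C * D" using C D[of] by (intro mult_mono) auto
    finally show ?thesis .
  qed
  then show "\<exists>C. \<forall>x. \<langle>x\<rangle> ^ N * norm (g x * cnj (g x)) \<le> C" by blast
qed

lemma integrable_rapid_square: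
  fixes g :: "real ^ 'n \<Rightarrow> complex"
  assumes [measurable]: "g \<in> borel_measurable borel" and "rapid_fun g"
  shows "integrable lborel (\<lambda>x. (norm (g x))\<^sup>2)"
proof -
  have "integrable lborel (\<lambda>x. norm (g x * cnj (g x)))"
    by (intro integrable_norm integrable_rapid rapid_square assms) measurable
  then show ?thesis by (simp add: norm_mult power2_eq_square)
qed

lemma schwartz_square_integrable: "schwartz g \<Longrightarrow> integrable lborel (\<lambda>x. (norm (g x))\<^sup>2)"
  by (intro integrable_rapid_square schwartz_measurable schwartz_rapid)

lemma integrable_cis_mult:
  "integrable lborel g \<Longrightarrow> integrable lborel (\<lambda>\<xi>. cis (x \<bullet> \<xi>) * g \<xi>)"
  by (rule Bochner_Integration.integrable_bound[where f = g], assumption)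
     (use borel_measurable_integrable[of lborel g] in \<open>auto simp: norm_mult\<close>)

lemma norm_ifourier_le: "norm (ifourier g x) \<le> (LINT \<xi>|lborel. norm (g \<xi>))"
  unfolding ifourier_def by (rule integral_norm_bound[THEN order_trans]) (simp add: norm_mult)

lemma ifourier_add:
  "integrable lborel f \<Longrightarrow> integrable lborel g \<Longrightarrow> ifourier (\<lambda>\<xi>. f \<xi> + g \<xi>) x = ifourier f x + ifourier g x"
  unfolding ifourier_def by (simp add: distrib_left integrable_cis_mult)

lemma ifourier_cmult: "ifourier (\<lambda>\<xi>. c * f \<xi>) x = c * ifourier f x"
proof -
  have "(\<lambda>\<xi>. cis (x \<bullet> \<xi>) * (c * f \<xi>)) = (\<lambda>\<xi>. c * (cis (x \<bullet> \<xi>) * f \<xi>))" by (simp add: mult_ac)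
  then show ?thesis unfolding ifourier_def by simp
qed

lemma ifourier_sum:
  "finite I \<Longrightarrow> (\<And>i. i \<in> I \<Longrightarrow> integrable lborel (f i)) \<Longrightarrow>
    ifourier (\<lambda>\<xi>. \<Sum>i\<in>I. f i \<xi>) x = (\<Sum>i\<in>I. ifourier (f i) x)"
proof (induction I rule: finite_induct)
  case empty then show ?case by (simp add: ifourier_def)
next
  case (insert i I)
  then show ?case by (simp add: ifourier_add)
qed

section \<open>Derivatives and weights under the transform\<close>

lemma cis_taylor: "norm (cis t - 1 - \<i> * t) \<le> t\<^sup>2 / 2"
  using iexp_approx1[of t 1] by (simp add: cis_eq_iexp diff_diff_eq power2_eq_square)

text \<open>The second-order remainder of the exponential is at most (h \<bullet> \<xi>)^2 / 2, so
  the error is at most |h|^2 M / 2 with M the second absolute moment of g. Decay of g enters, but no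
  smoothness, so this also serves for transforms of continuous functions of compact support.\<close>

lemma has_derivative_ifourier:
  fixes g :: "real ^ 'n \<Rightarrow> complex"
  assumes [measurable]: "g \<in> borel_measurable borel" and g: "rapid_fun g"
  shows "(ifourier g has_derivative
    (\<lambda>h. \<Sum>i\<in>UNIV. h $ i *\<^sub>R ifourier (\<lambda>\<xi>. \<i> * complex_of_real (\<xi> $ i) * g \<xi>) x)) (at x)"
proof -
  have ig: "integrable lborel g" by (rule integrable_rapid) (use assms in auto)
  have igi: "integrable lborel (\<lambda>\<xi>. \<i> * complex_of_real (\<xi> $ i) * g \<xi>)" for i
    by (intro integrable_rapid rapid_fun_mult g) (measurable, intro smooth_withD(2)[OF slow_mult] slow_const slow_of_real slow_component)
  have i2: "integrable lborel (\<lambda>\<xi>. (norm \<xi>)\<^sup>2 * norm (g \<xi>))"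
  proof -
    have "integrable lborel (\<lambda>\<xi>. complex_of_real ((norm \<xi>)\<^sup>2) * g \<xi>)"
    proof (intro integrable_rapid rapid_fun_mult g)
      show "poly_fun (\<lambda>\<xi>. complex_of_real ((norm (\<xi>::real^'n))\<^sup>2))" unfolding poly_fun_def
        by (rule exI[of _ 1], rule exI[of _ 2]) (simp add: japanese_sq norm_power)
    qed measurable
    from integrable_norm[OF this] show ?thesis by (simp add: norm_mult norm_power)
  qed
  define M where "M = (LINT \<xi>|lborel. (norm \<xi>)\<^sup>2 * norm (g \<xi>))"
  define D where "D h = (\<Sum>i\<in>UNIV. h $ i *\<^sub>R ifourier (\<lambda>\<xi>. \<i> * complex_of_real (\<xi> $ i) * g \<xi>) x)" for h :: "real^'n"
  have bound: "norm (ifourier g (x + h) - ifourier g x - D h) \<le> (norm h)\<^sup>2 / 2 * M" for h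
  proof -
    have igh: "integrable lborel (\<lambda>\<xi>. h $ i *\<^sub>R (\<i> * complex_of_real (\<xi> $ i) * g \<xi>))" for i
      using igi by (rule integrable_scaleR_right)
    have "D h = ifourier (\<lambda>\<xi>. \<Sum>i\<in>UNIV. h $ i *\<^sub>R (\<i> * complex_of_real (\<xi> $ i) * g \<xi>)) x"
      unfolding D_def by (subst ifourier_sum) (use igh in \<open>auto simp: scaleR_conv_of_real ifourier_cmult\<close>)
    also have "(\<lambda>\<xi>. \<Sum>i\<in>UNIV. h $ i *\<^sub>R (\<i> * complex_of_real (\<xi> $ i) * g \<xi>)) = (\<lambda>\<xi>. \<i> * complex_of_real (h \<bullet> \<xi>) * g \<xi>)"
      by (simp add: inner_vec_real sum_distrib_left sum_distrib_right scaleR_conv_of_real mult_ac)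
    finally have D: "D h = ifourier (\<lambda>\<xi>. \<i> * complex_of_real (h \<bullet> \<xi>) * g \<xi>) x" .
    have ih: "integrable lborel (\<lambda>\<xi>. \<i> * complex_of_real (h \<bullet> \<xi>) * g \<xi>)"
    proof -
      have "integrable lborel (\<lambda>\<xi>. \<Sum>i\<in>UNIV. h $ i *\<^sub>R (\<i> * complex_of_real (\<xi> $ i) * g \<xi>))" using igh by auto
      then show ?thesis by (simp add: inner_vec_real sum_distrib_left sum_distrib_right scaleR_conv_of_real mult_ac)
    qed
    have "ifourier g (x + h) - ifourier g x - D h =
       (LINT \<xi>|lborel. cis ((x + h) \<bullet> \<xi>) * g \<xi> - cis (x \<bullet> \<xi>) * g \<xi> - cis (x \<bullet> \<xi>) * (\<i> * complex_of_real (h \<bullet> \<xi>) * g \<xi>))"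
      unfolding D unfolding ifourier_def using integrable_cis_mult[OF ig] integrable_cis_mult[OF ih] by simp
    also have "\<dots> = (LINT \<xi>|lborel. cis (x \<bullet> \<xi>) * (cis (h \<bullet> \<xi>) - 1 - \<i> * complex_of_real (h \<bullet> \<xi>)) * g \<xi>)"
      by (intro Bochner_Integration.integral_cong refl) (simp add: inner_add_left algebra_simps flip: cis_mult)
    finally have "norm (ifourier g (x + h) - ifourier g x - D h) \<le>
        (LINT \<xi>|lborel. norm (cis (x \<bullet> \<xi>) * (cis (h \<bullet> \<xi>) - 1 - \<i> * complex_of_real (h \<bullet> \<xi>)) * g \<xi>))"
      using integral_norm_bound by simp
    also have "\<dots> \<le> (LINT \<xi>|lborel. (norm h)\<^sup>2 / 2 * ((norm \<xi>)\<^sup>2 * norm (g \<xi>)))"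
    proof (rule integral_mono')
      show "integrable lborel (\<lambda>\<xi>. (norm h)\<^sup>2 / 2 * ((norm \<xi>)\<^sup>2 * norm (g \<xi>)))"
        using i2 by (rule integrable_mult_right)
      fix \<xi>
      have "norm (cis (h \<bullet> \<xi>) - 1 - \<i> * complex_of_real (h \<bullet> \<xi>)) \<le> (h \<bullet> \<xi>)\<^sup>2 / 2" by (rule cis_taylor)
      also have "\<dots> \<le> (norm h * norm \<xi>)\<^sup>2 / 2"
        by (intro divide_right_mono abs_le_square_iff[THEN iffD1])
           (use Cauchy_Schwarz_ineq2[of h \<xi>] in auto)
      finally show "norm (cis (x \<bullet> \<xi>) * (cis (h \<bullet> \<xi>) - 1 - \<i> * complex_of_real (h \<bullet> \<xi>)) * g \<xi>) \<le>
          (norm h)\<^sup>2 / 2 * ((norm \<xi>)\<^sup>2 * norm (g \<xi>))"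
        by (simp add: norm_mult power_mult_distrib mult_right_mono flip: mult.assoc times_divide_eq_left)
    qed auto
    finally show ?thesis unfolding M_def by simp
  qed
  have M0: "M \<ge> 0" unfolding M_def by simp
  have "(\<lambda>h. norm (ifourier g (x + h) - ifourier g x - D h) / norm h) \<midarrow>0\<rightarrow> 0"
  proof (rule Lim_null_comparison)
    show "\<forall>\<^sub>F h in at 0. norm (norm (ifourier g (x + h) - ifourier g x - D h) / norm h) \<le> norm h / 2 * M"
      using bound M0 by (auto simp: eventually_at_filter field_simps power2_eq_square)
    show "(\<lambda>h. norm h / 2 * M) \<midarrow>0\<rightarrow> 0"
      by (auto intro!: tendsto_eq_intros)
  qed
  moreover have "bounded_linear D" unfolding D_def
    by (intro bounded_linear_sum bounded_linear_scaleR_const bounded_linear_vec_nth)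
  ultimately show ?thesis unfolding D_def[symmetric] has_derivative_at by blast
qed

lemma partial_ifourier:
  assumes "g \<in> borel_measurable borel" "rapid_fun g"
  shows "partial i (ifourier g) = ifourier (\<lambda>\<xi>. \<i> * complex_of_real (\<xi> $ i) * g \<xi>)"
  by (rule ext, subst partial_eqI[OF has_derivative_ifourier[OF assms]])
     (simp add: axis_def if_distrib[of "\<lambda>c. c *\<^sub>R _"] cong: if_cong)

lemma ifourier_differentiable:
  "g \<in> borel_measurable borel \<Longrightarrow> rapid_fun g \<Longrightarrow> ifourier g differentiable (at x)"
  using has_derivative_ifourier unfolding differentiable_def by blast

text \<open>A form of Peetre's inequality: weights at two points are comparable up to the weight of
  their difference.\<close>

lemma japanese_add_le: "\<langle>x + y\<rangle> \<le> 2 * \<langle>x\<rangle> * \<langle>y\<rangle>"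
proof (rule power2_le_imp_le)
  have "(norm (x + y))\<^sup>2 \<le> (norm x + norm y)\<^sup>2" by (intro power_mono norm_triangle_ineq) simp
  also have "\<dots> \<le> 2 * (norm x)\<^sup>2 + 2 * (norm y)\<^sup>2"
    using sum_squares_bound[of "norm x" "norm y"] by (simp add: power2_sum)
  finally show "\<langle>x + y\<rangle>\<^sup>2 \<le> (2 * \<langle>x\<rangle> * \<langle>y\<rangle>)\<^sup>2"
    by (simp add: power_mult_distrib japanese_sq distrib_left distrib_right)
       (smt (verit) mult_nonneg_nonneg zero_le_power2)
qed (simp add: japanese_nonneg)

text \<open>Difference quotients have integral zero by translation invariance, and they converge to
  the derivative under an integrable majorant. This is the source of integration by parts
  below.\<close>

lemma integral_partial_zero:
  fixes f :: "real ^ 'n \<Rightarrow> complex"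
  assumes f: "schwartz f"
  shows "(LINT x|lborel. partial i f x) = 0"
proof -
  let ?e = "axis i 1 :: real^'n"
  note [measurable] = schwartz_measurable[OF f] schwartz_measurable[OF schwartz_partial[OF f, of i]]
  define s where "s m x = (f (x + (1 / real (Suc m)) *\<^sub>R ?e) - f x) * real (Suc m)" for m x
  obtain C where C: "C > 0" "\<And>x. \<langle>x\<rangle> ^ (2 * CARD('n)) * norm (partial i f x) \<le> C"
    using schwartz_rapid[OF schwartz_partial[OF f, of i]] rapid_funE by blast
  \<comment> \<open>For a shift t in [0, 1] one has \<langle>te\<rangle> \<le> 2 and hence
    \<langle>x\<rangle> \<le> 4 \<langle>x + te\<rangle>; the power 2n of this 4 is the factor in
    \<open>w\<close>. The mean value theorem then bounds the difference quotients.\<close>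
  define w where "w x = C * 4 ^ (2 * CARD('n)) * inverse (\<langle>x\<rangle> ^ (2 * CARD('n)))" for x :: "real^'n"
  have der: "((\<lambda>t. f (x + t *\<^sub>R ?e)) has_vector_derivative partial i f (x + t *\<^sub>R ?e)) (at t within S)" for x t S
  proof -
    have "(f has_derivative frechet_derivative f (at (x + t *\<^sub>R ?e))) (at (x + t *\<^sub>R ?e))"
      using schwartz_differentiable[OF f] by (simp add: frechet_derivative_works)
    moreover have "((\<lambda>t. x + t *\<^sub>R ?e) has_derivative (\<lambda>h. h *\<^sub>R ?e)) (at t within S)"
      by (auto intro!: derivative_eq_intros)
    ultimately have *: "((\<lambda>t. f (x + t *\<^sub>R ?e)) has_derivative (\<lambda>h. frechet_derivative f (at (x + t *\<^sub>R ?e)) (h *\<^sub>R ?e))) (at t within S)"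
      by (rule has_derivative_compose[rotated])
    show ?thesis unfolding has_vector_derivative_def partial_def
      using * linear_frechet_derivative[OF schwartz_differentiable[OF f]] by (simp add: linear_cmul)
  qed
  have sw: "norm (s m x) \<le> w x" for m x
  proof -
    have B: "norm (partial i f (x + t *\<^sub>R ?e)) \<le> w x" if "t \<in> {0..1}" for t
    proof -
      let ?y = "x + t *\<^sub>R ?e"
      have "\<langle>- t *\<^sub>R ?e\<rangle>\<^sup>2 \<le> 2\<^sup>2" using that power_le_one[of t 2] unfolding japanese_sq by simp
      then have "\<langle>- t *\<^sub>R ?e\<rangle> \<le> 2" by (rule power2_le_imp_le) simp
      moreover have "\<langle>x\<rangle> \<le> 2 * \<langle>?y\<rangle> * \<langle>- t *\<^sub>R ?e\<rangle>" using japanese_add_le[of ?y "- t *\<^sub>R ?e"] by simp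
      ultimately have "\<langle>x\<rangle> \<le> 4 * \<langle>?y\<rangle>"
        using mult_left_mono[of "\<langle>- t *\<^sub>R ?e\<rangle>" 2 "2 * \<langle>?y\<rangle>"] japanese_nonneg[of ?y] by linarith
      then have "\<langle>x\<rangle> ^ (2 * CARD('n)) \<le> (4 * \<langle>?y\<rangle>) ^ (2 * CARD('n))" by (intro power_mono japanese_nonneg)
      then have "\<langle>x\<rangle> ^ (2 * CARD('n)) * norm (partial i f ?y) \<le> (4 * \<langle>?y\<rangle>) ^ (2 * CARD('n)) * norm (partial i f ?y)"
        by (rule mult_right_mono) simp
      also have "\<dots> = 4 ^ (2 * CARD('n)) * (\<langle>?y\<rangle> ^ (2 * CARD('n)) * norm (partial i f ?y))"
        by (simp add: power_mult_distrib)
      also have "\<dots> \<le> 4 ^ (2 * CARD('n)) * C" by (intro mult_left_mono C) simp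
      finally show ?thesis unfolding w_def using japanese_pos[of x] by (simp add: field_simps)
    qed
    have "norm (f (x + (1 / real (Suc m)) *\<^sub>R ?e) - f (x + 0 *\<^sub>R ?e)) \<le> w x * norm (1 / real (Suc m) - 0)"
    proof (rule differentiable_bound[where S = "{0..1}" and f = "\<lambda>t. f (x + t *\<^sub>R ?e)"])
      show "((\<lambda>t. f (x + t *\<^sub>R ?e)) has_derivative (\<lambda>h. h *\<^sub>R partial i f (x + t *\<^sub>R ?e))) (at t within {0..1})" for t
        using der unfolding has_vector_derivative_def .
      show "onorm (\<lambda>h. h *\<^sub>R partial i f (x + t *\<^sub>R ?e)) \<le> w x" if "t \<in> {0..1}" for t
        using B[OF that] by (intro onorm_le) (auto intro: mult_left_mono simp: mult.commute)
    qed auto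
    then have "norm (f (x + (1 / real (Suc m)) *\<^sub>R ?e) - f x) * real (Suc m) \<le> w x"
      by (simp add: field_simps)
    then show ?thesis unfolding s_def norm_mult norm_of_real by simp
  qed
  have lim: "(\<lambda>m. s m x) \<longlonglongrightarrow> partial i f x" for x
  proof -
    have "((\<lambda>h. (f (x + h *\<^sub>R ?e) - f x) /\<^sub>R h) \<longlongrightarrow> partial i f x) (at 0)"
    proof (rule Lim_null[THEN iffD2], rule tendsto_norm_zero_cancel)
      have "((\<lambda>h. norm (f (x + (0 + h) *\<^sub>R ?e) - f (x + 0 *\<^sub>R ?e) - h *\<^sub>R partial i f x) / norm h) \<longlongrightarrow> 0) (at 0)"
        using der[of x 0 UNIV] unfolding has_vector_derivative_def has_derivative_at by simp
      then show "((\<lambda>h. norm ((f (x + h *\<^sub>R ?e) - f x) /\<^sub>R h - partial i f x)) \<longlongrightarrow> 0) (at 0)"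
      proof (rule Lim_transform_within[where d = 1])
        fix h :: real assume "0 < dist h 0"
        then have "(f (x + h *\<^sub>R ?e) - f x) /\<^sub>R h - partial i f x = inverse h *\<^sub>R (f (x + h *\<^sub>R ?e) - f x - h *\<^sub>R partial i f x)"
          by (simp add: scaleR_diff_right)
        then show "norm (f (x + (0 + h) *\<^sub>R ?e) - f (x + 0 *\<^sub>R ?e) - h *\<^sub>R partial i f x) / norm h =
            norm ((f (x + h *\<^sub>R ?e) - f x) /\<^sub>R h - partial i f x)"
          by (simp add: divide_inverse mult.commute)
      qed simp
    qed
    moreover have "filterlim (\<lambda>m. 1 / real (Suc m)) (at 0) sequentially"
      unfolding filterlim_at using LIMSEQ_inverse_real_of_nat by (auto simp: inverse_eq_divide)
    ultimately have "(\<lambda>m. (f (x + (1 / real (Suc m)) *\<^sub>R ?e) - f x) /\<^sub>R (1 / real (Suc m))) \<longlonglongrightarrow> partial i f x"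
      by (rule filterlim_compose)
    then show ?thesis unfolding s_def by (simp add: scaleR_conv_of_real mult_ac)
  qed
  have "(\<lambda>m. LINT x|lborel. s m x) \<longlonglongrightarrow> (LINT x|lborel. partial i f x)"
  proof (rule integral_dominated_convergence[where w = w])
    show "integrable lborel w" unfolding w_def by (intro integrable_mult_right integrable_japanese)
    show "AE x in lborel. (\<lambda>m. s m x) \<longlonglongrightarrow> partial i f x" using lim by simp
    show "AE x in lborel. norm (s m x) \<le> w x" for m using sw by simp
  qed (auto simp: s_def)
  moreover have "(LINT x|lborel. s m x) = 0" for m
  proof -
    have "(LINT x|lborel. f (x + (1 / real (Suc m)) *\<^sub>R ?e)) = (LINT x|lborel. f x)"
      using lborel_affine_vec(2)[of 1 f "(1 / real (Suc m)) *\<^sub>R ?e"] by (simp add: add.commute)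
    moreover have "integrable lborel (\<lambda>x. f (x + (1 / real (Suc m)) *\<^sub>R ?e))"
      using lborel_affine_vec(1)[of 1 f "(1 / real (Suc m)) *\<^sub>R ?e"] schwartz_integrable[OF f] by (simp add: add.commute)
    ultimately show ?thesis unfolding s_def using schwartz_integrable[OF f] by simp
  qed
  ultimately show ?thesis by (simp add: LIMSEQ_const_iff)
qed

lemma slow_sum: "(\<And>i. i \<in> I \<Longrightarrow> smooth_with poly_fun (f i)) \<Longrightarrow> smooth_with poly_fun (\<lambda>x. \<Sum>i\<in>I. f i x)"
  by (induction I rule: infinite_finite_induct) (auto intro: slow_add slow_const)

lemma slow_inner: "smooth_with poly_fun (\<lambda>\<xi>::real^'n. x \<bullet> \<xi>)"
  unfolding inner_vec_real by (intro slow_sum slow_mult slow_const slow_component)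

lemma slow_cis_inner: "smooth_with poly_fun (\<lambda>\<xi>::real^'n. cis (x \<bullet> \<xi>))"
  using slow_cis[OF slow_inner, of 1 x] by simp

lemma partial_cis_inner: "partial i (\<lambda>\<xi>::real^'n. cis (x \<bullet> \<xi>)) = (\<lambda>\<xi>. \<i> * complex_of_real (x $ i) * cis (x \<bullet> \<xi>))"
proof
  fix \<xi> :: "real^'n"
  have "((\<lambda>\<xi>. \<i> * complex_of_real (x \<bullet> \<xi>)) has_derivative (\<lambda>h. \<i> * complex_of_real (x \<bullet> h))) (at \<xi>)"
    by (intro has_derivative_mult_right has_derivative_of_real has_derivative_inner_right has_derivative_ident)
  from has_derivative_compose[OF this, of exp "\<lambda>h. h * exp (\<i> * complex_of_real (x \<bullet> \<xi>))"]
  have "((\<lambda>\<xi>. exp (\<i> * complex_of_real (x \<bullet> \<xi>))) has_derivative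
      (\<lambda>h. \<i> * complex_of_real (x \<bullet> h) * exp (\<i> * complex_of_real (x \<bullet> \<xi>)))) (at \<xi>)"
    by (simp add: mult_ac has_field_derivative_imp_has_derivative[OF DERIV_exp, unfolded mult.commute[of "exp _"]])
  then show "partial i (\<lambda>\<xi>. cis (x \<bullet> \<xi>)) \<xi> = \<i> * complex_of_real (x $ i) * cis (x \<bullet> \<xi>)"
    unfolding cis_eq_iexp by (subst partial_eqI) (assumption, simp add: cart_eq_inner_axis)
qed

text \<open>The derivative of the product cis(x \<bullet> \<xi>) g(\<xi>) has integral zero, so the
  derivative passes from g to the exponential with a change of sign.\<close>

lemma ifourier_partial:
  assumes g: "schwartz g"
  shows "ifourier (partial i g) x = - \<i> * complex_of_real (x $ i) * ifourier g x"
proof -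
  have S: "schwartz (\<lambda>\<xi>. cis (x \<bullet> \<xi>) * g \<xi>)" by (intro schwartz_slow_mult slow_cis_inner g)
  have "0 = (LINT \<xi>|lborel. partial i (\<lambda>\<xi>. cis (x \<bullet> \<xi>) * g \<xi>) \<xi>)"
    using integral_partial_zero[OF S] by simp
  also have "\<dots> = (LINT \<xi>|lborel. cis (x \<bullet> \<xi>) * partial i g \<xi> + \<i> * complex_of_real (x $ i) * (cis (x \<bullet> \<xi>) * g \<xi>))"
    by (intro Bochner_Integration.integral_cong refl,
        subst partial_mult[OF smooth_withD(1)[OF slow_cis_inner] schwartz_differentiable[OF g]])
       (simp add: partial_cis_inner mult_ac)
  also have "\<dots> = ifourier (partial i g) x + \<i> * complex_of_real (x $ i) * ifourier g x"
    unfolding ifourier_def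
    using integrable_cis_mult[OF schwartz_integrable[OF g]]
      integrable_cis_mult[OF schwartz_integrable[OF schwartz_partial[OF g]]] by simp
  finally show ?thesis by (simp add: eq_neg_iff_add_eq_0)
qed

lemma ifourier_i_partial:
  assumes g: "schwartz g"
  shows "ifourier (\<lambda>\<xi>. \<i> * partial i g \<xi>) x = complex_of_real (x $ i) * ifourier g x"
  by (simp add: ifourier_cmult ifourier_partial[OF g] flip: mult.assoc)

lemma schwartz_component_mult:
  "schwartz g \<Longrightarrow> schwartz (\<lambda>\<xi>. \<i> * complex_of_real (\<xi> $ i) * g \<xi>)"
  by (intro schwartz_slow_mult slow_mult slow_const slow_of_real slow_component)

text \<open>Multiplying the transform by \<langle>x\<rangle>^2 amounts to applying 1 - \<Delta> to
  g. Hence \<langle>x\<rangle>^(2N) times the transform is the transform of an integrable function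
  and therefore bounded.\<close>

lemma ifourier_rapid:
  fixes g :: "real ^ 'n \<Rightarrow> complex"
  assumes g: "schwartz g"
  shows "rapid_fun (ifourier g)"
proof -
  have ex: "\<exists>g'. schwartz g' \<and> (\<forall>x. complex_of_real (\<langle>x\<rangle> ^ (2 * N)) * ifourier g x = ifourier g' x)" for N
  proof (induction N)
    case 0 then show ?case using g by auto
  next
    case (Suc N)
    then obtain g' where g': "schwartz g'" "\<And>x. complex_of_real (\<langle>x\<rangle> ^ (2 * N)) * ifourier g x = ifourier g' x" by blast
    \<comment> \<open>This is (1 - \<Delta>) g', with each -\<partial>_i^2 written as the square of
      i\<partial>_i so that \<open>ifourier_i_partial\<close> applies twice.\<close>
    define L where "L = (\<lambda>\<xi>. g' \<xi> + (\<Sum>i\<in>UNIV. \<i> * partial i (\<lambda>\<eta>. \<i> * partial i g' \<eta>) \<xi>))"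
    have S1: "schwartz (\<lambda>\<eta>. \<i> * partial i g' \<eta>)" for i by (intro schwartz_cmult schwartz_partial g')
    have S2: "schwartz (\<lambda>\<xi>. \<i> * partial i (\<lambda>\<eta>. \<i> * partial i g' \<eta>) \<xi>)" for i
      by (intro schwartz_cmult schwartz_partial S1)
    have "schwartz L" unfolding L_def by (intro schwartz_add g' schwartz_sum S2)
    moreover have "complex_of_real (\<langle>x\<rangle> ^ (2 * Suc N)) * ifourier g x = ifourier L x" for x
    proof -
      have "ifourier L x = ifourier g' x + (\<Sum>i\<in>UNIV. complex_of_real (x $ i) * (complex_of_real (x $ i) * ifourier g' x))"
        unfolding L_def
        by (subst ifourier_add, (intro schwartz_integrable schwartz_sum S2 g')+, subst ifourier_sum)
           (simp_all add: schwartz_integrable S2 ifourier_i_partial S1 g')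
      also have "\<dots> = complex_of_real (\<langle>x\<rangle>\<^sup>2) * ifourier g' x"
      proof -
        have "complex_of_real (\<langle>x\<rangle>\<^sup>2) = 1 + (\<Sum>i\<in>UNIV. (complex_of_real (x $ i))\<^sup>2)"
          unfolding japanese_sq norm_sq_vec by simp
        moreover have "(\<Sum>i\<in>UNIV. complex_of_real (x $ i) * (complex_of_real (x $ i) * ifourier g' x)) =
            (\<Sum>i\<in>UNIV. (complex_of_real (x $ i))\<^sup>2) * ifourier g' x"
          unfolding sum_distrib_right by (simp add: power2_eq_square mult.assoc)
        ultimately show ?thesis by (simp only: distrib_right mult_1)
      qed
      also have "\<dots> = complex_of_real (\<langle>x\<rangle>\<^sup>2) * (complex_of_real (\<langle>x\<rangle> ^ (2 * N)) * ifourier g x)" by (simp only: g'(2))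
      also have "\<dots> = complex_of_real (\<langle>x\<rangle> ^ (2 * Suc N)) * ifourier g x" by (simp add: power_add power2_eq_square mult_ac)
      finally show ?thesis by simp
    qed
    ultimately show ?case by blast
  qed
  show ?thesis unfolding rapid_fun_def
  proof
    fix N
    obtain g' where g': "schwartz g'" "\<And>x. complex_of_real (\<langle>x\<rangle> ^ (2 * N)) * ifourier g x = ifourier g' x"
      using ex[of N] by blast
    have "\<langle>x\<rangle> ^ N * norm (ifourier g x) \<le> (LINT \<xi>|lborel. norm (g' \<xi>))" for x
    proof -
      have "\<langle>x\<rangle> ^ N * norm (ifourier g x) \<le> \<langle>x\<rangle> ^ (2 * N) * norm (ifourier g x)"
        by (intro mult_right_mono power_increasing japanese_ge_1) auto
      also have "\<dots> = norm (complex_of_real (\<langle>x\<rangle> ^ (2 * N)) * ifourier g x)"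
        by (simp only: norm_mult norm_of_real abs_of_nonneg[OF zero_le_power[OF japanese_nonneg]])
      also have "\<dots> \<le> (LINT \<xi>|lborel. norm (g' \<xi>))" unfolding g'(2) by (rule norm_ifourier_le)
      finally show ?thesis .
    qed
    then show "\<exists>C. \<forall>x. \<langle>x\<rangle> ^ N * norm (ifourier g x) \<le> C" by blast
  qed
qed

lemma schwartz_ifourier:
  assumes "schwartz g" shows "schwartz (ifourier g)"
  unfolding schwartz_iff
proof (rule smooth_with_coinduct[where X = "{ifourier g | g. schwartz g}"], goal_cases)
  case 1 then show ?case using assms by blast
next
  case (2 f)
  then obtain g where g: "schwartz g" "f = ifourier g" by blast
  have "partial i f = ifourier (\<lambda>\<xi>. \<i> * complex_of_real (\<xi> $ i) * g \<xi>)" for i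
    unfolding g(2) using g(1) by (intro partial_ifourier schwartz_measurable schwartz_rapid)
  moreover have "f differentiable (at x)" for x
    unfolding g(2) using g(1) by (intro ifourier_differentiable schwartz_measurable schwartz_rapid)
  moreover have "rapid_fun f" unfolding g(2) by (rule ifourier_rapid[OF g(1)])
  ultimately show ?case using schwartz_component_mult[OF g(1)] by blast
qed

section \<open>Fourier inversion by Gaussian regularisation\<close>

definition gauss_avg :: "real \<Rightarrow> (real ^ 'n \<Rightarrow> complex) \<Rightarrow> real ^ 'n \<Rightarrow> complex"
  where "gauss_avg s g x = (LINT y|lborel. g (x + s *\<^sub>R y) * complex_of_real (exp (- (norm y)\<^sup>2 / 2)))"

text \<open>The Gaussian makes the double integral absolutely convergent, so Fubini applies, and its
  own transform localises g near \<xi> on the scale s. Note that \<open>gauss_avg s g\<close> is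
  (2\<pi>)^(n/2) times the mean of g under the normal law of variance s^2 around the point.\<close>

lemma gauss_regularised_ifourier:
  fixes g :: "real ^ 'n \<Rightarrow> complex"
  assumes s: "s > 0" and g: "integrable lborel g"
  shows "(LINT x|lborel. cis (- (x \<bullet> \<xi>)) * complex_of_real (exp (- (s\<^sup>2 * (norm x)\<^sup>2) / 2)) * ifourier g x) =
    sqrt (2 * pi) ^ CARD('n) * gauss_avg s g \<xi>"
proof -
  have [measurable]: "g \<in> borel_measurable borel" using borel_measurable_integrable[OF g] by simp
  define G where "G x = complex_of_real (exp (- (s\<^sup>2 * (norm x)\<^sup>2) / 2))" for x :: "real^'n"
  have [measurable]: "G \<in> borel_measurable borel" unfolding G_def by measurable
  have s2: "s\<^sup>2 > 0" using s by simp
  have G: "integrable lborel G" unfolding G_def by (rule integrable_of_real, rule gauss_fourier(1)[OF s2])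
  have int: "integrable (lborel \<Otimes>\<^sub>M lborel) (\<lambda>(x, \<eta>). cis (x \<bullet> (\<eta> - \<xi>)) * G x * g \<eta>)"
    by (rule Bochner_Integration.integrable_bound[OF integrable_tensor[OF G g]])
       (auto simp: norm_mult split: prod.splits)
  have "(LINT x|lborel. cis (- (x \<bullet> \<xi>)) * G x * ifourier g x) =
      (LINT x|lborel. (LINT \<eta>|lborel. cis (x \<bullet> (\<eta> - \<xi>)) * G x * g \<eta>))"
  proof (rule Bochner_Integration.integral_cong[OF refl])
    fix x
    have "cis (- (x \<bullet> \<xi>)) * G x * ifourier g x = (LINT \<eta>|lborel. cis (- (x \<bullet> \<xi>)) * G x * (cis (x \<bullet> \<eta>) * g \<eta>))"
      unfolding ifourier_def by simp
    also have "(\<lambda>\<eta>. cis (- (x \<bullet> \<xi>)) * G x * (cis (x \<bullet> \<eta>) * g \<eta>)) = (\<lambda>\<eta>. cis (x \<bullet> (\<eta> - \<xi>)) * G x * g \<eta>)"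
      by (rule ext, unfold inner_diff_right, unfold diff_conv_add_uminus cis_mult[symmetric], simp only: mult_ac)
    finally show "cis (- (x \<bullet> \<xi>)) * G x * ifourier g x = (LINT \<eta>|lborel. cis (x \<bullet> (\<eta> - \<xi>)) * G x * g \<eta>)" .
  qed
  also have "\<dots> = (LINT \<eta>|lborel. (LINT x|lborel. cis (x \<bullet> (\<eta> - \<xi>)) * G x * g \<eta>))"
    by (rule lborel_pair.Fubini_integral[OF int, symmetric])
  also have "\<dots> = (LINT \<eta>|lborel. g \<eta> * complex_of_real (sqrt (2 * pi / s\<^sup>2) ^ CARD('n) * exp (- (norm (\<eta> - \<xi>))\<^sup>2 / (2 * s\<^sup>2))))"
  proof (rule Bochner_Integration.integral_cong[OF refl])
    fix \<eta>
    have "(LINT x|lborel. cis (x \<bullet> (\<eta> - \<xi>)) * G x * g \<eta>) = (LINT x|lborel. cis (x \<bullet> (\<eta> - \<xi>)) * G x) * g \<eta>"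
      by (rule integral_mult_left_zero)
    then show "(LINT x|lborel. cis (x \<bullet> (\<eta> - \<xi>)) * G x * g \<eta>) =
        g \<eta> * complex_of_real (sqrt (2 * pi / s\<^sup>2) ^ CARD('n) * exp (- (norm (\<eta> - \<xi>))\<^sup>2 / (2 * s\<^sup>2)))"
      unfolding G_def gauss_fourier(2)[OF s2] by (simp only: mult.commute)
  qed
  \<comment> \<open>The substitution \<eta> = \<xi> + s y; its Jacobian s^n cancels the s^(-n) of
    the Gaussian transform.\<close>
  also have "\<dots> = \<bar>s\<bar> ^ CARD('n) *\<^sub>R (LINT y|lborel. g (\<xi> + s *\<^sub>R y) *
      complex_of_real (sqrt (2 * pi / s\<^sup>2) ^ CARD('n) * exp (- (norm (\<xi> + s *\<^sub>R y - \<xi>))\<^sup>2 / (2 * s\<^sup>2))))"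
    using s by (intro lborel_affine_vec(2)) auto
  also have "(\<lambda>y. g (\<xi> + s *\<^sub>R y) *
      complex_of_real (sqrt (2 * pi / s\<^sup>2) ^ CARD('n) * exp (- (norm (\<xi> + s *\<^sub>R y - \<xi>))\<^sup>2 / (2 * s\<^sup>2)))) =
      (\<lambda>y. complex_of_real (sqrt (2 * pi / s\<^sup>2) ^ CARD('n)) * (g (\<xi> + s *\<^sub>R y) * complex_of_real (exp (- (norm y)\<^sup>2 / 2))))"
    using s by (auto simp: power_mult_distrib)
  also have "\<bar>s\<bar> ^ CARD('n) *\<^sub>R (LINT y|lborel. complex_of_real (sqrt (2 * pi / s\<^sup>2) ^ CARD('n)) * (g (\<xi> + s *\<^sub>R y) * complex_of_real (exp (- (norm y)\<^sup>2 / 2))))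
     = complex_of_real (\<bar>s\<bar> ^ CARD('n) * sqrt (2 * pi / s\<^sup>2) ^ CARD('n)) * gauss_avg s g \<xi>"
    unfolding gauss_avg_def scaleR_conv_of_real by (simp only: integral_mult_right_zero of_real_mult mult.assoc)
  also have "\<bar>s\<bar> ^ CARD('n) * sqrt (2 * pi / s\<^sup>2) ^ CARD('n) = sqrt (2 * pi) ^ CARD('n)"
    using s by (simp add: power_mult_distrib[symmetric] real_sqrt_divide)
  finally show ?thesis unfolding G_def .
qed

lemma gauss_avg_tendsto:
  fixes g :: "real ^ 'n \<Rightarrow> complex"
  assumes g: "continuous_on UNIV g" "bdd_fun g"
  shows "(\<lambda>m. gauss_avg (1 / real (Suc m)) g x) \<longlonglongrightarrow> sqrt (2 * pi) ^ CARD('n) * g x"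
proof -
  have [measurable]: "g \<in> borel_measurable borel" using g(1) by (rule borel_measurable_continuous_onI)
  obtain C where C: "C > 0" "\<And>x. norm (g x) \<le> C" using g(2) bdd_funE by blast
  have ig: "integrable lborel (\<lambda>y::real^'n. exp (- (norm y)\<^sup>2 / 2))" using gauss_fourier(1)[of 1, where 'n = 'n] by simp
  have "(\<lambda>m. gauss_avg (1 / real (Suc m)) g x) \<longlonglongrightarrow> (LINT y|lborel. g x * complex_of_real (exp (- (norm (y::real^'n))\<^sup>2 / 2)))"
    unfolding gauss_avg_def
  proof (rule integral_dominated_convergence[where w = "\<lambda>y. C * exp (- (norm y)\<^sup>2 / 2)"])
    show "integrable lborel (\<lambda>y::real^'n. C * exp (- (norm y)\<^sup>2 / 2))" using ig by (rule integrable_mult_right)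
    show "AE y in lborel. norm (g (x + (1 / real (Suc m)) *\<^sub>R y) * complex_of_real (exp (- (norm y)\<^sup>2 / 2))) \<le> C * exp (- (norm y)\<^sup>2 / 2)" for m
      using C by (auto simp: norm_mult intro!: mult_right_mono)
    show "AE y in lborel. (\<lambda>m. g (x + (1 / real (Suc m)) *\<^sub>R y) * complex_of_real (exp (- (norm y)\<^sup>2 / 2)))
        \<longlonglongrightarrow> g x * complex_of_real (exp (- (norm y)\<^sup>2 / 2))"
    proof (rule AE_I2)
      fix y :: "real^'n"
      have "(\<lambda>m. x + (1 / real (Suc m)) *\<^sub>R y) \<longlonglongrightarrow> x + 0 *\<^sub>R y"
        using LIMSEQ_inverse_real_of_nat by (intro tendsto_intros) (simp add: inverse_eq_divide)
      then have "(\<lambda>m. g (x + (1 / real (Suc m)) *\<^sub>R y)) \<longlonglongrightarrow> g (x + 0 *\<^sub>R y)"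
        using g(1) by (intro isCont_tendsto_compose[of _ g]) (auto simp: continuous_on_eq_continuous_at)
      then show "(\<lambda>m. g (x + (1 / real (Suc m)) *\<^sub>R y) * complex_of_real (exp (- (norm y)\<^sup>2 / 2)))
        \<longlonglongrightarrow> g x * complex_of_real (exp (- (norm y)\<^sup>2 / 2))"
        by (intro tendsto_mult_right) simp
    qed
  qed measurable
  also have "(LINT y|lborel. g x * complex_of_real (exp (- (norm (y::real^'n))\<^sup>2 / 2))) = g x * complex_of_real (sqrt (2 * pi) ^ CARD('n))"
    using gauss_integral[of 1, where 'n = 'n] by simp
  finally show ?thesis by (simp add: mult.commute)
qed

text \<open>Let the Gaussian regulariser tend to 1. On the left the integrable function
  \<open>ifourier g\<close> dominates; on the right the averages converge to g. Each side
  contributes one factor (2\<pi>)^(n/2).\<close>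

lemma fourier_inversion:
  fixes g :: "real ^ 'n \<Rightarrow> complex"
  assumes g: "schwartz g"
  shows "fourier (ifourier g) \<xi> = (2 * pi) ^ CARD('n) * g \<xi>"
proof -
  have Sg: "schwartz (ifourier g)" by (rule schwartz_ifourier[OF g])
  note [measurable] = schwartz_measurable[OF Sg]
  let ?s = "\<lambda>m. 1 / real (Suc m)"
  let ?L = "\<lambda>m. LINT x|lborel. cis (- (x \<bullet> \<xi>)) * complex_of_real (exp (- ((?s m)\<^sup>2 * (norm x)\<^sup>2) / 2)) * ifourier g x"
  have L: "?L \<longlonglongrightarrow> (LINT x|lborel. cis (- (x \<bullet> \<xi>)) * ifourier g x)"
  proof (rule integral_dominated_convergence[where w = "\<lambda>x. norm (ifourier g x)"])
    show "integrable lborel (\<lambda>x. norm (ifourier g x))" by (intro integrable_norm schwartz_integrable Sg)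
    show "AE x in lborel. norm (cis (- (x \<bullet> \<xi>)) * complex_of_real (exp (- ((?s m)\<^sup>2 * (norm x)\<^sup>2) / 2)) * ifourier g x) \<le> norm (ifourier g x)" for m
      by (auto simp: norm_mult intro!: mult_left_le_one_le)
    show "AE x in lborel. (\<lambda>m. cis (- (x \<bullet> \<xi>)) * complex_of_real (exp (- ((?s m)\<^sup>2 * (norm x)\<^sup>2) / 2)) * ifourier g x)
      \<longlonglongrightarrow> cis (- (x \<bullet> \<xi>)) * ifourier g x"
    proof (rule AE_I2)
      fix x :: "real^'n"
      have "?s \<longlonglongrightarrow> 0" using LIMSEQ_inverse_real_of_nat by (simp add: inverse_eq_divide)
      then have "(\<lambda>m. exp (- ((?s m)\<^sup>2 * (norm x)\<^sup>2) / 2)) \<longlonglongrightarrow> exp (- (0\<^sup>2 * (norm x)\<^sup>2) / 2)"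
        by (intro tendsto_intros) auto
      then have "(\<lambda>m. complex_of_real (exp (- ((?s m)\<^sup>2 * (norm x)\<^sup>2) / 2))) \<longlonglongrightarrow> complex_of_real 1"
        by (intro tendsto_of_real) simp
      then have "(\<lambda>m. cis (- (x \<bullet> \<xi>)) * complex_of_real (exp (- ((?s m)\<^sup>2 * (norm x)\<^sup>2) / 2)) * ifourier g x)
        \<longlonglongrightarrow> cis (- (x \<bullet> \<xi>)) * complex_of_real 1 * ifourier g x"
        by (intro tendsto_mult tendsto_const)
      then show "(\<lambda>m. cis (- (x \<bullet> \<xi>)) * complex_of_real (exp (- ((?s m)\<^sup>2 * (norm x)\<^sup>2) / 2)) * ifourier g x)
        \<longlonglongrightarrow> cis (- (x \<bullet> \<xi>)) * ifourier g x" by simp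
    qed
  qed measurable
  have eq: "?L = (\<lambda>m. sqrt (2 * pi) ^ CARD('n) * gauss_avg (?s m) g \<xi>)"
    by (rule ext, rule gauss_regularised_ifourier) (use schwartz_integrable[OF g] in auto)
  have R: "(\<lambda>m. sqrt (2 * pi) ^ CARD('n) * gauss_avg (?s m) g \<xi>) \<longlonglongrightarrow> sqrt (2 * pi) ^ CARD('n) * (sqrt (2 * pi) ^ CARD('n) * g \<xi>)"
    by (intro tendsto_mult_left gauss_avg_tendsto schwartz_continuous[OF g] bdd_fun_rapid_fun schwartz_rapid[OF g])
  have "(LINT x|lborel. cis (- (x \<bullet> \<xi>)) * ifourier g x) = sqrt (2 * pi) ^ CARD('n) * (sqrt (2 * pi) ^ CARD('n) * g \<xi>)"
    by (rule LIMSEQ_unique[OF L R[folded eq]])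
  also have "\<dots> = complex_of_real ((sqrt (2 * pi) * sqrt (2 * pi)) ^ CARD('n)) * g \<xi>"
    by (simp only: power_mult_distrib of_real_mult of_real_power mult_ac)
  also have "sqrt (2 * pi) * sqrt (2 * pi) = 2 * pi" by simp
  finally show ?thesis unfolding fourier_def by simp
qed

text \<open>Squared norms in \<open>[0, \<infinity>]\<close>: integrability then needs no separate treatment, and instead of
  Minkowski's inequality \<open>sqn (f + g) \<le> 2 sqn f + 2 sqn g\<close> suffices, as constants are irrelevant.\<close>

definition sqn :: "('a::euclidean_space \<Rightarrow> complex) \<Rightarrow> ennreal"
  where "sqn f = (\<integral>\<^sup>+x. ennreal ((norm (f x))\<^sup>2) \<partial>lborel)"

text \<open>Fatou's lemma in the form used to remove cutoffs from a uniform bound; the cutoffs will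
  be Gaussians and indicators of time intervals.\<close>

lemma nn_integral_weight_limit:
  assumes [measurable]: "f \<in> borel_measurable M" "\<And>m. r m \<in> borel_measurable M"
    and r: "\<And>x. (\<lambda>m. r m x) \<longlonglongrightarrow> 1"
    and bound: "\<And>m::nat. (\<integral>\<^sup>+x. ennreal (f x * r m x) \<partial>M) \<le> B"
  shows "(\<integral>\<^sup>+x. ennreal (f x) \<partial>M) \<le> B"
proof -
  have "(\<integral>\<^sup>+x. ennreal (f x) \<partial>M) = (\<integral>\<^sup>+x. liminf (\<lambda>m. ennreal (f x * r m x)) \<partial>M)"
  proof (intro nn_integral_cong)
    fix x
    have "(\<lambda>m. f x * r m x) \<longlonglongrightarrow> f x * 1" by (intro tendsto_mult_left r)
    then have "(\<lambda>m. ennreal (f x * r m x)) \<longlonglongrightarrow> ennreal (f x)"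
      by (intro tendsto_ennrealI) simp
    then show "ennreal (f x) = liminf (\<lambda>m. ennreal (f x * r m x))"
      by (intro lim_imp_Liminf[symmetric]) auto
  qed
  also have "\<dots> \<le> liminf (\<lambda>m. \<integral>\<^sup>+x. ennreal (f x * r m x) \<partial>M)"
    by (intro nn_integral_liminf) measurable
  also have "\<dots> \<le> liminf (\<lambda>m. B)"
    by (intro Liminf_mono always_eventually allI bound)
  also have "\<dots> = B" by (simp add: Liminf_const)
  finally show ?thesis .
qed

lemma nn_integral_gauss_limit:
  assumes [measurable]: "f \<in> borel_measurable M" "\<phi> \<in> borel_measurable M"
    and bound: "\<And>\<epsilon>. \<epsilon> > 0 \<Longrightarrow> (\<integral>\<^sup>+x. ennreal (f x * exp (- (\<epsilon> * \<phi> x) / 2)) \<partial>M) \<le> B"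
  shows "(\<integral>\<^sup>+x. ennreal (f x) \<partial>M) \<le> B"
proof (rule nn_integral_weight_limit)
  fix x
  have "(\<lambda>m. 1 / real (Suc m)) \<longlonglongrightarrow> 0" using LIMSEQ_inverse_real_of_nat by (simp add: inverse_eq_divide)
  then have "(\<lambda>m. exp (- (1 / real (Suc m) * \<phi> x) / 2)) \<longlonglongrightarrow> exp (- (0 * \<phi> x) / 2)"
    by (intro tendsto_intros) auto
  then show "(\<lambda>m. exp (- (1 / real (Suc m) * \<phi> x) / 2)) \<longlonglongrightarrow> 1" by simp
next
  show "(\<integral>\<^sup>+x. ennreal (f x * exp (- (1 / real (Suc m) * \<phi> x) / 2)) \<partial>M) \<le> B" for m
    by (rule bound) simp
qed measurable

text \<open>Model case of the smoothing argument: with z = x, plane waves and a Gaussian measure in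
  x, the kernel of T^* T is itself a Gaussian.\<close>

lemma sqn_ifourier_le:
  fixes q :: "real ^ 'n \<Rightarrow> complex"
  assumes q: "integrable lborel q" "integrable lborel (\<lambda>\<xi>. (norm (q \<xi>))\<^sup>2)"
  shows "sqn (ifourier q) \<le> ennreal ((2 * pi) ^ CARD('n) * (LINT \<xi>|lborel. (norm (q \<xi>))\<^sup>2))"
proof -
  have [measurable]: "q \<in> borel_measurable borel" using borel_measurable_integrable[OF q(1)] by simp
  have [measurable]: "ifourier q \<in> borel_measurable borel" unfolding ifourier_def by measurable
  show ?thesis unfolding sqn_def
  proof (rule nn_integral_gauss_limit[where \<phi> = "\<lambda>x. (norm x)\<^sup>2"])
    fix \<epsilon> :: real assume \<epsilon>: "\<epsilon> > 0"
    define \<mu> where "\<mu> = density lborel (\<lambda>x::real^'n. ennreal (exp (- (\<epsilon> * (norm x)\<^sup>2) / 2)))"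
    \<comment> \<open>Its mass is (2\<pi>/\<epsilon>)^(n/2) (2\<pi>\<epsilon>)^(n/2) = (2\<pi>)^n
      for every \<epsilon>.\<close>
    define k where "k \<zeta> = sqrt (2 * pi / \<epsilon>) ^ CARD('n) * exp (- ((1 / \<epsilon>) * (norm \<zeta>)\<^sup>2) / 2)" for \<zeta> :: "real^'n"
    have fin: "finite_measure \<mu>"
    proof
      have "emeasure \<mu> (space \<mu>) = (\<integral>\<^sup>+x. ennreal (exp (- (\<epsilon> * (norm (x::real^'n))\<^sup>2) / 2)) \<partial>lborel)"
        unfolding \<mu>_def by (subst emeasure_density) auto
      also have "\<dots> < \<infinity>" using gauss_fourier(1)[OF \<epsilon>, where 'n = 'n] by (simp add: nn_integral_eq_integral)
      finally show "emeasure \<mu> (space \<mu>) \<noteq> \<infinity>" by simp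
    qed
    have k: "integrable lborel k" "(LINT \<zeta>|lborel. k \<zeta>) = (2 * pi) ^ CARD('n)"
    proof -
      show "integrable lborel k" unfolding k_def
        by (intro integrable_mult_right gauss_fourier(1)) (use \<epsilon> in simp)
      have "(LINT \<zeta>|lborel. k \<zeta>) = sqrt (2 * pi / \<epsilon>) ^ CARD('n) * sqrt (2 * pi / (1 / \<epsilon>)) ^ CARD('n)"
        unfolding k_def using gauss_integral[of "1 / \<epsilon>", where 'n = 'n] \<epsilon> by simp
      also have "\<dots> = (2 * pi) ^ CARD('n)"
      proof -
        have "(2 * pi / \<epsilon>) * (2 * pi / (1 / \<epsilon>)) = (2 * pi)\<^sup>2" using \<epsilon> by (simp add: power2_eq_square)
        then have "sqrt (2 * pi / \<epsilon>) * sqrt (2 * pi / (1 / \<epsilon>)) = 2 * pi"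
          unfolding real_sqrt_mult[symmetric] by (simp only: real_sqrt_abs) simp
        then show ?thesis by (simp only: power_mult_distrib[symmetric])
      qed
      finally show "(LINT \<zeta>|lborel. k \<zeta>) = (2 * pi) ^ CARD('n)" .
    qed
    have "(\<integral>\<^sup>+x. ennreal ((norm (LINT \<xi>|lborel. cis (x \<bullet> \<xi>) * q \<xi>))\<^sup>2) \<partial>\<mu>)
        \<le> ennreal ((LINT \<zeta>|lborel. k \<zeta>) * (LINT \<xi>|lborel. (norm (q \<xi>))\<^sup>2))"
    proof (rule TT_star_bound[OF fin _ _ q k(1)])
      have "(\<lambda>(z, \<xi>::real^'n). cis (z \<bullet> \<xi>)) \<in> borel_measurable (lborel \<Otimes>\<^sub>M lborel)" by measurable
      then show "(\<lambda>(z, \<xi>). cis (z \<bullet> \<xi>)) \<in> borel_measurable (\<mu> \<Otimes>\<^sub>M lborel)"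
        by (simp add: \<mu>_def cong: measurable_cong_sets)
      show "0 \<le> k \<zeta>" for \<zeta> unfolding k_def using \<epsilon> by simp
      fix \<xi> \<eta> :: "real^'n"
      have "(LINT z|\<mu>. cis (z \<bullet> \<xi>) * cnj (cis (z \<bullet> \<eta>))) =
        (LINT z|lborel. cis (z \<bullet> (\<xi> - \<eta>)) * complex_of_real (exp (- (\<epsilon> * (norm z)\<^sup>2) / 2)))"
        unfolding \<mu>_def
        by (subst integral_density)
           (auto simp: cis_cnj cis_mult inner_diff_right scaleR_conv_of_real mult.commute)
      also have "\<dots> = complex_of_real (k (\<xi> - \<eta>))"
      proof -
        have "- (norm (\<xi> - \<eta>))\<^sup>2 / (2 * \<epsilon>) = - ((1 / \<epsilon>) * (norm (\<xi> - \<eta>))\<^sup>2) / 2"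
          by (simp add: field_simps)
        then show ?thesis unfolding gauss_fourier(2)[OF \<epsilon>] k_def by (simp only:)
      qed
      finally have eq: "(LINT z|\<mu>. cis (z \<bullet> \<xi>) * cnj (cis (z \<bullet> \<eta>))) = complex_of_real (k (\<xi> - \<eta>))" .
      have "k (\<xi> - \<eta>) \<ge> 0" unfolding k_def using \<epsilon> by simp
      then show "norm (LINT z|\<mu>. cis (z \<bullet> \<xi>) * cnj (cis (z \<bullet> \<eta>))) \<le> k (\<xi> - \<eta>)"
        unfolding eq norm_of_real by simp
    qed simp
    also have "(\<integral>\<^sup>+x. ennreal ((norm (LINT \<xi>|lborel. cis (x \<bullet> \<xi>) * q \<xi>))\<^sup>2) \<partial>\<mu>) =
      (\<integral>\<^sup>+x. ennreal ((norm (ifourier q x))\<^sup>2 * exp (- (\<epsilon> * (norm x)\<^sup>2) / 2)) \<partial>lborel)"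
      unfolding \<mu>_def ifourier_def[symmetric]
      by (subst nn_integral_density) (auto simp: ennreal_mult mult.commute)
    finally show "(\<integral>\<^sup>+x. ennreal ((norm (ifourier q x))\<^sup>2 * exp (- (\<epsilon> * (norm x)\<^sup>2) / 2)) \<partial>lborel)
      \<le> ennreal ((2 * pi) ^ CARD('n) * (LINT \<xi>|lborel. (norm (q \<xi>))\<^sup>2))" unfolding k(2) .
  qed simp_all
qed

subsection \<open>Density of Schwartz functions\<close>

lemma norm_add_square_le: "(norm (a + b))\<^sup>2 \<le> 2 * (norm a)\<^sup>2 + 2 * (norm (b::'a::real_normed_vector))\<^sup>2"
proof -
  have "(norm (a + b))\<^sup>2 \<le> (norm a + norm b)\<^sup>2" by (intro power_mono norm_triangle_ineq) simp
  also have "\<dots> \<le> 2 * (norm a)\<^sup>2 + 2 * (norm b)\<^sup>2"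
    using sum_squares_bound[of "norm a" "norm b"] by (simp add: power2_sum)
  finally show ?thesis .
qed

lemma sqn_mono: "(\<And>x. norm (f x) \<le> norm (g x)) \<Longrightarrow> sqn f \<le> sqn g"
  unfolding sqn_def by (intro nn_integral_mono ennreal_leI power_mono) auto

lemma sqn_cmult:
  assumes [measurable]: "f \<in> borel_measurable borel"
  shows "sqn (\<lambda>x. c * f x) = ennreal ((norm c)\<^sup>2) * sqn f"
  unfolding sqn_def
  by (subst nn_integral_cmult[symmetric]) (auto simp: norm_mult power_mult_distrib ennreal_mult)

lemma sqn_add_le:
  assumes [measurable]: "f \<in> borel_measurable borel" "g \<in> borel_measurable borel"
  shows "sqn (\<lambda>x. f x + g x) \<le> 2 * sqn f + 2 * sqn g"
proof -
  have "sqn (\<lambda>x. f x + g x) \<le> (\<integral>\<^sup>+x. 2 * ennreal ((norm (f x))\<^sup>2) + 2 * ennreal ((norm (g x))\<^sup>2) \<partial>lborel)"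
    unfolding sqn_def
  proof (intro nn_integral_mono)
    fix x
    have "ennreal ((norm (f x + g x))\<^sup>2) \<le> ennreal (2 * (norm (f x))\<^sup>2 + 2 * (norm (g x))\<^sup>2)"
      by (intro ennreal_leI norm_add_square_le)
    also have "\<dots> = 2 * ennreal ((norm (f x))\<^sup>2) + 2 * ennreal ((norm (g x))\<^sup>2)"
      by (simp add: ennreal_mult)
    finally show "ennreal ((norm (f x + g x))\<^sup>2) \<le> 2 * ennreal ((norm (f x))\<^sup>2) + 2 * ennreal ((norm (g x))\<^sup>2)" .
  qed
  also have "\<dots> = 2 * sqn f + 2 * sqn g"
    unfolding sqn_def by (simp add: nn_integral_add nn_integral_cmult)
  finally show ?thesis .
qed

lemma sqn_tendsto_0:
  assumes [measurable]: "\<And>m. f m \<in> borel_measurable borel" "w \<in> borel_measurable borel"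
    and lim: "AE x in lborel. (\<lambda>m. f m x) \<longlonglongrightarrow> 0"
    and bd: "\<And>m x. (norm (f m x))\<^sup>2 \<le> w x" and w: "(\<integral>\<^sup>+x. ennreal (w x) \<partial>lborel) < \<infinity>"
  shows "(\<lambda>m. sqn (f m)) \<longlonglongrightarrow> 0"
proof -
  have "(\<lambda>m. sqn (f m)) \<longlonglongrightarrow> (\<integral>\<^sup>+x. 0 \<partial>(lborel :: 'a measure))"
    unfolding sqn_def
  proof (rule nn_integral_dominated_convergence[where w = "\<lambda>x. ennreal (w x)"])
    show "AE x in lborel. (\<lambda>m. ennreal ((norm (f m x))\<^sup>2)) \<longlonglongrightarrow> 0"
      using lim
    proof eventually_elim
      case (elim x)
      then have "(\<lambda>m. (norm (f m x))\<^sup>2) \<longlonglongrightarrow> (norm (0::complex))\<^sup>2" by (intro tendsto_intros)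
      then have "(\<lambda>m. ennreal ((norm (f m x))\<^sup>2)) \<longlonglongrightarrow> ennreal 0" by (intro tendsto_ennrealI) simp
      then show ?case by simp
    qed
    show "AE x in lborel. ennreal ((norm (f m x))\<^sup>2) \<le> ennreal (w x)" for m
      using bd by (auto intro: ennreal_leI)
  qed (use w in auto)
  then show ?thesis by simp
qed

lemma nn_integral_const_indicator:
  "A \<in> sets M \<Longrightarrow> c \<ge> 0 \<Longrightarrow> (\<integral>\<^sup>+x. ennreal (c * indicator A x) \<partial>M) = ennreal c * emeasure M A"
  by (subst nn_integral_cmult_indicator[symmetric]) (auto simp: ennreal_mult ennreal_indicator)

text \<open>A measurable function is an almost everywhere limit of continuous functions. These are
  made bounded and compactly supported without spoiling continuity or the limit, so that dominated
  convergence gives convergence in L2.\<close>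

lemma bounded_approx_continuous:
  fixes G :: "real^'n \<Rightarrow> complex"
  assumes [measurable]: "G \<in> borel_measurable borel"
    and M: "M > 0" "\<And>x. norm (G x) \<le> M" and supp: "\<And>x. norm x > M \<Longrightarrow> G x = 0" and e: "e > 0"
  shows "\<exists>H. continuous_on UNIV H \<and> (\<forall>x. norm x > M + 1 \<longrightarrow> H x = 0) \<and> sqn (\<lambda>x. G x - H x) < e"
proof -
  have "G measurable_on UNIV"
    by (subst measurable_on_iff_borel_measurable) (auto simp: lebesgue_on_UNIV_eq intro: measurable_completion)
  then obtain N g where N: "negligible N" and g: "\<And>n. continuous_on UNIV (g n)"
    and lim: "\<And>x. x \<notin> N \<Longrightarrow> (\<lambda>n::nat. g n x) \<longlonglongrightarrow> G x"
    unfolding measurable_on_def by auto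
  \<comment> \<open>\<open>cl\<close> is the radial retraction onto the disc of radius M, which
    fixes all values of G. \<open>\<rho>\<close> is a continuous cutoff, 1 where |x| \<le> M and 0
    where |x| \<ge> M + 1.\<close>
  define cl where "cl z = (M / max M (norm z)) *\<^sub>R z" for z :: complex
  define \<rho> where "\<rho> x = max 0 (min 1 (M + 1 - norm x))" for x :: "real^'n"
  define H where "H n x = \<rho> x *\<^sub>R cl (g n x)" for n x
  have cl_cont: "continuous_on UNIV cl"
    unfolding cl_def using M(1) by (intro continuous_intros) (auto simp: max_def)
  have cl_norm: "norm (cl z) \<le> M" for z
    using M(1) by (auto simp: cl_def max_def field_simps)
  have cl_id: "cl z = z" if "norm z \<le> M" for z using that M(1) by (simp add: cl_def max_def)
  have H_cont: "continuous_on UNIV (H n)" for n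
    unfolding H_def \<rho>_def
    by (intro continuous_on_scaleR continuous_intros continuous_on_compose2[OF cl_cont g]) auto
  have H_supp: "H n x = 0" if "norm x > M + 1" for n x using that by (simp add: H_def \<rho>_def)
  have H_norm: "norm (H n x) \<le> M" for n x
  proof -
    have "norm (H n x) = \<rho> x * norm (cl (g n x))" by (simp add: H_def \<rho>_def)
    also have "\<dots> \<le> 1 * M" using cl_norm M(1) by (intro mult_mono) (auto simp: \<rho>_def)
    finally show ?thesis by simp
  qed
  have [measurable]: "H n \<in> borel_measurable borel" for n by (rule borel_measurable_continuous_onI[OF H_cont])
  have "(\<lambda>n. sqn (\<lambda>x. G x - H n x)) \<longlonglongrightarrow> 0"
  proof (rule sqn_tendsto_0[where w = "\<lambda>x. (2 * M)\<^sup>2 * indicator (cball 0 (M + 1)) x"])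
    have "AE x in lebesgue. x \<notin> N"
      using N by (auto simp: negligible_iff_null_sets intro!: AE_not_in)
    then have "AE x in lborel. x \<notin> N" by (simp add: AE_completion_iff)
    then show "AE x in lborel. (\<lambda>n. G x - H n x) \<longlonglongrightarrow> 0"
    proof eventually_elim
      case (elim x)
      have "(\<lambda>n. cl (g n x)) \<longlonglongrightarrow> cl (G x)"
        using cl_cont lim[OF elim] by (intro isCont_tendsto_compose[of _ cl]) (auto simp: continuous_on_eq_continuous_at)
      then have "(\<lambda>n. cl (g n x)) \<longlonglongrightarrow> G x" using cl_id[OF M(2)] by simp
      then have "(\<lambda>n. G x - H n x) \<longlonglongrightarrow> G x - \<rho> x *\<^sub>R G x" unfolding H_def by (intro tendsto_intros)
      moreover have "\<rho> x *\<^sub>R G x = G x" using supp[of x] by (cases "norm x > M") (auto simp: \<rho>_def)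
      ultimately show ?case by simp
    qed
    show "(norm (G x - H n x))\<^sup>2 \<le> (2 * M)\<^sup>2 * indicator (cball 0 (M + 1)) x" for n x
    proof (cases "norm x > M + 1")
      case True
      then show ?thesis using supp[of x] H_supp[OF True] by simp
    next
      case False
      have "norm (G x - H n x) \<le> 2 * M" using norm_triangle_ineq4[of "G x" "H n x"] M(2)[of x] H_norm[of n x] by linarith
      from power_mono[OF this, of 2] show ?thesis using False by simp
    qed
    have [measurable]: "cball (0::real^'n) (M + 1) \<in> sets borel" by simp
    show "(\<lambda>x. (2 * M)\<^sup>2 * indicator (cball (0::real^'n) (M + 1)) x) \<in> borel_measurable borel" by measurable
    show "(\<integral>\<^sup>+x. ennreal ((2 * M)\<^sup>2 * indicator (cball (0::real^'n) (M + 1)) x) \<partial>lborel) < \<infinity>"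
      by (subst nn_integral_const_indicator)
         (use emeasure_lborel_cball_finite[of "0::real^'n" "M + 1"] in \<open>auto simp: ennreal_mult_less_top\<close>)
  qed measurable
  then have "\<forall>\<^sub>F n in sequentially. sqn (\<lambda>x. G x - H n x) < e" using e by (rule order_tendstoD)
  then obtain n where "sqn (\<lambda>x. G x - H n x) < e" by (auto simp: eventually_sequentially)
  then show ?thesis using H_cont H_supp by blast
qed

text \<open>Splits a tolerance according to the two factors 2 in \<open>sqn_add_le\<close>; the
  tolerance may be infinite.\<close>

lemma ennreal_quarter: "(e::ennreal) > 0 \<Longrightarrow> \<exists>d>0. 2 * d + 2 * d \<le> e"
proof (cases e rule: ennreal_cases)
  case (real r)
  assume "e > 0"
  then have "r > 0" using real by simp
  have "2 * ennreal (r / 4) = ennreal (2 * (r / 4))"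
    by (subst ennreal_mult') simp_all
  then have "2 * ennreal (r / 4) + 2 * ennreal (r / 4) = ennreal (2 * (r / 4) + 2 * (r / 4))"
    using real(1) by (subst ennreal_plus) simp_all
  then show ?thesis using real \<open>r > 0\<close> by (intro exI[of _ "ennreal (r / 4)"]) simp
next
  case top
  then show ?thesis by (intro exI[of _ 1]) simp
qed

lemma L2_approx_continuous:
  fixes F :: "real^'n \<Rightarrow> complex"
  assumes F[measurable]: "F \<in> borel_measurable borel" and fin: "sqn F < \<infinity>" and e: "e > 0"
  shows "\<exists>H R. continuous_on UNIV H \<and> (\<forall>x. norm x > R \<longrightarrow> H x = 0) \<and> sqn (\<lambda>x. F x - H x) < e"
proof -
  obtain d where d: "d > 0" "2 * d + 2 * d \<le> e" using ennreal_quarter[OF e] by blast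
  define G where "G m x = (if norm (F x) \<le> real (Suc m) \<and> norm x \<le> real (Suc m) then F x else 0)" for m x
  have [measurable]: "G m \<in> borel_measurable borel" for m unfolding G_def by measurable
  have "(\<lambda>m. sqn (\<lambda>x. F x - G m x)) \<longlonglongrightarrow> 0"
  proof (rule sqn_tendsto_0[where w = "\<lambda>x. (norm (F x))\<^sup>2"])
    show "AE x in lborel. (\<lambda>m. F x - G m x) \<longlonglongrightarrow> 0"
    proof (rule AE_I2)
      fix x
      obtain M :: nat where M: "max (norm (F x)) (norm x) \<le> real M" using real_arch_simple by blast
      have "\<forall>\<^sub>F m in sequentially. F x - G m x = 0"
        using eventually_ge_at_top[of M] by eventually_elim (use M in \<open>auto simp: G_def\<close>)
      then show "(\<lambda>m. F x - G m x) \<longlonglongrightarrow> 0" by (rule tendsto_eventually)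
    qed
    show "(\<integral>\<^sup>+x. ennreal ((norm (F x))\<^sup>2) \<partial>lborel) < \<infinity>" using fin unfolding sqn_def .
  qed (auto simp: G_def)
  then have "\<forall>\<^sub>F m in sequentially. sqn (\<lambda>x. F x - G m x) < d" using d(1) by (rule order_tendstoD)
  then obtain m where m: "sqn (\<lambda>x. F x - G m x) < d" by (auto simp: eventually_sequentially)
  obtain H where H: "continuous_on UNIV H" "\<And>x. norm x > real (Suc m) + 1 \<Longrightarrow> H x = 0" "sqn (\<lambda>x. G m x - H x) < d"
  proof -
    have "norm (G m x) \<le> real (Suc m)" for x by (auto simp: G_def)
    moreover have "G m x = 0" if "norm x > real (Suc m)" for x using that by (auto simp: G_def)
    ultimately show ?thesis
      using bounded_approx_continuous[of "G m" "real (Suc m)" d] d(1) that by auto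
  qed
  have [measurable]: "H \<in> borel_measurable borel" by (rule borel_measurable_continuous_onI[OF H(1)])
  have "sqn (\<lambda>x. F x - H x) = sqn (\<lambda>x. (F x - G m x) + (G m x - H x))" by simp
  also have "\<dots> \<le> 2 * sqn (\<lambda>x. F x - G m x) + 2 * sqn (\<lambda>x. G m x - H x)" by (rule sqn_add_le) measurable
  also have "\<dots> < 2 * d + 2 * d"
  proof -
    have "2 * sqn (\<lambda>x. F x - G m x) < 2 * d" "2 * sqn (\<lambda>x. G m x - H x) < 2 * d"
      using m H(3) by (auto intro!: ennreal_mult_strict_left_mono)
    then show ?thesis by (rule add_strict_mono)
  qed
  finally show ?thesis using H d(2) by (meson order.strict_trans2)
qed

section \<open>Gaussian mollification and weighted approximation\<close>

lemma power_le_exp: "u \<ge> 0 \<Longrightarrow> u ^ N \<le> real N ^ N * exp u"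
proof (cases "N = 0")
  case False
  assume u: "u \<ge> 0"
  have "(u / real N) ^ N \<le> (1 + u / real N) ^ N" using u by (intro power_mono) auto
  also have "\<dots> \<le> exp u" using False u by (intro exp_ge_one_plus_x_over_n_power_n) auto
  finally show ?thesis using False by (simp add: power_divide field_simps)
qed simp

definition gaussian :: "real \<Rightarrow> real^'n \<Rightarrow> complex"
  where "gaussian s \<xi> = complex_of_real (exp (- (s\<^sup>2 * (norm \<xi>)\<^sup>2) / 2))"

text \<open>The inequality u^N \<le> N^N exp u at u = c \<langle>\<xi>\<rangle>^2 compares any power
  of the weight with the reciprocal of the Gaussian.\<close>

lemma rapid_gaussian:
  assumes s: "s > 0" shows "rapid_fun (gaussian s)"
  unfolding rapid_fun_def
proof
  fix N
  define c where "c = s\<^sup>2 / 2"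
  have c: "c > 0" using s by (simp add: c_def)
  have "\<langle>\<xi>\<rangle> ^ N * norm (gaussian s \<xi>) \<le> real N ^ N * exp c / c ^ N" for \<xi> :: "real^'n"
  proof -
    have "\<langle>\<xi>\<rangle> ^ N \<le> \<langle>\<xi>\<rangle> ^ (2 * N)" by (intro power_increasing japanese_ge_1) simp
    then have "c ^ N * \<langle>\<xi>\<rangle> ^ N \<le> (c * \<langle>\<xi>\<rangle>\<^sup>2) ^ N"
      using c by (simp add: power_mult power_mult_distrib)
    also have "\<dots> \<le> real N ^ N * exp (c * \<langle>\<xi>\<rangle>\<^sup>2)" using c by (intro power_le_exp) simp
    also have "\<dots> = real N ^ N * exp c * exp (c * (norm \<xi>)\<^sup>2)"
      by (simp add: japanese_sq distrib_left exp_add)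
    finally have "c ^ N * \<langle>\<xi>\<rangle> ^ N * exp (- (c * (norm \<xi>)\<^sup>2)) \<le> real N ^ N * exp c * exp (c * (norm \<xi>)\<^sup>2) * exp (- (c * (norm \<xi>)\<^sup>2))"
      by (rule mult_right_mono) simp
    also have "\<dots> = real N ^ N * exp c" by (simp add: mult.assoc flip: exp_add)
    finally have "c ^ N * (\<langle>\<xi>\<rangle> ^ N * norm (gaussian s \<xi>)) \<le> real N ^ N * exp c"
      by (simp add: gaussian_def c_def mult.assoc)
    then show ?thesis using c by (simp add: field_simps)
  qed
  then show "\<exists>C. \<forall>\<xi>::real^'n. \<langle>\<xi>\<rangle> ^ N * norm (gaussian s \<xi>) \<le> C" by blast
qed

lemma schwartz_gaussian:
  assumes s: "s > 0" shows "schwartz (gaussian s :: real^'n \<Rightarrow> complex)"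
  unfolding schwartz_iff
proof (rule smooth_with_coinduct[where X = "{\<lambda>\<xi>. b \<xi> * gaussian s \<xi> | b. smooth_with poly_fun b}"], goal_cases)
  case 1
  have "smooth_with poly_fun (\<lambda>x::real^'n. 1 :: complex)" by (rule slow_const)
  moreover have "gaussian s = (\<lambda>x::real^'n. 1 * gaussian s x)" by simp
  ultimately show ?case by (intro CollectI exI conjI)
next
  case (2 h)
  then obtain b where b: "smooth_with poly_fun b" "h = (\<lambda>x. b x * gaussian s x)" by auto
  have pc: "(gaussian s has_derivative (\<lambda>h. complex_of_real (- s\<^sup>2 * (x \<bullet> h)) * gaussian s x)) (at x)" for x :: "real^'n"
  proof -
    have "((\<lambda>x::real^'n. exp (- (s\<^sup>2 * (x \<bullet> x)) / 2)) has_derivative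
        (\<lambda>h. - (s\<^sup>2 * (x \<bullet> h)) * exp (- (s\<^sup>2 * (x \<bullet> x)) / 2))) (at x)"
      by (auto intro!: derivative_eq_intros simp: inner_commute algebra_simps)
    then have "((\<lambda>x::real^'n. complex_of_real (exp (- (s\<^sup>2 * (x \<bullet> x)) / 2))) has_derivative
        (\<lambda>h. complex_of_real (- (s\<^sup>2 * (x \<bullet> h)) * exp (- (s\<^sup>2 * (x \<bullet> x)) / 2)))) (at x)"
      by (rule has_derivative_of_real)
    then show ?thesis
      unfolding gaussian_def power2_norm_eq_inner by simp
  qed
  have d: "gaussian s differentiable (at x)" for x :: "real^'n" using pc unfolding differentiable_def by blast
  have "h differentiable (at x)" for x unfolding b(2)
    by (intro differentiable_mult smooth_withD(1)[OF b(1)] d)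
  moreover have "partial i h = (\<lambda>x. (partial i b x + complex_of_real (- s\<^sup>2) * (complex_of_real (x $ i) * b x)) * gaussian s x)" for i
    unfolding b(2)
  proof
    fix x
    show "partial i (\<lambda>x. b x * gaussian s x) x =
        (partial i b x + complex_of_real (- s\<^sup>2) * (complex_of_real (x $ i) * b x)) * gaussian s x"
      unfolding partial_mult[OF smooth_withD(1)[OF b(1)] d] partial_eqI[OF pc]
      by (simp add: cart_eq_inner_axis algebra_simps)
  qed
  moreover have "smooth_with poly_fun (\<lambda>x. partial i b x + complex_of_real (- s\<^sup>2) * (complex_of_real (x $ i) * b x))" for i
    by (intro slow_add slow_mult slow_const slow_of_real slow_component smooth_with_partial b)
  moreover have "rapid_fun h" unfolding b(2)
    by (intro rapid_fun_mult smooth_withD(2)[OF b(1)] rapid_gaussian s)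
  ultimately show ?case by (intro conjI allI CollectI exI) auto
qed

text \<open>A derivative of the transform costs a power of \<xi>, that is decay of g, and never a
  derivative of g. Measurable rapidly decreasing functions thus form a family that is stable under
  the required multiplications.\<close>

lemma tame_ifourier:
  fixes g :: "real^'n \<Rightarrow> complex"
  assumes "g \<in> borel_measurable borel" "rapid_fun g"
  shows "smooth_with bdd_fun (ifourier g)"
proof (rule smooth_with_coinduct[where X = "{ifourier g | g. g \<in> borel_measurable borel \<and> rapid_fun g}"], goal_cases)
  case 1 then show ?case using assms by blast
next
  case (2 f)
  then obtain g where g[measurable]: "g \<in> borel_measurable borel" and g': "rapid_fun g" and f: "f = ifourier g" by blast
  have "partial i f = ifourier (\<lambda>\<xi>. \<i> * complex_of_real (\<xi> $ i) * g \<xi>)" for i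
    unfolding f by (rule partial_ifourier[OF g g'])
  moreover have "rapid_fun (\<lambda>\<xi>. \<i> * complex_of_real (\<xi> $ i) * g \<xi>)" for i
    by (intro rapid_fun_mult g' smooth_withD(2)[OF slow_mult] slow_const slow_of_real slow_component)
  moreover have "(\<lambda>\<xi>. \<i> * complex_of_real (\<xi> $ i) * g \<xi>) \<in> borel_measurable borel" for i by measurable
  moreover have "f differentiable (at x)" for x
    unfolding f by (rule ifourier_differentiable[OF g g'])
  moreover have "bdd_fun f" unfolding f bdd_fun_def using norm_ifourier_le by blast
  ultimately show ?case by blast
qed

lemma ifourier_reflect: 
  assumes [measurable]: "g \<in> borel_measurable borel"
  shows "ifourier (\<lambda>x. g (- x)) \<xi> = ifourier g (- \<xi>)"
proof -
  have [measurable]: "(\<lambda>x. cis (- \<xi> \<bullet> x) * g x) \<in> borel_measurable borel" by measurable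
  show ?thesis unfolding ifourier_def
    using lborel_affine_vec(2)[of "-1" "\<lambda>x. cis (- \<xi> \<bullet> x) * g x" 0] by simp
qed

text \<open>The transform of f is tame, so cutting it off by a Gaussian gives a Schwartz function g,
  and transforming back gives averages of f on the scale s. In this way mollifications of f arise
  directly as \<open>ifourier\<close> of Schwartz functions.\<close>

lemma ifourier_mollified:
  fixes f :: "real^'n \<Rightarrow> complex"
  assumes f[measurable]: "f \<in> borel_measurable borel" and f': "rapid_fun f" and s: "s > 0"
  defines "g \<equiv> \<lambda>\<xi>. ifourier f (- \<xi>) * gaussian s \<xi>"
  shows "schwartz g" "ifourier g x = sqrt (2 * pi) ^ CARD('n) * gauss_avg s f x"
proof -
  have r: "rapid_fun (\<lambda>x. f (- x))"
    using f' unfolding rapid_fun_def japanese_def by (metis norm_minus_cancel)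
  have slow: "smooth_with poly_fun (\<lambda>\<xi>. ifourier f (- \<xi>))"
    using tame_ifourier[of "\<lambda>x. f (- x)"] r unfolding ifourier_reflect[OF f] by (intro slow_tame) auto
  show "schwartz g" unfolding g_def by (intro schwartz_slow_mult slow schwartz_gaussian s)
  have [measurable]: "ifourier f \<in> borel_measurable borel" unfolding ifourier_def by measurable
  have [measurable]: "gaussian s \<in> borel_measurable (borel :: (real^'n) measure)" unfolding gaussian_def by measurable
  have "ifourier g x = (LINT \<xi>|lborel. cis (x \<bullet> \<xi>) * g \<xi>)" unfolding ifourier_def ..
  also have "\<dots> = (LINT \<xi>|lborel. cis (x \<bullet> (0 + (-1) *\<^sub>R \<xi>)) * g (0 + (-1) *\<^sub>R \<xi>))"
    by (subst lborel_affine_vec(2)[where c = "-1" and t = 0]) (auto simp: g_def)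
  also have "\<dots> = (LINT \<xi>|lborel. cis (- (\<xi> \<bullet> x)) * complex_of_real (exp (- (s\<^sup>2 * (norm \<xi>)\<^sup>2) / 2)) * ifourier f \<xi>)"
    by (simp add: g_def gaussian_def inner_commute mult_ac)
  also have "\<dots> = sqrt (2 * pi) ^ CARD('n) * gauss_avg s f x"
    by (rule gauss_regularised_ifourier[OF s integrable_rapid[OF f f']])
  finally show "ifourier g x = sqrt (2 * pi) ^ CARD('n) * gauss_avg s f x" .
qed

text \<open>For s \<le> 1 Peetre's inequality bounds \<langle>x\<rangle> by 2 \<langle>x +
  sy\<rangle> \<langle>y\<rangle>. The first weight is absorbed by f and the second by the Gaussian.
  The uniformity in s provides the majorant for s \<rightarrow> 0.\<close>

lemma gauss_avg_rapid:
  fixes f :: "real^'n \<Rightarrow> complex"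
  assumes [measurable]: "f \<in> borel_measurable borel" and f': "rapid_fun f"
  shows "\<exists>C. \<forall>s x. 0 < s \<longrightarrow> s \<le> 1 \<longrightarrow> \<langle>x\<rangle> ^ N * norm (gauss_avg s f x) \<le> C"
proof -
  obtain C where C: "C > 0" "\<And>x. \<langle>x\<rangle> ^ N * norm (f x) \<le> C" using f' rapid_funE by blast
  have S: "schwartz (\<lambda>y::real^'n. complex_of_real (2 ^ N * C) * (complex_of_real (\<langle>y\<rangle>\<^sup>2) ^ N * gaussian 1 y))"
  proof (intro schwartz_cmult schwartz_slow_mult schwartz_gaussian)
    have "smooth_with poly_fun (\<lambda>y::real^'n. complex_of_real (\<langle>y\<rangle>\<^sup>2))"
      unfolding japanese_sq norm_sq_vec
      unfolding power2_eq_square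
      by (intro slow_of_real slow_add slow_const slow_sum slow_mult slow_component)
    then show "smooth_with poly_fun (\<lambda>y::real^'n. complex_of_real (\<langle>y\<rangle>\<^sup>2) ^ N)"
      by (induction N) (auto intro: slow_const slow_mult)
  qed simp
  define w where "w y = norm (complex_of_real (2 ^ N * C) * (complex_of_real (\<langle>y\<rangle>\<^sup>2) ^ N * gaussian 1 y))" for y :: "real^'n"
  have w: "integrable lborel w" unfolding w_def by (intro integrable_norm schwartz_integrable S)
  have "\<langle>x\<rangle> ^ N * norm (gauss_avg s f x) \<le> (LINT y|lborel. w y)" if s: "0 < s" "s \<le> 1" for s x
  proof -
    have "\<langle>x\<rangle> ^ N * norm (gauss_avg s f x) \<le> \<langle>x\<rangle> ^ N * (LINT y|lborel. norm (f (x + s *\<^sub>R y) * gaussian 1 y))"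
      unfolding gauss_avg_def gaussian_def
      by (intro mult_left_mono zero_le_power japanese_nonneg order.trans[OF integral_norm_bound]) simp
    also have "\<dots> = (LINT y|lborel. \<langle>x\<rangle> ^ N * norm (f (x + s *\<^sub>R y) * gaussian 1 y))" by simp
    also have "\<dots> \<le> (LINT y|lborel. w y)"
    proof (rule integral_mono'[OF w])
      fix y :: "real^'n"
      have "\<langle>- (s *\<^sub>R y)\<rangle> \<le> \<langle>y\<rangle>"
        unfolding japanese_def using s mult_left_le_one_le[of "norm y" s] by (auto intro!: power_mono)
      then have "\<langle>x\<rangle> \<le> 2 * \<langle>x + s *\<^sub>R y\<rangle> * \<langle>y\<rangle>"
        using japanese_add_le[of "x + s *\<^sub>R y" "- (s *\<^sub>R y)"]
          mult_left_mono[of "\<langle>- (s *\<^sub>R y)\<rangle>" "\<langle>y\<rangle>" "2 * \<langle>x + s *\<^sub>R y\<rangle>"] japanese_nonneg[of "x + s *\<^sub>R y"] by simp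
      then have "\<langle>x\<rangle> ^ N \<le> (2 * \<langle>x + s *\<^sub>R y\<rangle> * \<langle>y\<rangle>) ^ N" by (intro power_mono japanese_nonneg)
      then have "\<langle>x\<rangle> ^ N * norm (f (x + s *\<^sub>R y)) \<le> (2 * \<langle>x + s *\<^sub>R y\<rangle> * \<langle>y\<rangle>) ^ N * norm (f (x + s *\<^sub>R y))"
        by (rule mult_right_mono) simp
      also have "\<dots> = (2 ^ N * \<langle>y\<rangle> ^ N) * (\<langle>x + s *\<^sub>R y\<rangle> ^ N * norm (f (x + s *\<^sub>R y)))"
        by (simp add: power_mult_distrib mult_ac)
      also have "\<dots> \<le> (2 ^ N * \<langle>y\<rangle> ^ N) * C" by (intro mult_left_mono C) (simp add: japanese_nonneg)
      also have "\<dots> \<le> (2 ^ N * \<langle>y\<rangle> ^ (2 * N)) * C"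
        using C(1) by (intro mult_right_mono mult_left_mono power_increasing japanese_ge_1) auto
      finally have "\<langle>x\<rangle> ^ N * norm (f (x + s *\<^sub>R y)) * norm (gaussian 1 y) \<le> (2 ^ N * \<langle>y\<rangle> ^ (2 * N)) * C * norm (gaussian 1 y)"
        by (rule mult_right_mono) simp
      then show "\<langle>x\<rangle> ^ N * norm (f (x + s *\<^sub>R y) * gaussian 1 y) \<le> w y"
        using C(1) japanese_nonneg[of y] unfolding w_def norm_mult norm_power norm_of_real
        by (simp add: mult_ac flip: power_mult)
    qed (simp add: w_def)
    finally show ?thesis .
  qed
  then show ?thesis by blast
qed

text \<open>The function \<langle>x\<rangle>^k f is approximated by a continuous H of compact
  support; h = H / \<langle>x\<rangle>^k is of the same kind, and its Gaussian averages converge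
  pointwise with decay uniform in the scale, hence in the weighted norm. The approximants have the
  form \<open>ifourier g\<close> because the estimates for the flow are proved for data given on the
  frequency side.\<close>

lemma schwartz_dense:
  fixes f :: "real^'n \<Rightarrow> complex"
  assumes [measurable]: "f \<in> borel_measurable borel"
    and fin: "sqn (\<lambda>x. complex_of_real (\<langle>x\<rangle> ^ k) * f x) < \<infinity>" and e: "e > 0"
  shows "\<exists>g. schwartz g \<and> sqn (\<lambda>x. complex_of_real (\<langle>x\<rangle> ^ k) * (f x - ifourier g x)) < e"
proof -
  obtain d where d: "d > 0" "2 * d + 2 * d \<le> e" using ennreal_quarter[OF e] by blast
  obtain H R where H: "continuous_on UNIV H" "\<And>x. norm x > R \<Longrightarrow> H x = 0"
      "sqn (\<lambda>x. complex_of_real (\<langle>x\<rangle> ^ k) * f x - H x) < d"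
    using L2_approx_continuous[of "\<lambda>x. complex_of_real (\<langle>x\<rangle> ^ k) * f x" d] fin d(1) by auto
  have [measurable]: "H \<in> borel_measurable borel" by (rule borel_measurable_continuous_onI[OF H(1)])
  define h where "h x = H x / complex_of_real (\<langle>x\<rangle> ^ k)" for x
  have j0: "\<langle>x\<rangle> \<noteq> 0" for x :: "real^'n" using japanese_pos[of x] by simp
  have h_cont: "continuous_on UNIV h"
    unfolding h_def by (intro continuous_intros H(1)) (simp add: j0)
  have h_meas[measurable]: "h \<in> borel_measurable borel" by (rule borel_measurable_continuous_onI[OF h_cont])
  have hH: "complex_of_real (\<langle>x\<rangle> ^ k) * h x = H x" for x unfolding h_def by (simp add: j0)
  have h_rapid: "rapid_fun h" unfolding rapid_fun_def
  proof
    fix N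
    have "compact (cball 0 R :: (real^'n) set)" by simp
    moreover have "continuous_on (cball 0 R) (\<lambda>x. complex_of_real (\<langle>x\<rangle> ^ N) * h x)"
      by (intro continuous_intros continuous_on_subset[OF h_cont]) auto
    ultimately have "bounded ((\<lambda>x. complex_of_real (\<langle>x\<rangle> ^ N) * h x) ` cball 0 R)"
      by (intro compact_imp_bounded compact_continuous_image)
    then obtain C where "\<forall>z\<in>(\<lambda>x. complex_of_real (\<langle>x\<rangle> ^ N) * h x) ` cball 0 R. norm z \<le> C"
      unfolding bounded_iff by blast
    then have C: "\<And>x. x \<in> cball 0 R \<Longrightarrow> norm (complex_of_real (\<langle>x\<rangle> ^ N) * h x) \<le> C" by blast
    have "\<langle>x\<rangle> ^ N * norm (h x) \<le> max C 0" for x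
    proof (cases "norm x > R")
      case True then show ?thesis by (simp add: h_def H(2))
    next
      case False
      then show ?thesis using C[of x] japanese_nonneg[of x] by (simp add: norm_mult norm_power)
    qed
    then show "\<exists>C. \<forall>x. \<langle>x\<rangle> ^ N * norm (h x) \<le> C" by blast
  qed
  \<comment> \<open>Two factors (2\<pi>)^(n/2) are cancelled: one from transforming back, one from
    the unnormalised Gaussian in \<open>gauss_avg\<close>.\<close>
  define c where "c = inverse (complex_of_real (sqrt (2 * pi) ^ CARD('n) * sqrt (2 * pi) ^ CARD('n)))"
  define s where "s m = 1 / real (Suc m)" for m
  have s: "0 < s m" "s m \<le> 1" for m by (auto simp: s_def)
  define g where "g m \<xi> = c * (ifourier h (- \<xi>) * gaussian (s m) \<xi>)" for m \<xi>
  have g_S: "schwartz (g m)" for m unfolding g_def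
    by (intro schwartz_cmult ifourier_mollified(1) h_meas h_rapid s)
  define c' where "c' = inverse (complex_of_real (sqrt (2 * pi) ^ CARD('n)))"
  have Pg: "ifourier (g m) x = c' * gauss_avg (s m) h x" for m x
    unfolding g_def ifourier_cmult ifourier_mollified(2)[OF h_meas h_rapid s(1)] c_def c'_def
    by simp
  have [measurable]: "ifourier (g m) \<in> borel_measurable borel" for m
    by (intro schwartz_measurable schwartz_ifourier g_S)
  have lim: "(\<lambda>m. ifourier (g m) x) \<longlonglongrightarrow> h x" for x
  proof -
    have "(\<lambda>m. c' * gauss_avg (s m) h x) \<longlonglongrightarrow> c' * (sqrt (2 * pi) ^ CARD('n) * h x)"
      unfolding s_def by (intro tendsto_mult_left gauss_avg_tendsto h_cont bdd_fun_rapid_fun h_rapid)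
    moreover have "c' * (sqrt (2 * pi) ^ CARD('n) * h x) = h x" by (simp add: c'_def)
    ultimately show ?thesis unfolding Pg by (simp only:)
  qed
  \<comment> \<open>After squaring, the surplus n beyond the weight k leaves the integrable function
    \<langle>x\<rangle>^(-2n) as majorant.\<close>
  let ?N = "k + CARD('n)"
  obtain C where C: "\<And>s x. 0 < s \<Longrightarrow> s \<le> 1 \<Longrightarrow> \<langle>x\<rangle> ^ ?N * norm (gauss_avg s h x) \<le> C"
    using gauss_avg_rapid[OF h_meas h_rapid, of ?N] by blast
  obtain D where D: "\<And>x. \<langle>x\<rangle> ^ ?N * norm (h x) \<le> D" using h_rapid unfolding rapid_fun_def by blast
  define B where "B = D + norm c' * C"
  have diff: "\<langle>x\<rangle> ^ ?N * norm (h x - ifourier (g m) x) \<le> B" for m x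
  proof -
    have "\<langle>x\<rangle> ^ ?N * norm (h x - ifourier (g m) x) \<le> \<langle>x\<rangle> ^ ?N * (norm (h x) + norm (ifourier (g m) x))"
      by (intro mult_left_mono norm_triangle_ineq4 zero_le_power japanese_nonneg)
    also have "\<dots> = \<langle>x\<rangle> ^ ?N * norm (h x) + norm c' * (\<langle>x\<rangle> ^ ?N * norm (gauss_avg (s m) h x))"
      unfolding Pg norm_mult by (simp add: distrib_left mult_ac)
    also have "\<dots> \<le> B" unfolding B_def using D C[OF s] by (intro add_mono mult_left_mono) auto
    finally show ?thesis .
  qed
  have "(\<lambda>m. sqn (\<lambda>x. complex_of_real (\<langle>x\<rangle> ^ k) * (h x - ifourier (g m) x))) \<longlonglongrightarrow> 0"
  proof (rule sqn_tendsto_0[where w = "\<lambda>x. B\<^sup>2 * inverse (\<langle>x\<rangle> ^ (2 * CARD('n)))"])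
    show "AE x in lborel. (\<lambda>m. complex_of_real (\<langle>x\<rangle> ^ k) * (h x - ifourier (g m) x)) \<longlonglongrightarrow> 0"
    proof (rule AE_I2)
      fix x
      have "(\<lambda>m. complex_of_real (\<langle>x\<rangle> ^ k) * (h x - ifourier (g m) x)) \<longlonglongrightarrow> complex_of_real (\<langle>x\<rangle> ^ k) * (h x - h x)"
        by (intro tendsto_intros lim)
      then show "(\<lambda>m. complex_of_real (\<langle>x\<rangle> ^ k) * (h x - ifourier (g m) x)) \<longlonglongrightarrow> 0" by simp
    qed
    show "(norm (complex_of_real (\<langle>x\<rangle> ^ k) * (h x - ifourier (g m) x)))\<^sup>2 \<le> B\<^sup>2 * inverse (\<langle>x\<rangle> ^ (2 * CARD('n)))" for m x
    proof -
      have "(\<langle>x\<rangle> ^ ?N * norm (h x - ifourier (g m) x))\<^sup>2 \<le> B\<^sup>2"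
        using diff japanese_nonneg[of x] by (intro power_mono) auto
      then have "(\<langle>x\<rangle> ^ k * norm (h x - ifourier (g m) x))\<^sup>2 * \<langle>x\<rangle> ^ (2 * CARD('n)) \<le> B\<^sup>2"
        by (simp add: power_mult_distrib power_add power_mult mult_ac power2_eq_square)
      then have "(\<langle>x\<rangle> ^ k * norm (h x - ifourier (g m) x))\<^sup>2 \<le> B\<^sup>2 / \<langle>x\<rangle> ^ (2 * CARD('n))"
        by (simp only: pos_le_divide_eq zero_less_power japanese_pos)
      then show ?thesis
        unfolding norm_mult norm_of_real abs_of_nonneg[OF zero_le_power[OF japanese_nonneg]] divide_inverse .
    qed
    show "(\<integral>\<^sup>+x. ennreal (B\<^sup>2 * inverse (\<langle>x::real^'n\<rangle> ^ (2 * CARD('n)))) \<partial>lborel) < \<infinity>"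
    proof -
      have "integrable lborel (\<lambda>x::real^'n. B\<^sup>2 * inverse (\<langle>x\<rangle> ^ (2 * CARD('n))))"
        by (intro integrable_mult_right integrable_japanese)
      then show ?thesis by (subst nn_integral_eq_integral) (auto simp: japanese_nonneg)
    qed
  qed measurable
  then have "\<forall>\<^sub>F m in sequentially. sqn (\<lambda>x. complex_of_real (\<langle>x\<rangle> ^ k) * (h x - ifourier (g m) x)) < d"
    using d(1) by (rule order_tendstoD)
  then obtain m where m: "sqn (\<lambda>x. complex_of_real (\<langle>x\<rangle> ^ k) * (h x - ifourier (g m) x)) < d"
    by (auto simp: eventually_sequentially)
  have "sqn (\<lambda>x. complex_of_real (\<langle>x\<rangle> ^ k) * (f x - ifourier (g m) x)) =
      sqn (\<lambda>x. (complex_of_real (\<langle>x\<rangle> ^ k) * f x - H x) + complex_of_real (\<langle>x\<rangle> ^ k) * (h x - ifourier (g m) x))"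
    unfolding hH[symmetric] by (simp add: algebra_simps)
  also have "\<dots> \<le> 2 * sqn (\<lambda>x. complex_of_real (\<langle>x\<rangle> ^ k) * f x - H x) + 2 * sqn (\<lambda>x. complex_of_real (\<langle>x\<rangle> ^ k) * (h x - ifourier (g m) x))"
    by (rule sqn_add_le) measurable
  also have "\<dots> < 2 * d + 2 * d"
  proof -
    have "2 * sqn (\<lambda>x. complex_of_real (\<langle>x\<rangle> ^ k) * f x - H x) < 2 * d"
      "2 * sqn (\<lambda>x. complex_of_real (\<langle>x\<rangle> ^ k) * (h x - ifourier (g m) x)) < 2 * d"
      using m H(3) by (auto intro!: ennreal_mult_strict_left_mono)
    then show ?thesis by (rule add_strict_mono)
  qed
  finally show ?thesis using g_S d(2) by (meson order.strict_trans2)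
qed

subsection \<open>Uniqueness for the Cauchy problem\<close>

lemma has_vector_derivative_iff_tendsto:
  fixes f :: "real \<Rightarrow> 'b::real_normed_vector"
  shows "(f has_vector_derivative d) (at t) \<longleftrightarrow> ((\<lambda>\<tau>. (f \<tau> - f t) /\<^sub>R (\<tau> - t)) \<longlongrightarrow> d) (at t)"
proof -
  have "norm ((f \<tau> - f t) - (\<tau> - t) *\<^sub>R d) / norm (\<tau> - t) = norm ((f \<tau> - f t) /\<^sub>R (\<tau> - t) - d)" if "\<tau> \<noteq> t" for \<tau>
  proof -
    have "(f \<tau> - f t) /\<^sub>R (\<tau> - t) - d = inverse (\<tau> - t) *\<^sub>R ((f \<tau> - f t) - (\<tau> - t) *\<^sub>R d)"
      using that by (simp add: scaleR_diff_right)
    then show ?thesis by (simp add: divide_inverse mult.commute)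
  qed
  then have "((\<lambda>\<tau>. norm ((f \<tau> - f t) - (\<tau> - t) *\<^sub>R d) / norm (\<tau> - t)) \<longlongrightarrow> 0) (at t) \<longleftrightarrow>
    ((\<lambda>\<tau>. norm ((f \<tau> - f t) /\<^sub>R (\<tau> - t) - d)) \<longlongrightarrow> 0) (at t)"
    by (intro filterlim_cong refl) (auto simp: eventually_at_filter)
  then show ?thesis
    unfolding has_vector_derivative_def has_derivative_iff_norm tendsto_norm_zero_iff Lim_null[of _ d]
    by (simp add: bounded_linear_scaleR_left)
qed

section \<open>Norms and pairings in L2\<close>

lemma in_L2_sqn:
  "in_L2 lborel f \<longleftrightarrow> f \<in> borel_measurable borel \<and> sqn f < \<infinity>"
  unfolding in_L2_def sqn_def by (auto simp: integrable_iff_bounded)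

lemma L2_norm_nonneg: "L2_norm M f \<ge> 0"
  unfolding L2_norm_def by simp

lemma L2_norm_sq: "in_L2 lborel f \<Longrightarrow> ennreal ((L2_norm lborel f)\<^sup>2) = sqn f"
  unfolding in_L2_def sqn_def L2_norm_def by (subst nn_integral_eq_integral) auto

lemma in_L2_schwartz: "schwartz g \<Longrightarrow> in_L2 lborel g"
  unfolding in_L2_def using schwartz_square_integrable schwartz_measurable by auto

lemma in_L2_add:
  assumes "in_L2 lborel f" "in_L2 lborel g"
  shows "in_L2 lborel (\<lambda>x. f x + g x)"
proof -
  have [measurable]: "f \<in> borel_measurable borel" "g \<in> borel_measurable borel" using assms by (auto simp: in_L2_def)
  have "sqn (\<lambda>x. f x + g x) \<le> 2 * sqn f + 2 * sqn g" by (rule sqn_add_le) measurable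
  also have "\<dots> < \<infinity>" using assms by (auto simp: in_L2_sqn ennreal_mult_less_top)
  finally show ?thesis by (simp add: in_L2_sqn)
qed

lemma in_L2_cmult: "in_L2 lborel f \<Longrightarrow> in_L2 lborel (\<lambda>x. c * f x)"
  unfolding in_L2_def by (auto simp: norm_mult power_mult_distrib)

lemma in_L2_diff: "in_L2 lborel f \<Longrightarrow> in_L2 lborel g \<Longrightarrow> in_L2 lborel (\<lambda>x. f x - g x)"
  using in_L2_add[of f "\<lambda>x. (-1) * g x"] in_L2_cmult[of g "-1"] by simp

lemma integrable_L2_pairing:
  assumes "in_L2 lborel f" "in_L2 lborel g"
  shows "integrable lborel (\<lambda>x. f x * cnj (g x))"
proof (rule Bochner_Integration.integrable_bound[where f = "\<lambda>x. (norm (f x))\<^sup>2 + (norm (g x))\<^sup>2"])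
  show "integrable lborel (\<lambda>x. (norm (f x))\<^sup>2 + (norm (g x))\<^sup>2)"
    using assms by (intro Bochner_Integration.integrable_add) (auto simp: in_L2_def)
  show "(\<lambda>x. f x * cnj (g x)) \<in> borel_measurable lborel"
    using assms by (auto simp: in_L2_def intro!: borel_measurable_times borel_measurable_cnj)
  show "AE x in lborel. norm (f x * cnj (g x)) \<le> norm ((norm (f x))\<^sup>2 + (norm (g x))\<^sup>2)"
  proof (rule AE_I2)
    fix x
    have "2 * (norm (f x) * norm (g x)) \<le> (norm (f x))\<^sup>2 + (norm (g x))\<^sup>2"
      using sum_squares_bound[of "norm (f x)" "norm (g x)"] by simp
    moreover have "0 \<le> norm (f x) * norm (g x)" by simp
    ultimately show "norm (f x * cnj (g x)) \<le> norm ((norm (f x))\<^sup>2 + (norm (g x))\<^sup>2)"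
      unfolding norm_mult complex_mod_cnj real_norm_def by linarith
  qed
qed

lemma L2_pairing_Cauchy_Schwarz:
  assumes f: "in_L2 lborel f" and g: "in_L2 lborel g"
  shows "norm (L2_pairing f g) \<le> L2_norm lborel f * L2_norm lborel g"
proof -
  have [measurable]: "f \<in> borel_measurable borel" "g \<in> borel_measurable borel" using assms by (auto simp: in_L2_def)
  have "ennreal (norm (L2_pairing f g)) \<le> (\<integral>\<^sup>+x. ennreal (norm (f x * cnj (g x))) \<partial>lborel)"
    unfolding L2_pairing_def by (rule integral_norm_bound_ennreal[OF integrable_L2_pairing[OF f g]])
  also have "\<dots> = (\<integral>\<^sup>+x. ennreal (norm (f x)) * ennreal (norm (g x)) \<partial>lborel)"
    by (simp add: norm_mult ennreal_mult)
  finally have "(ennreal (norm (L2_pairing f g)))\<^sup>2 \<le> (\<integral>\<^sup>+x. ennreal (norm (f x)) * ennreal (norm (g x)) \<partial>lborel)\<^sup>2"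
    by (rule power_mono) simp
  also have "\<dots> \<le> (\<integral>\<^sup>+x. (ennreal (norm (f x)))\<^sup>2 \<partial>lborel) * (\<integral>\<^sup>+x. (ennreal (norm (g x)))\<^sup>2 \<partial>lborel)"
    by (rule Cauchy_Schwarz_nn_integral) measurable
  also have "\<dots> = sqn f * sqn g" unfolding sqn_def by (simp add: ennreal_power)
  also have "\<dots> = ennreal ((L2_norm lborel f * L2_norm lborel g)\<^sup>2)"
    by (simp add: L2_norm_sq[symmetric] f g power_mult_distrib ennreal_mult)
  finally have "(norm (L2_pairing f g))\<^sup>2 \<le> (L2_norm lborel f * L2_norm lborel g)\<^sup>2"
    by (simp add: ennreal_power ennreal_le_iff)
  then show ?thesis by (rule power2_le_imp_le) (simp add: L2_norm_nonneg)
qed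

lemma L2_norm_add_le:
  assumes f: "in_L2 lborel f" and g: "in_L2 lborel g"
  shows "L2_norm lborel (\<lambda>x. f x + g x) \<le> 2 * (L2_norm lborel f + L2_norm lborel g)"
proof (rule power2_le_imp_le)
  have [measurable]: "f \<in> borel_measurable borel" "g \<in> borel_measurable borel" using assms by (auto simp: in_L2_def)
  let ?a = "L2_norm lborel f" and ?b = "L2_norm lborel g"
  have "ennreal ((L2_norm lborel (\<lambda>x. f x + g x))\<^sup>2) \<le> 2 * sqn f + 2 * sqn g"
    unfolding L2_norm_sq[OF in_L2_add[OF f g]] by (rule sqn_add_le) measurable
  also have "\<dots> = ennreal (2 * ?a\<^sup>2 + 2 * ?b\<^sup>2)"
    by (simp add: L2_norm_sq[symmetric] f g ennreal_mult)
  finally have "(L2_norm lborel (\<lambda>x. f x + g x))\<^sup>2 \<le> 2 * ?a\<^sup>2 + 2 * ?b\<^sup>2"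
    by (rule ennreal_le_iff[THEN iffD1, rotated]) simp
  moreover have "0 \<le> ?a * ?b" by (simp add: L2_norm_nonneg)
  ultimately show "(L2_norm lborel (\<lambda>x. f x + g x))\<^sup>2 \<le> (2 * (?a + ?b))\<^sup>2"
  proof -
    have "(2 * (?a + ?b))\<^sup>2 = 4 * ?a\<^sup>2 + 4 * ?b\<^sup>2 + 8 * (?a * ?b)"
      by (simp add: power2_eq_square algebra_simps)
    then show ?thesis if "(L2_norm lborel (\<lambda>x. f x + g x))\<^sup>2 \<le> 2 * ?a\<^sup>2 + 2 * ?b\<^sup>2" "0 \<le> ?a * ?b"
      using that zero_le_power2[of ?a] zero_le_power2[of ?b] by linarith
  qed
qed (simp add: L2_norm_nonneg)

lemma L2_pairing_diff_left:
  "in_L2 lborel f \<Longrightarrow> in_L2 lborel g \<Longrightarrow> in_L2 lborel h \<Longrightarrow>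
    L2_pairing (\<lambda>x. f x - g x) h = L2_pairing f h - L2_pairing g h"
  unfolding L2_pairing_def by (simp add: left_diff_distrib integrable_L2_pairing)

lemma L2_pairing_add_right:
  "in_L2 lborel f \<Longrightarrow> in_L2 lborel g \<Longrightarrow> in_L2 lborel h \<Longrightarrow>
    L2_pairing f (\<lambda>x. g x + h x) = L2_pairing f g + L2_pairing f h"
  unfolding L2_pairing_def by (simp add: distrib_left integrable_L2_pairing)

lemma L2_pairing_cmult_right: "L2_pairing f (\<lambda>x. c * g x) = cnj c * L2_pairing f g"
proof -
  have "L2_pairing f (\<lambda>x. c * g x) = (LINT x|lborel. cnj c * (f x * cnj (g x)))"
    unfolding L2_pairing_def by (intro Bochner_Integration.integral_cong) (auto simp: mult_ac)
  then show ?thesis unfolding L2_pairing_def by simp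
qed

lemma L2_norm_ifourier_le:
  fixes g :: "real^'n \<Rightarrow> complex"
  assumes g: "schwartz g"
  shows "L2_norm lborel (ifourier g) \<le> sqrt ((2 * pi) ^ CARD('n)) * L2_norm lborel g"
proof (rule power2_le_imp_le)
  have "ennreal ((L2_norm lborel (ifourier g))\<^sup>2) \<le> ennreal ((2 * pi) ^ CARD('n) * (LINT \<xi>|lborel. (norm (g \<xi>))\<^sup>2))"
    unfolding L2_norm_sq[OF in_L2_schwartz[OF schwartz_ifourier[OF g]]]
    by (intro sqn_ifourier_le schwartz_integrable schwartz_square_integrable g)
  then have "(L2_norm lborel (ifourier g))\<^sup>2 \<le> (2 * pi) ^ CARD('n) * (LINT \<xi>|lborel. (norm (g \<xi>))\<^sup>2)"
    by (simp add: ennreal_le_iff)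
  also have "\<dots> = (sqrt ((2 * pi) ^ CARD('n)) * L2_norm lborel g)\<^sup>2"
    unfolding power_mult_distrib L2_norm_def by (simp add: real_sqrt_pow2)
  finally show "(L2_norm lborel (ifourier g))\<^sup>2 \<le> (sqrt ((2 * pi) ^ CARD('n)) * L2_norm lborel g)\<^sup>2" .
qed (simp add: L2_norm_nonneg)

text \<open>Fubini moves the transform from h onto \<open>ifourier g\<close>, where Fourier
  inversion applies.\<close>

lemma Plancherel:
  fixes g h :: "real^'n \<Rightarrow> complex"
  assumes g: "schwartz g" and h: "schwartz h"
  shows "L2_pairing (ifourier g) (ifourier h) = (2 * pi) ^ CARD('n) * L2_pairing g h"
proof -
  have G: "integrable lborel (ifourier g)" by (intro schwartz_integrable schwartz_ifourier g)
  have H: "integrable lborel (\<lambda>x. cnj (h x))" by (intro integrable_cnj schwartz_integrable h)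
  note [measurable] = schwartz_measurable[OF schwartz_ifourier[OF g]] schwartz_measurable[OF h]
  have int: "integrable (lborel \<Otimes>\<^sub>M lborel) (\<lambda>(x, \<xi>). cis (- (x \<bullet> \<xi>)) * ifourier g x * cnj (h \<xi>))"
    by (rule Bochner_Integration.integrable_bound[OF integrable_tensor[OF G H]])
       (auto simp: norm_mult split: prod.splits)
  have "L2_pairing (ifourier g) (ifourier h) = (LINT x|lborel. (LINT \<xi>|lborel. cis (- (x \<bullet> \<xi>)) * ifourier g x * cnj (h \<xi>)))"
    unfolding L2_pairing_def
  proof (rule Bochner_Integration.integral_cong[OF refl])
    fix x
    have "cnj (ifourier h x) = (LINT \<xi>|lborel. cis (- (x \<bullet> \<xi>)) * cnj (h \<xi>))"
      unfolding ifourier_def by (simp add: cis_cnj flip: Bochner_Integration.integral_cnj)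
    then have "ifourier g x * cnj (ifourier h x) = (LINT \<xi>|lborel. ifourier g x * (cis (- (x \<bullet> \<xi>)) * cnj (h \<xi>)))"
      by simp
    then show "ifourier g x * cnj (ifourier h x) = (LINT \<xi>|lborel. cis (- (x \<bullet> \<xi>)) * ifourier g x * cnj (h \<xi>))"
      by (simp only: mult_ac)
  qed
  also have "\<dots> = (LINT \<xi>|lborel. (LINT x|lborel. cis (- (x \<bullet> \<xi>)) * ifourier g x * cnj (h \<xi>)))"
    by (rule lborel_pair.Fubini_integral[OF int, symmetric])
  also have "\<dots> = (LINT \<xi>|lborel. (2 * pi) ^ CARD('n) * (g \<xi> * cnj (h \<xi>)))"
  proof (rule Bochner_Integration.integral_cong[OF refl])
    fix \<xi>
    have "(LINT x|lborel. cis (- (x \<bullet> \<xi>)) * ifourier g x * cnj (h \<xi>)) = fourier (ifourier g) \<xi> * cnj (h \<xi>)"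
      unfolding fourier_def by (rule integral_mult_left_zero)
    then show "(LINT x|lborel. cis (- (x \<bullet> \<xi>)) * ifourier g x * cnj (h \<xi>)) = (2 * pi) ^ CARD('n) * (g \<xi> * cnj (h \<xi>))"
      unfolding fourier_inversion[OF g] by (simp only: mult.assoc)
  qed
  finally show ?thesis unfolding L2_pairing_def by simp
qed

lemma L2_pairing_self: "in_L2 lborel f \<Longrightarrow> L2_pairing f f = complex_of_real ((L2_norm lborel f)\<^sup>2)"
  unfolding L2_pairing_def L2_norm_def
  by (simp add: complex_norm_square[symmetric] flip: of_real_power)

lemma L2_norm_ifourier:
  fixes g :: "real^'n \<Rightarrow> complex"
  assumes g: "schwartz g"
  shows "(L2_norm lborel (ifourier g))\<^sup>2 = (2 * pi) ^ CARD('n) * (L2_norm lborel g)\<^sup>2"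
proof -
  have "complex_of_real ((L2_norm lborel (ifourier g))\<^sup>2) = complex_of_real ((2 * pi) ^ CARD('n) * (L2_norm lborel g)\<^sup>2)"
    using Plancherel[OF g g] by (simp add: L2_pairing_self in_L2_schwartz g schwartz_ifourier)
  then show ?thesis by (simp only: of_real_eq_iff)
qed

text \<open>The propagator exp(-ita) on the frequency side; \<open>ifourier (evol a t g)\<close> is
  the solution with datum \<open>ifourier g\<close>.\<close>

definition evol :: "(real^'n \<Rightarrow> real) \<Rightarrow> real \<Rightarrow> (real^'n \<Rightarrow> complex) \<Rightarrow> real^'n \<Rightarrow> complex"
  where "evol a t g = (\<lambda>\<xi>. cis (- t * a \<xi>) * g \<xi>)"

lemma schwartz_evol: "smooth_with poly_fun a \<Longrightarrow> schwartz g \<Longrightarrow> schwartz (evol a t g)"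
  unfolding evol_def by (intro schwartz_slow_mult slow_cis)

lemma norm_evol: "norm (evol a t g \<xi>) = norm (g \<xi>)"
  unfolding evol_def by (simp add: norm_mult)

lemma evol_evol: "evol a t (evol a (- t) g) = g"
  unfolding evol_def by (simp add: cis_mult flip: mult.assoc)

lemma evol_0: "evol a 0 g = g" unfolding evol_def by simp

lemma L2_norm_evol: "L2_norm lborel (evol a t g) = L2_norm lborel g"
  unfolding L2_norm_def norm_evol ..

lemma fourier_multiplier_ifourier:
  fixes g :: "real^'n \<Rightarrow> complex"
  assumes "schwartz g"
  shows "fourier_multiplier a (ifourier g) = ifourier (\<lambda>\<xi>. complex_of_real (a \<xi>) * g \<xi>)"
proof
  fix x
  have "(\<lambda>\<xi>. cis (x \<bullet> \<xi>) * complex_of_real (a \<xi>) * fourier (ifourier g) \<xi>) =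
    (\<lambda>\<xi>. complex_of_real ((2 * pi) ^ CARD('n)) * (cis (x \<bullet> \<xi>) * (complex_of_real (a \<xi>) * g \<xi>)))"
    unfolding fourier_inversion[OF assms] by (simp add: mult_ac)
  then show "fourier_multiplier a (ifourier g) x = ifourier (\<lambda>\<xi>. complex_of_real (a \<xi>) * g \<xi>) x"
    unfolding fourier_multiplier_def ifourier_def by simp
qed

text \<open>The pairing of \<open>u(t)\<close> with the solution of the same equation with Schwartz data is constant in
  time, since \<open>a(D)\<close> is symmetric.\<close>

lemma solution_duality:
  fixes a :: "real^'n \<Rightarrow> real"
  assumes a: "smooth_with poly_fun a" and u: "cauchy_solution a u0 u" and h: "schwartz h"
  shows "L2_pairing (u t) (ifourier (evol a t h)) = L2_pairing (u 0) (ifourier h)"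
proof -
  define F where "F t = L2_pairing (u t) (ifourier (evol a t h))" for t
  have uL2: "in_L2 lborel (u t)" for t using u unfolding cauchy_solution_def by blast
  have ucont: "((\<lambda>\<tau>. L2_norm lborel (\<lambda>x. u \<tau> x - u t x)) \<longlongrightarrow> 0) (at t)" for t
    using u unfolding cauchy_solution_def by blast
  have ueq: "\<exists>d. ((\<lambda>\<tau>. L2_pairing (u \<tau>) \<phi>) has_vector_derivative d) (at t) \<and>
           \<i> * d - fourier_multiplier_distr a (u t) \<phi> = 0" if "schwartz \<phi>" for \<phi> t
    using u that unfolding cauchy_solution_def by blast
  have deriv: "(F has_vector_derivative 0) (at t)" for t
  proof -
    define \<phi> where "\<phi> = ifourier (evol a t h)"
    define q where "q = (\<lambda>\<xi>. complex_of_real (a \<xi>) * evol a t h \<xi>)"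
    have S: "schwartz (evol a \<tau> h)" for \<tau> by (rule schwartz_evol[OF a h])
    have q: "schwartz q" unfolding q_def by (intro schwartz_slow_mult slow_of_real a S)
    have \<phi>: "schwartz \<phi>" unfolding \<phi>_def by (intro schwartz_ifourier S)
    \<comment> \<open>\<psi> is the time derivative at t of the moving test function
      \<open>ifourier (evol a \<tau> h)\<close>.\<close>
    define \<psi> where "\<psi> = ifourier (\<lambda>\<xi>. - \<i> * q \<xi>)"
    have nq: "schwartz (\<lambda>\<xi>. - \<i> * q \<xi>)" by (intro schwartz_cmult q)
    have \<psi>: "schwartz \<psi>" unfolding \<psi>_def by (intro schwartz_ifourier nq)
    obtain d where d: "((\<lambda>\<tau>. L2_pairing (u \<tau>) \<phi>) has_vector_derivative d) (at t)"
        "\<i> * d - fourier_multiplier_distr a (u t) \<phi> = 0"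
      using ueq[OF \<phi>] by blast
    have \<psi>_eq: "\<psi> = (\<lambda>x. - \<i> * ifourier q x)" unfolding \<psi>_def by (rule ext) (rule ifourier_cmult)
    have "fourier_multiplier_distr a (u t) \<phi> = L2_pairing (u t) (ifourier q)"
      unfolding fourier_multiplier_distr_def \<phi>_def fourier_multiplier_ifourier[OF S] q_def ..
    then have "L2_pairing (u t) \<psi> = \<i> * (\<i> * d)"
      unfolding \<psi>_eq L2_pairing_cmult_right using d(2) by simp
    \<comment> \<open>The two terms of the product rule cancel: the pairing is conjugate linear on
      the right, so the factor -i of \<psi> comes out as i, and the equation identifies the pairing
      of u(t) with a(D)\<phi> as i d.\<close>
    then have d\<psi>: "L2_pairing (u t) \<psi> + d = 0" by (simp flip: mult.assoc)
    \<comment> \<open>\<rho> is the second-order Taylor remainder of the propagator, pointwise at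
      most (\<tau> - t)^2 |a^2 h|. Since a is slow, a^2 h is again a Schwartz function, so this is a
      bound in L2.\<close>
    define \<rho> where "\<rho> \<tau> = (\<lambda>\<xi>. (evol a \<tau> h \<xi> + (-1) * evol a t h \<xi>) + complex_of_real (- (\<tau> - t)) * (- \<i> * q \<xi>))" for \<tau>
    have \<rho>: "schwartz (\<rho> \<tau>)" for \<tau> unfolding \<rho>_def by (intro schwartz_add schwartz_cmult S nq)
    define r where "r = (\<lambda>\<xi>. complex_of_real (a \<xi>) * (complex_of_real (a \<xi>) * h \<xi>))"
    have r: "schwartz r" unfolding r_def by (intro schwartz_slow_mult slow_of_real a h)
    have \<rho>_bd: "norm (\<rho> \<tau> \<xi>) \<le> (\<tau> - t)\<^sup>2 * norm (r \<xi>)" for \<tau> \<xi>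
    proof -
      have "evol a \<tau> h \<xi> = cis (- (\<tau> - t) * a \<xi>) * evol a t h \<xi>"
        unfolding evol_def mult.assoc[symmetric] cis_mult by (simp add: algebra_simps)
      then have "\<rho> \<tau> \<xi> = (cis (- (\<tau> - t) * a \<xi>) - 1 - \<i> * complex_of_real (- (\<tau> - t) * a \<xi>)) * evol a t h \<xi>"
        unfolding \<rho>_def q_def by (simp add: algebra_simps)
      then have "norm (\<rho> \<tau> \<xi>) = norm (cis (- (\<tau> - t) * a \<xi>) - 1 - \<i> * complex_of_real (- (\<tau> - t) * a \<xi>)) * norm (h \<xi>)"
        by (simp only: norm_mult norm_evol)
      also have "\<dots> \<le> (- (\<tau> - t) * a \<xi>)\<^sup>2 / 2 * norm (h \<xi>)"
        by (rule mult_right_mono[OF cis_taylor]) simp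
      also have "\<dots> = 1 / 2 * ((\<tau> - t)\<^sup>2 * norm (r \<xi>))"
      proof -
        have "norm (r \<xi>) = (a \<xi>)\<^sup>2 * norm (h \<xi>)"
          unfolding r_def norm_mult norm_of_real by (simp add: power2_eq_square flip: mult.assoc abs_mult)
        then show ?thesis unfolding power_mult_distrib power2_minus by simp
      qed
      also have "\<dots> \<le> (\<tau> - t)\<^sup>2 * norm (r \<xi>)" by simp
      finally show ?thesis by simp
    qed
    define K where "K = sqrt ((2 * pi) ^ CARD('n)) * L2_norm lborel r"
    have K: "L2_norm lborel (ifourier (\<rho> \<tau>)) \<le> (\<tau> - t)\<^sup>2 * K" for \<tau>
    proof -
      have "L2_norm lborel (\<rho> \<tau>) \<le> sqrt (LINT \<xi>|lborel. ((\<tau> - t)\<^sup>2)\<^sup>2 * (norm (r \<xi>))\<^sup>2)"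
        unfolding L2_norm_def
        by (intro real_sqrt_le_mono integral_mono integrable_mult_right schwartz_square_integrable \<rho> r)
           (unfold power_mult_distrib[symmetric], intro power_mono \<rho>_bd norm_ge_zero)
      also have "\<dots> = (\<tau> - t)\<^sup>2 * L2_norm lborel r" by (simp only: L2_norm_def integral_mult_right_zero real_sqrt_mult real_sqrt_abs abs_power2)
      finally have "sqrt ((2 * pi) ^ CARD('n)) * L2_norm lborel (\<rho> \<tau>) \<le> sqrt ((2 * pi) ^ CARD('n)) * ((\<tau> - t)\<^sup>2 * L2_norm lborel r)"
        by (rule mult_left_mono) simp
      from order.trans[OF L2_norm_ifourier_le[OF \<rho>] this] show ?thesis
        unfolding K_def by (simp only: mult.left_commute)
    qed
    \<comment> \<open>The product rule with both entries moving. In the mixed term the increment of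
      u is paired with \<psi>, so continuity of u in L2 suffices; u is differentiable in time only
      after pairing with a fixed test function.\<close>
    have split: "F \<tau> - F t = L2_pairing (u \<tau>) (ifourier (\<rho> \<tau>)) + complex_of_real (\<tau> - t) * L2_pairing (\<lambda>x. u \<tau> x - u t x) \<psi>
        + complex_of_real (\<tau> - t) * L2_pairing (u t) \<psi> + (L2_pairing (u \<tau>) \<phi> - L2_pairing (u t) \<phi>)" for \<tau>
    proof -
      have "ifourier (evol a \<tau> h) x = ifourier (\<rho> \<tau>) x + (\<phi> x + complex_of_real (\<tau> - t) * \<psi> x)" for x
      proof -
        have "ifourier (\<rho> \<tau>) x = (ifourier (evol a \<tau> h) x + (-1) * \<phi> x) + complex_of_real (- (\<tau> - t)) * \<psi> x"
          unfolding \<rho>_def \<phi>_def \<psi>_def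
          by (subst ifourier_add, (intro schwartz_integrable schwartz_add schwartz_cmult S nq)+,
              subst ifourier_add, (intro schwartz_integrable schwartz_add schwartz_cmult S nq)+)
             (simp only: ifourier_cmult)
        then show ?thesis by (simp add: algebra_simps)
      qed
      then have "ifourier (evol a \<tau> h) = (\<lambda>x. ifourier (\<rho> \<tau>) x + (\<phi> x + complex_of_real (\<tau> - t) * \<psi> x))"
        by (rule ext)
      then have "F \<tau> = L2_pairing (u \<tau>) (\<lambda>x. ifourier (\<rho> \<tau>) x + (\<phi> x + complex_of_real (\<tau> - t) * \<psi> x))"
        unfolding F_def by (simp only:)
      also have "\<dots> = L2_pairing (u \<tau>) (ifourier (\<rho> \<tau>)) + (L2_pairing (u \<tau>) \<phi> + complex_of_real (\<tau> - t) * L2_pairing (u \<tau>) \<psi>)"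
        by (subst L2_pairing_add_right, (intro uL2 in_L2_add in_L2_cmult in_L2_schwartz schwartz_ifourier \<rho> \<phi> \<psi>)+,
            subst L2_pairing_add_right, (intro uL2 in_L2_add in_L2_cmult in_L2_schwartz schwartz_ifourier \<rho> \<phi> \<psi>)+)
           (simp add: L2_pairing_cmult_right)
      finally show ?thesis
        unfolding F_def \<phi>_def[symmetric]
        by (simp add: L2_pairing_diff_left uL2 in_L2_schwartz \<psi> algebra_simps)
    qed
    \<comment> \<open>Continuity in L2 keeps the norm of u(\<tau>) bounded near t, against a
      remainder of order (\<tau> - t)^2.\<close>
    have lim1: "((\<lambda>\<tau>. L2_pairing (u \<tau>) (ifourier (\<rho> \<tau>)) / complex_of_real (\<tau> - t)) \<longlongrightarrow> 0) (at t)"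
    proof (rule Lim_null_comparison)
      have K0: "K \<ge> 0" unfolding K_def by (simp add: L2_norm_nonneg)
      show "\<forall>\<^sub>F \<tau> in at t. norm (L2_pairing (u \<tau>) (ifourier (\<rho> \<tau>)) / complex_of_real (\<tau> - t))
          \<le> 2 * (L2_norm lborel (\<lambda>x. u \<tau> x - u t x) + L2_norm lborel (u t)) * (\<bar>\<tau> - t\<bar> * K)"
        unfolding eventually_at_filter
      proof (rule always_eventually, intro allI impI)
        fix \<tau> assume \<tau>: "\<tau> \<noteq> t"
        have "L2_norm lborel (u \<tau>) = L2_norm lborel (\<lambda>x. (u \<tau> x - u t x) + u t x)" by simp
        also have "\<dots> \<le> 2 * (L2_norm lborel (\<lambda>x. u \<tau> x - u t x) + L2_norm lborel (u t))"
          by (intro L2_norm_add_le in_L2_diff uL2)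
        finally have A: "L2_norm lborel (u \<tau>) \<le> 2 * (L2_norm lborel (\<lambda>x. u \<tau> x - u t x) + L2_norm lborel (u t))" .
        have "norm (L2_pairing (u \<tau>) (ifourier (\<rho> \<tau>))) \<le> L2_norm lborel (u \<tau>) * L2_norm lborel (ifourier (\<rho> \<tau>))"
          by (intro L2_pairing_Cauchy_Schwarz uL2 in_L2_schwartz schwartz_ifourier \<rho>)
        also have "\<dots> \<le> (2 * (L2_norm lborel (\<lambda>x. u \<tau> x - u t x) + L2_norm lborel (u t))) * ((\<tau> - t)\<^sup>2 * K)"
          using A K[of \<tau>] L2_norm_nonneg by (intro mult_mono) (auto intro: add_nonneg_nonneg)
        finally have B: "norm (L2_pairing (u \<tau>) (ifourier (\<rho> \<tau>))) \<le> (2 * (L2_norm lborel (\<lambda>x. u \<tau> x - u t x) + L2_norm lborel (u t))) * (\<bar>\<tau> - t\<bar> * K) * \<bar>\<tau> - t\<bar>"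
          by (simp add: power2_eq_square mult_ac flip: abs_mult)
        have "norm (L2_pairing (u \<tau>) (ifourier (\<rho> \<tau>)) / complex_of_real (\<tau> - t)) = norm (L2_pairing (u \<tau>) (ifourier (\<rho> \<tau>))) / \<bar>\<tau> - t\<bar>"
          by (simp only: norm_divide norm_of_real)
        also have "\<dots> \<le> 2 * (L2_norm lborel (\<lambda>x. u \<tau> x - u t x) + L2_norm lborel (u t)) * (\<bar>\<tau> - t\<bar> * K)"
          using \<tau> B by (simp only: pos_divide_le_eq zero_less_abs_iff right_minus_eq not_False_eq_True)
        finally show "norm (L2_pairing (u \<tau>) (ifourier (\<rho> \<tau>)) / complex_of_real (\<tau> - t))
          \<le> 2 * (L2_norm lborel (\<lambda>x. u \<tau> x - u t x) + L2_norm lborel (u t)) * (\<bar>\<tau> - t\<bar> * K)" .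
      qed
      have "((\<lambda>\<tau>. 2 * (L2_norm lborel (\<lambda>x. u \<tau> x - u t x) + L2_norm lborel (u t)) * (\<bar>\<tau> - t\<bar> * K))
        \<longlongrightarrow> 2 * (0 + L2_norm lborel (u t)) * (\<bar>t - t\<bar> * K)) (at t)"
        by (intro tendsto_intros ucont)
      then show "((\<lambda>\<tau>. 2 * (L2_norm lborel (\<lambda>x. u \<tau> x - u t x) + L2_norm lborel (u t)) * (\<bar>\<tau> - t\<bar> * K)) \<longlongrightarrow> 0) (at t)"
        by simp
    qed
    have lim2: "((\<lambda>\<tau>. L2_pairing (\<lambda>x. u \<tau> x - u t x) \<psi>) \<longlongrightarrow> 0) (at t)"
    proof (rule Lim_null_comparison)
      show "\<forall>\<^sub>F \<tau> in at t. norm (L2_pairing (\<lambda>x. u \<tau> x - u t x) \<psi>) \<le> L2_norm lborel (\<lambda>x. u \<tau> x - u t x) * L2_norm lborel \<psi>"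
        by (intro always_eventually allI L2_pairing_Cauchy_Schwarz in_L2_diff uL2 in_L2_schwartz \<psi>)
      show "((\<lambda>\<tau>. L2_norm lborel (\<lambda>x. u \<tau> x - u t x) * L2_norm lborel \<psi>) \<longlongrightarrow> 0) (at t)"
        using tendsto_mult_right[OF ucont, of t "L2_norm lborel \<psi>"] by simp
    qed
    have lim3: "((\<lambda>\<tau>. (L2_pairing (u \<tau>) \<phi> - L2_pairing (u t) \<phi>) / complex_of_real (\<tau> - t)) \<longlongrightarrow> d) (at t)"
    proof -
      have "((\<lambda>\<tau>. (L2_pairing (u \<tau>) \<phi> - L2_pairing (u t) \<phi>) /\<^sub>R (\<tau> - t)) \<longlongrightarrow> d) (at t)"
        using d(1) unfolding has_vector_derivative_iff_tendsto .
      then show ?thesis by (simp add: scaleR_conv_of_real divide_inverse mult.commute)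
    qed
    have gen: "A / \<delta> + B + C + D / \<delta> = inverse \<delta> * (A + \<delta> * B + \<delta> * C + D)" if "\<delta> \<noteq> 0" for A B C D \<delta> :: complex
      using that by (simp add: field_simps)
    have "((\<lambda>\<tau>. L2_pairing (u \<tau>) (ifourier (\<rho> \<tau>)) / complex_of_real (\<tau> - t) + L2_pairing (\<lambda>x. u \<tau> x - u t x) \<psi> + L2_pairing (u t) \<psi>
        + (L2_pairing (u \<tau>) \<phi> - L2_pairing (u t) \<phi>) / complex_of_real (\<tau> - t)) \<longlongrightarrow> 0 + 0 + L2_pairing (u t) \<psi> + d) (at t)"
      by (intro tendsto_add lim1 lim2 lim3 tendsto_const)
    then have "((\<lambda>\<tau>. (F \<tau> - F t) /\<^sub>R (\<tau> - t)) \<longlongrightarrow> 0 + 0 + L2_pairing (u t) \<psi> + d) (at t)"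
    proof (rule Lim_transform_within[where d = 1])
      fix \<tau> :: real assume "0 < dist \<tau> t"
      then have *: "complex_of_real (\<tau> - t) \<noteq> 0" by (simp only: of_real_eq_0_iff) auto
      show "L2_pairing (u \<tau>) (ifourier (\<rho> \<tau>)) / complex_of_real (\<tau> - t) + L2_pairing (\<lambda>x. u \<tau> x - u t x) \<psi> + L2_pairing (u t) \<psi>
        + (L2_pairing (u \<tau>) \<phi> - L2_pairing (u t) \<phi>) / complex_of_real (\<tau> - t) = (F \<tau> - F t) /\<^sub>R (\<tau> - t)"
        unfolding split scaleR_conv_of_real of_real_inverse by (rule gen[OF *])
    qed simp
    then show ?thesis unfolding has_vector_derivative_iff_tendsto using d\<psi> by simp
  qed
  have "\<exists>c. \<forall>t\<in>UNIV. F t = c"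
    by (rule has_derivative_zero_constant) (use deriv in \<open>auto simp: has_vector_derivative_def\<close>)
  then have "F t = F 0" by (metis UNIV_I)
  then show ?thesis unfolding F_def by (simp add: evol_0)
qed

text \<open>By duality the difference w at time t, paired with a smooth test function, equals the
  difference w0 at time 0 paired with the function evolved back, whose norm is the same. Density of
  the test functions then bounds w by w0. The constant 4 is the square of a factor 2 lost in the
  triangle inequality.\<close>

lemma solution_close:
  fixes a :: "real^'n \<Rightarrow> real"
  assumes a: "smooth_with poly_fun a" and u: "cauchy_solution a u0 u" and g: "schwartz g"
  shows "sqn (\<lambda>x. u t x - ifourier (evol a t g) x) \<le> 4 * sqn (\<lambda>x. u0 x - ifourier g x)"
proof -
  have uL2: "in_L2 lborel (u t)" for t using u unfolding cauchy_solution_def by blast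
  have S: "schwartz (evol a \<tau> f)" if "schwartz f" for \<tau> f by (rule schwartz_evol[OF a that])
  have PL2: "in_L2 lborel (ifourier f)" if "schwartz f" for f :: "real^'n \<Rightarrow> complex" by (intro in_L2_schwartz schwartz_ifourier that)
  define w where "w = (\<lambda>x. u t x - ifourier (evol a t g) x)"
  define w0 where "w0 = (\<lambda>x. u 0 x - ifourier g x)"
  have w: "in_L2 lborel w" unfolding w_def by (intro in_L2_diff uL2 PL2 S g)
  have w0: "in_L2 lborel w0" unfolding w0_def by (intro in_L2_diff uL2 PL2 g)
  let ?n = "L2_norm lborel :: (real^'n \<Rightarrow> complex) \<Rightarrow> real"
  have dual: "L2_pairing w (ifourier (evol a t h)) = L2_pairing w0 (ifourier h)" if h: "schwartz h" for h
  proof -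
    have "L2_pairing (evol a t g) (evol a t h) = L2_pairing g h"
      unfolding L2_pairing_def evol_def
      by (intro Bochner_Integration.integral_cong) (auto simp: cis_cnj cis_mult mult_ac simp flip: mult.assoc)
    then have "L2_pairing (ifourier (evol a t g)) (ifourier (evol a t h)) = L2_pairing (ifourier g) (ifourier h)"
      by (simp add: Plancherel S g h)
    then show ?thesis unfolding w_def w0_def
      by (simp add: L2_pairing_diff_left uL2 PL2 S g h solution_duality[OF a u h])
  qed
  have bd: "norm (L2_pairing w (ifourier h)) \<le> ?n w0 * ?n (ifourier h)" if h: "schwartz h" for h
  proof -
    \<comment> \<open>Evolving h backwards first makes \<open>ifourier h\<close> itself the test
      function at time t; Plancherel shows that its norm is unaffected.\<close>
    let ?h = "evol a (- t) h"
    have "L2_pairing w (ifourier h) = L2_pairing w0 (ifourier ?h)"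
      using dual[OF S[OF h, of "- t"]] unfolding evol_evol .
    also have "norm \<dots> \<le> ?n w0 * ?n (ifourier ?h)" by (intro L2_pairing_Cauchy_Schwarz w0 PL2 S h)
    also have "?n (ifourier ?h) = ?n (ifourier h)"
      by (rule power2_eq_imp_eq) (simp_all add: L2_norm_ifourier S h L2_norm_evol L2_norm_nonneg)
    finally show ?thesis .
  qed
  \<comment> \<open>The test function is chosen within e of w itself; the factor 2 comes from
    \<open>L2_norm_add_le\<close>.\<close>
  have eps: "(?n w)\<^sup>2 \<le> ?n w * e + ?n w0 * (2 * (?n w + e))" if e: "e > 0" for e
  proof -
    have "sqn (\<lambda>x. complex_of_real (\<langle>x\<rangle> ^ 0) * w x) < \<infinity>" using w by (simp add: in_L2_sqn)
    moreover have "w \<in> borel_measurable borel" using w by (simp add: in_L2_def)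
    ultimately obtain h where h: "schwartz h" "sqn (\<lambda>x. w x - ifourier h x) < ennreal (e\<^sup>2)"
      using schwartz_dense[of w 0 "ennreal (e\<^sup>2)"] e by auto
    define r where "r = (\<lambda>x. w x - ifourier h x)"
    have r: "in_L2 lborel r" unfolding r_def by (intro in_L2_diff w PL2 h)
    have "ennreal ((?n r)\<^sup>2) < ennreal (e\<^sup>2)" unfolding L2_norm_sq[OF r] using h(2) by (simp add: r_def)
    then have "(?n r)\<^sup>2 \<le> e\<^sup>2" using ennreal_less_iff by (metis less_imp_le zero_le_power2)
    then have nr: "?n r \<le> e" by (rule power2_le_imp_le) (use e in simp)
    have Ph: "ifourier h = (\<lambda>x. w x + (-1) * r x)" by (simp add: r_def)
    have nP: "?n (ifourier h) \<le> 2 * (?n w + e)"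
    proof -
      have "?n (ifourier h) \<le> 2 * (?n w + ?n (\<lambda>x. (-1) * r x))"
        unfolding Ph by (intro L2_norm_add_le w in_L2_cmult r)
      also have "?n (\<lambda>x. (-1) * r x) = ?n r" by (simp add: L2_norm_def)
      finally show ?thesis using nr by simp
    qed
    have "complex_of_real ((?n w)\<^sup>2) = L2_pairing w (\<lambda>x. r x + ifourier h x)"
      using L2_pairing_self[OF w] by (simp add: r_def)
    also have "\<dots> = L2_pairing w r + L2_pairing w (ifourier h)" by (intro L2_pairing_add_right w r PL2 h)
    finally have "(?n w)\<^sup>2 = norm (L2_pairing w r + L2_pairing w (ifourier h))"
      by (metis abs_of_nonneg norm_of_real zero_le_power2)
    also have "\<dots> \<le> norm (L2_pairing w r) + norm (L2_pairing w (ifourier h))" by (rule norm_triangle_ineq)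
    also have "\<dots> \<le> ?n w * ?n r + ?n w0 * ?n (ifourier h)"
      by (intro add_mono L2_pairing_Cauchy_Schwarz w r bd h)
    also have "\<dots> \<le> ?n w * e + ?n w0 * (2 * (?n w + e))"
      by (intro add_mono mult_left_mono nr nP L2_norm_nonneg)
    finally show ?thesis .
  qed
  \<comment> \<open>The limit e \<rightarrow> 0. Unless w has norm zero, one factor of its norm can
    then be divided out.\<close>
  have "(?n w)\<^sup>2 \<le> ?n w * 0 + ?n w0 * (2 * (?n w + 0))"
  proof (rule tendsto_lowerbound)
    show "((\<lambda>e. ?n w * e + ?n w0 * (2 * (?n w + e))) \<longlongrightarrow> ?n w * 0 + ?n w0 * (2 * (?n w + 0))) (at_right 0)"
      by (intro tendsto_intros)
    show "\<forall>\<^sub>F e in at_right 0. (?n w)\<^sup>2 \<le> ?n w * e + ?n w0 * (2 * (?n w + e))"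
      using eps by (auto simp: eventually_at_filter)
  qed simp
  then have "?n w * ?n w \<le> (2 * ?n w0) * ?n w" by (simp add: power2_eq_square mult_ac)
  then have le: "?n w \<le> 2 * ?n w0"
    by (cases "?n w = 0") (use L2_norm_nonneg[of lborel w] L2_norm_nonneg[of lborel w0] in auto)
  have "sqn w = ennreal ((?n w)\<^sup>2)" by (simp add: L2_norm_sq w)
  also have "\<dots> \<le> ennreal ((2 * ?n w0)\<^sup>2)" by (intro ennreal_leI power_mono le L2_norm_nonneg)
  also have "\<dots> = 4 * sqn w0" by (simp add: power_mult_distrib L2_norm_sq w0 ennreal_mult)
  also have "sqn w0 = sqn (\<lambda>x. u0 x - ifourier g x)"
    unfolding sqn_def w0_def using u unfolding cauchy_solution_def
    by (intro nn_integral_cong_AE) auto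
  finally show ?thesis unfolding w_def .
qed

subsection \<open>Smoothing on transversal pieces of frequency space\<close>

lemma integral_tensor:
  fixes f :: "'a::euclidean_space \<Rightarrow> complex" and g :: "'c::euclidean_space \<Rightarrow> complex"
  assumes "integrable lborel f" "integrable lborel g"
  shows "integrable lborel (\<lambda>p. f (fst p) * g (snd p))"
    and "(LINT p|lborel. f (fst p) * g (snd p)) = (LINT x|lborel. f x) * (LINT y|lborel. g y)"
proof -
  note int = integrable_tensor[OF assms]
  show "integrable lborel (\<lambda>p. f (fst p) * g (snd p))"
    using int unfolding lborel_prod by (simp add: case_prod_unfold)
  have "(LINT p|lborel. f (fst p) * g (snd p)) = (LINT p|(lborel \<Otimes>\<^sub>M lborel). (case p of (x, y) \<Rightarrow> f x * g y))"
    unfolding lborel_prod by (simp add: case_prod_unfold)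
  also have "\<dots> = (LINT x|lborel. (LINT y|lborel. f x * g y))"
    using lborel_pair.integral_fst'[OF int] by simp
  also have "\<dots> = (LINT x|lborel. f x) * (LINT y|lborel. g y)" by simp
  finally show "(LINT p|lborel. f (fst p) * g (snd p)) = (LINT x|lborel. f x) * (LINT y|lborel. g y)" .
qed

text \<open>The right-hand side is |\<Phi>(\<xi>) - \<Phi>(\<eta>)|^2, where \<Phi> replaces
  coordinate i by the value of a. The index may depend on the set E; it also selects the coordinate
  whose weight in x is used on E.\<close>

definition transversal :: "(real^'n \<Rightarrow> real) \<Rightarrow> (real^'n) set \<Rightarrow> bool"
  where "transversal a E \<longleftrightarrow> (\<exists>i c. c > 0 \<and> (\<forall>\<xi>\<in>E. \<forall>\<eta>\<in>E.
    c\<^sup>2 * (norm (\<xi> - \<eta>))\<^sup>2 \<le> (a \<xi> - a \<eta>)\<^sup>2 + (\<Sum>j\<in>-{i}. (\<xi> $ j - \<eta> $ j)\<^sup>2)))"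

lemma evol_ifourier_measurable [measurable]:
  fixes q :: "real^'n \<Rightarrow> complex"
  assumes [measurable]: "a \<in> borel_measurable borel" "q \<in> borel_measurable borel"
  shows "(\<lambda>p. ifourier (evol a (fst p) q) (snd p)) \<in> borel_measurable borel"
proof -
  have "(\<lambda>p. ifourier (evol a (fst p) q) (snd p)) \<in> borel_measurable (borel \<Otimes>\<^sub>M borel)"
    unfolding ifourier_def evol_def by measurable
  then show ?thesis by (simp add: borel_prod)
qed

lemma exp_prod_combine:
  fixes d :: real
  assumes "finite I"
  shows "exp (- A / d) * (\<Prod>j\<in>I. exp (- b j / d)) = exp (- (A + (\<Sum>j\<in>I. b j)) / d)"
proof -
  have "exp (- A / d) * (\<Prod>j\<in>I. exp (- b j / d)) = exp (- A / d + (\<Sum>j\<in>I. - b j / d))"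
    by (simp only: exp_add exp_sum[OF assms])
  also have "(\<Sum>j\<in>I. - b j / d) = - (\<Sum>j\<in>I. b j) / d" by (simp add: sum_divide_distrib sum_negf)
  also have "- A / d + - (\<Sum>j\<in>I. b j) / d = - (A + (\<Sum>j\<in>I. b j)) / d" by (simp add: add_divide_distrib diff_divide_distrib)
  finally show ?thesis .
qed

text \<open>The weights on space-time are products, so the kernel of T^* T factorises into Fourier
  integrals in t and in each x_j. They are Gaussian except for the one in x_i, which is bounded by
  the mass of its weight. The resulting convolution kernel has mass A (2\<pi>/c)^n, the constant of
  the estimate.\<close>

lemma smoothing_piece_real:
  fixes a :: "real^'n \<Rightarrow> real"
  assumes a[measurable]: "a \<in> borel_measurable borel" and s: "s > 1 / 2" and c: "c > 0"
    and E: "\<And>\<xi> \<eta>. \<xi> \<in> E \<Longrightarrow> \<eta> \<in> E \<Longrightarrow>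
      c\<^sup>2 * (norm (\<xi> - \<eta>))\<^sup>2 \<le> (a \<xi> - a \<eta>)\<^sup>2 + (\<Sum>j\<in>-{i}. (\<xi> $ j - \<eta> $ j)\<^sup>2)"
    and q: "integrable lborel q" "integrable lborel (\<lambda>\<xi>. (norm (q \<xi>))\<^sup>2)" and qE: "\<And>\<xi>. \<xi> \<notin> E \<Longrightarrow> q \<xi> = 0"
  shows "(\<integral>\<^sup>+p. ennreal ((1 + (snd p $ i)\<^sup>2) powr (- s) * (norm (ifourier (evol a (fst p) q) (snd p)))\<^sup>2) \<partial>lborel)
    \<le> ennreal ((LINT y|lborel. (1 + y\<^sup>2) powr (- s)) * (2 * pi / c) ^ CARD('n) * (LINT \<xi>|lborel. (norm (q \<xi>))\<^sup>2))"
proof -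
  have [measurable]: "q \<in> borel_measurable borel" using borel_measurable_integrable[OF q(1)] by simp
  define A where "A = (LINT y|lborel. (1 + y\<^sup>2 :: real) powr (- s))"
  have A0: "A \<ge> 0" unfolding A_def by simp
  have comp[measurable]: "(\<lambda>p. snd p $ j) \<in> borel_measurable (borel :: (real \<times> (real^'n)) measure)" for j
    by (intro borel_measurable_continuous_onI continuous_intros)
  have snd_m[measurable]: "(snd :: real \<times> (real^'n) \<Rightarrow> real^'n) \<in> borel_measurable borel"
    by (intro borel_measurable_continuous_onI continuous_intros)
  have fst_m[measurable]: "(fst :: real \<times> (real^'n) \<Rightarrow> real) \<in> borel_measurable borel"
    by (intro borel_measurable_continuous_onI continuous_intros)
  show ?thesis
  \<comment> \<open>The regulariser damps t and every x_j except x_i, in which the weight is already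
    integrable.\<close>
  proof (rule nn_integral_gauss_limit[where \<phi> = "\<lambda>p. (fst p)\<^sup>2 + (\<Sum>j\<in>-{i}. (snd p $ j)\<^sup>2)"])
    fix \<epsilon> :: real assume \<epsilon>: "\<epsilon> > 0"
    define w where "w j y = (if j = i then complex_of_real ((1 + y\<^sup>2) powr (- s)) else complex_of_real (exp (- (\<epsilon> * y\<^sup>2) / 2)))" for j y
    define wt where "wt y = complex_of_real (exp (- (\<epsilon> * y\<^sup>2) / 2))" for y :: real
    define W where "W x = (\<Prod>j\<in>UNIV. w j (x $ j))" for x :: "real^'n"
    define d where "d p = exp (- (\<epsilon> * (fst p)\<^sup>2) / 2) * ((1 + (snd p $ i)\<^sup>2) powr (- s) * (\<Prod>j\<in>-{i}. exp (- (\<epsilon> * (snd p $ j)\<^sup>2) / 2)))" for p :: "real \<times> (real^'n)"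
    have d0: "d p \<ge> 0" for p unfolding d_def by (intro mult_nonneg_nonneg prod_nonneg) auto
    have d_meas[measurable]: "d \<in> borel_measurable borel" unfolding d_def by measurable
    have dW: "complex_of_real (d p) = wt (fst p) * W (snd p)" for p
      unfolding d_def wt_def W_def prod.remove[OF finite UNIV_I[of i]] by (simp add: w_def Compl_eq_Diff_UNIV)
    have iw: "integrable lborel (w j)" for j
      unfolding w_def using integrable_bracket_1[OF s] gauss_integral_1(1)[OF \<epsilon>] by (cases "j = i") auto
    have iwt: "integrable lborel wt" unfolding wt_def by (rule gauss_integral_1(1)[OF \<epsilon>])
    have iW: "integrable lborel W" unfolding W_def by (rule lborel_prod_fun(1)[OF iw])
    have id: "integrable lborel d"
    proof -
      have "integrable lborel (\<lambda>p. Re (complex_of_real (d p)))"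
        unfolding dW by (intro integrable_Re integral_tensor(1) iwt iW)
      then show ?thesis by simp
    qed
    define \<mu> where "\<mu> = density lborel (\<lambda>p. ennreal (d p))"
    \<comment> \<open>The constant counts n Gaussian integrals, one in t and n - 1 in the x_j with j
      \<noteq> i, and the mass A of the weight in x_i.\<close>
    define k where "k \<zeta> = A * sqrt (2 * pi / \<epsilon>) ^ CARD('n) * exp (- ((c\<^sup>2 / \<epsilon>) * (norm \<zeta>)\<^sup>2) / 2)" for \<zeta> :: "real^'n"
    have fin: "finite_measure \<mu>"
    proof
      have "emeasure \<mu> (space \<mu>) = (\<integral>\<^sup>+p. ennreal (d p) \<partial>lborel)"
        unfolding \<mu>_def by (subst emeasure_density) auto
      also have "\<dots> < \<infinity>" using id d0 by (simp add: nn_integral_eq_integral)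
      finally show "emeasure \<mu> (space \<mu>) \<noteq> \<infinity>" by simp
    qed
    have k0: "k \<zeta> \<ge> 0" for \<zeta> unfolding k_def using \<epsilon> A0 by simp
    have c2: "c\<^sup>2 / \<epsilon> > 0" using c \<epsilon> by simp
    have k: "integrable lborel k" unfolding k_def by (intro integrable_mult_right gauss_fourier(1)[OF c2])
    have k_int: "(LINT \<zeta>|lborel. k \<zeta>) = A * (2 * pi / c) ^ CARD('n)"
    proof -
      have "(LINT \<zeta>|lborel. k \<zeta>) = A * sqrt (2 * pi / \<epsilon>) ^ CARD('n) * sqrt (2 * pi / (c\<^sup>2 / \<epsilon>)) ^ CARD('n)"
        unfolding k_def using gauss_integral[OF c2, where 'n = 'n] by simp
      also have "\<dots> = A * (sqrt (2 * pi / \<epsilon>) * sqrt (2 * pi / (c\<^sup>2 / \<epsilon>))) ^ CARD('n)"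
        by (simp only: power_mult_distrib mult.assoc)
      also have "sqrt (2 * pi / \<epsilon>) * sqrt (2 * pi / (c\<^sup>2 / \<epsilon>)) = sqrt ((2 * pi / c)\<^sup>2)"
        unfolding real_sqrt_mult[symmetric] using \<epsilon> c by (intro arg_cong[where f = sqrt]) (simp add: field_simps power2_eq_square)
      also have "\<dots> = 2 * pi / c" using c by (simp only: real_sqrt_abs) simp
      finally show ?thesis .
    qed
    define e where "e p \<xi> = cis (snd p \<bullet> \<xi>) * cis (- fst p * a \<xi>)" for p \<xi>
    have eP: "(LINT \<xi>|lborel. e p \<xi> * q \<xi>) = ifourier (evol a (fst p) q) (snd p)" for p
      unfolding e_def ifourier_def evol_def by (simp only: mult.assoc)
    have "(\<integral>\<^sup>+p. ennreal ((norm (LINT \<xi>|lborel. e p \<xi> * q \<xi>))\<^sup>2) \<partial>\<mu>)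
        \<le> ennreal ((LINT \<zeta>|lborel. k \<zeta>) * (LINT \<xi>|lborel. (norm (q \<xi>))\<^sup>2))"
    proof (rule TT_star_bound[OF fin _ _ q k k0])
      have m: "(\<lambda>(p, \<xi>). e p \<xi>) \<in> borel_measurable ((borel \<Otimes>\<^sub>M borel) \<Otimes>\<^sub>M borel)" unfolding e_def by measurable
      have S: "sets (\<mu> \<Otimes>\<^sub>M (lborel :: (real^'n) measure)) = sets ((borel \<Otimes>\<^sub>M borel) \<Otimes>\<^sub>M borel)"
      proof (rule sets_pair_measure_cong)
        show "sets \<mu> = sets (borel \<Otimes>\<^sub>M borel)" unfolding \<mu>_def borel_prod by simp
      qed simp
      show "(\<lambda>(p, \<xi>). e p \<xi>) \<in> borel_measurable (\<mu> \<Otimes>\<^sub>M lborel)"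
        unfolding measurable_cong_sets[OF S refl] by (rule m)
      show "norm (e p \<xi>) \<le> 1" for p \<xi> unfolding e_def by (simp add: norm_mult)
      fix \<xi> \<eta> assume nz: "q \<xi> \<noteq> 0" "q \<eta> \<noteq> 0"
      let ?\<zeta> = "\<xi> - \<eta>" and ?\<tau> = "- (a \<xi> - a \<eta>)"
      \<comment> \<open>The product of the two phases is a plane wave in (t, x), with frequency
        a(\<eta>) - a(\<xi>) in t and \<xi> - \<eta> in x.\<close>
      have ee: "e p \<xi> * cnj (e p \<eta>) = cis (fst p * ?\<tau>) * cis (snd p \<bullet> ?\<zeta>)" for p
        unfolding e_def by (simp add: cis_cnj cis_mult inner_diff_right algebra_simps)
      have i1: "integrable lborel (\<lambda>y. cis (y * ?\<tau>) * wt y)"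
        by (rule Bochner_Integration.integrable_bound[OF iwt]) (auto simp: norm_mult wt_def)
      have i2: "integrable lborel (\<lambda>x. cis (x \<bullet> ?\<zeta>) * W x)"
        using integrable_cis_mult[OF iW, of ?\<zeta>] by (simp add: inner_commute)
      have "(LINT p|\<mu>. e p \<xi> * cnj (e p \<eta>)) = (LINT p|lborel. d p *\<^sub>R (e p \<xi> * cnj (e p \<eta>)))"
        unfolding \<mu>_def
      proof (rule integral_density)
        show "(\<lambda>p. e p \<xi> * cnj (e p \<eta>)) \<in> borel_measurable lborel" unfolding ee by measurable
      qed (auto simp: d0)
      also have "\<dots> = (LINT p|lborel. (cis (fst p * ?\<tau>) * wt (fst p)) * (cis (snd p \<bullet> ?\<zeta>) * W (snd p)))"
        unfolding scaleR_conv_of_real dW ee by (simp only: mult_ac)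
      also have "\<dots> = (LINT y|lborel. cis (y * ?\<tau>) * wt y) * (LINT x|lborel. cis (x \<bullet> ?\<zeta>) * W x)"
        by (rule integral_tensor(2)[OF i1 i2])
      also have "norm \<dots> \<le> (sqrt (2 * pi / \<epsilon>) * exp (- ?\<tau>\<^sup>2 / (2 * \<epsilon>))) * (A * (\<Prod>j\<in>-{i}. sqrt (2 * pi / \<epsilon>) * exp (- (?\<zeta> $ j)\<^sup>2 / (2 * \<epsilon>))))"
        unfolding norm_mult
      proof (intro mult_mono)
        have g1: "norm (LINT y|lborel. cis (y * z) * complex_of_real (exp (- (\<epsilon> * y\<^sup>2) / 2))) = sqrt (2 * pi / \<epsilon>) * exp (- z\<^sup>2 / (2 * \<epsilon>))" for z
          unfolding gauss_integral_1(2)[OF \<epsilon>] norm_of_real using \<epsilon> by simp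
        show "norm (LINT y|lborel. cis (y * ?\<tau>) * wt y) \<le> sqrt (2 * pi / \<epsilon>) * exp (- ?\<tau>\<^sup>2 / (2 * \<epsilon>))"
          unfolding wt_def g1 by simp
        have "(LINT x|lborel. cis (x \<bullet> ?\<zeta>) * W x) = (\<Prod>j\<in>UNIV. (LINT y|lborel. cis (y * ?\<zeta> $ j) * w j y))"
          unfolding W_def by (rule fourier_prod_fun[OF iw])
        then have "norm (LINT x|lborel. cis (x \<bullet> ?\<zeta>) * W x) = (\<Prod>j\<in>UNIV. norm (LINT y|lborel. cis (y * ?\<zeta> $ j) * w j y))"
          by (simp only: prod_norm)
        also have "\<dots> = norm (LINT y|lborel. cis (y * ?\<zeta> $ i) * w i y) * (\<Prod>j\<in>-{i}. norm (LINT y|lborel. cis (y * ?\<zeta> $ j) * w j y))"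
          by (subst prod.remove[OF finite UNIV_I[of i]]) (simp only: Compl_eq_Diff_UNIV)
        also have "(\<Prod>j\<in>-{i}. norm (LINT y|lborel. cis (y * ?\<zeta> $ j) * w j y)) = (\<Prod>j\<in>-{i}. sqrt (2 * pi / \<epsilon>) * exp (- (?\<zeta> $ j)\<^sup>2 / (2 * \<epsilon>)))"
        proof (rule prod.cong[OF refl])
          fix j assume "j \<in> -{i}"
          then have "w j y = complex_of_real (exp (- (\<epsilon> * y\<^sup>2) / 2))" for y by (simp add: w_def)
          then show "norm (LINT y|lborel. cis (y * ?\<zeta> $ j) * w j y) = sqrt (2 * pi / \<epsilon>) * exp (- (?\<zeta> $ j)\<^sup>2 / (2 * \<epsilon>))"
            by (simp only: g1)
        qed
        \<comment> \<open>Oscillation in x_i is given up: the difference of the i-th frequencies is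
          recovered from that of the values of a, through the integral in t.\<close>
        also have "norm (LINT y|lborel. cis (y * ?\<zeta> $ i) * w i y) \<le> A"
        proof -
          have "norm (LINT y|lborel. cis (y * ?\<zeta> $ i) * w i y) \<le> (LINT y|lborel. norm (cis (y * ?\<zeta> $ i) * w i y))"
            by (rule integral_norm_bound)
          also have "\<dots> = A" unfolding A_def by (simp add: norm_mult w_def)
          finally show ?thesis .
        qed
        finally show "norm (LINT x|lborel. cis (x \<bullet> ?\<zeta>) * W x) \<le> A * (\<Prod>j\<in>-{i}. sqrt (2 * pi / \<epsilon>) * exp (- (?\<zeta> $ j)\<^sup>2 / (2 * \<epsilon>)))"
          using \<epsilon> by (simp add: mult_right_mono prod_nonneg)
      qed (use \<epsilon> in auto)
      also have "\<dots> = A * sqrt (2 * pi / \<epsilon>) ^ CARD('n) * exp (- (?\<tau>\<^sup>2 + (\<Sum>j\<in>-{i}. (?\<zeta> $ j)\<^sup>2)) / (2 * \<epsilon>))"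
      proof -
        \<comment> \<open>The Gaussian in t fills the place of the coordinate i, so n equal factors
          arise.\<close>
        have C: "sqrt (2 * pi / \<epsilon>) * sqrt (2 * pi / \<epsilon>) ^ card (-{i}) = sqrt (2 * pi / \<epsilon>) ^ CARD('n)"
          using card_Suc_Diff1[OF finite UNIV_I[of i]] unfolding Compl_eq_Diff_UNIV power_Suc[symmetric] by simp
        have X: "exp (- ?\<tau>\<^sup>2 / (2 * \<epsilon>)) * (\<Prod>j\<in>-{i}. exp (- (?\<zeta> $ j)\<^sup>2 / (2 * \<epsilon>))) = exp (- (?\<tau>\<^sup>2 + (\<Sum>j\<in>-{i}. (?\<zeta> $ j)\<^sup>2)) / (2 * \<epsilon>))"
          by (rule exp_prod_combine) simp
        have P: "(\<Prod>j\<in>-{i}. sqrt (2 * pi / \<epsilon>) * exp (- (?\<zeta> $ j)\<^sup>2 / (2 * \<epsilon>))) = sqrt (2 * pi / \<epsilon>) ^ card (-{i}) * (\<Prod>j\<in>-{i}. exp (- (?\<zeta> $ j)\<^sup>2 / (2 * \<epsilon>)))"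
          by (simp only: prod.distrib prod_constant)
        have "(sqrt (2 * pi / \<epsilon>) * exp (- ?\<tau>\<^sup>2 / (2 * \<epsilon>))) * (A * (\<Prod>j\<in>-{i}. sqrt (2 * pi / \<epsilon>) * exp (- (?\<zeta> $ j)\<^sup>2 / (2 * \<epsilon>)))) =
            A * (sqrt (2 * pi / \<epsilon>) * sqrt (2 * pi / \<epsilon>) ^ card (-{i})) * (exp (- ?\<tau>\<^sup>2 / (2 * \<epsilon>)) * (\<Prod>j\<in>-{i}. exp (- (?\<zeta> $ j)\<^sup>2 / (2 * \<epsilon>))))"
          unfolding P by (simp only: mult_ac)
        then show ?thesis unfolding C X .
      qed
      \<comment> \<open>As q is nonzero at both frequencies, both lie in E, and transversality
        bounds the exponent by a multiple of |\<xi> - \<eta>|^2.\<close>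
      also have "\<dots> \<le> k ?\<zeta>"
      proof -
        have "c\<^sup>2 * (norm ?\<zeta>)\<^sup>2 \<le> (a \<xi> - a \<eta>)\<^sup>2 + (\<Sum>j\<in>-{i}. (\<xi> $ j - \<eta> $ j)\<^sup>2)"
          by (rule E) (use nz qE in auto)
        then have "c\<^sup>2 * (norm ?\<zeta>)\<^sup>2 / (2 * \<epsilon>) \<le> (?\<tau>\<^sup>2 + (\<Sum>j\<in>-{i}. (?\<zeta> $ j)\<^sup>2)) / (2 * \<epsilon>)"
          using \<epsilon> by (intro divide_right_mono) (simp_all add: power2_commute)
        then have "- (?\<tau>\<^sup>2 + (\<Sum>j\<in>-{i}. (?\<zeta> $ j)\<^sup>2)) / (2 * \<epsilon>) \<le> - ((c\<^sup>2 / \<epsilon>) * (norm ?\<zeta>)\<^sup>2) / 2"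
        proof -
          have e1: "- X / (2 * \<epsilon>) = - (X / (2 * \<epsilon>))" for X by (rule minus_divide_left[symmetric])
          have e2: "- ((c\<^sup>2 / \<epsilon>) * N) / 2 = - (c\<^sup>2 * N / (2 * \<epsilon>))" for N by simp
          show ?thesis if "c\<^sup>2 * (norm ?\<zeta>)\<^sup>2 / (2 * \<epsilon>) \<le> (?\<tau>\<^sup>2 + (\<Sum>j\<in>-{i}. (?\<zeta> $ j)\<^sup>2)) / (2 * \<epsilon>)"
            using that unfolding e1 e2 neg_le_iff_le .
        qed
        then show ?thesis unfolding k_def using A0 \<epsilon> by (intro mult_left_mono) auto
      qed
      finally show "norm (LINT p|\<mu>. e p \<xi> * cnj (e p \<eta>)) \<le> k ?\<zeta>" .
    qed
    also have "(\<integral>\<^sup>+p. ennreal ((norm (LINT \<xi>|lborel. e p \<xi> * q \<xi>))\<^sup>2) \<partial>\<mu>) =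
      (\<integral>\<^sup>+p. ennreal (d p) * ennreal ((norm (ifourier (evol a (fst p) q) (snd p)))\<^sup>2) \<partial>lborel)"
      unfolding \<mu>_def eP by (rule nn_integral_density) auto
    also have "\<dots> = (\<integral>\<^sup>+p. ennreal ((1 + (snd p $ i)\<^sup>2) powr (- s) * (norm (ifourier (evol a (fst p) q) (snd p)))\<^sup>2
        * exp (- (\<epsilon> * ((fst p)\<^sup>2 + (\<Sum>j\<in>-{i}. (snd p $ j)\<^sup>2))) / 2)) \<partial>lborel)"
    proof (intro nn_integral_cong)
      fix p :: "real \<times> (real^'n)"
      have "exp (- (\<epsilon> * (fst p)\<^sup>2) / 2) * (\<Prod>j\<in>-{i}. exp (- (\<epsilon> * (snd p $ j)\<^sup>2) / 2)) = exp (- (\<epsilon> * ((fst p)\<^sup>2 + (\<Sum>j\<in>-{i}. (snd p $ j)\<^sup>2))) / 2)"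
        by (subst exp_prod_combine) (simp_all add: sum_distrib_left distrib_left)
      note X = this
      have "d p * (norm (ifourier (evol a (fst p) q) (snd p)))\<^sup>2 = (1 + (snd p $ i)\<^sup>2) powr (- s) * (norm (ifourier (evol a (fst p) q) (snd p)))\<^sup>2
        * exp (- (\<epsilon> * ((fst p)\<^sup>2 + (\<Sum>j\<in>-{i}. (snd p $ j)\<^sup>2))) / 2)"
        unfolding X[symmetric] d_def by (simp only: mult_ac)
      then show "ennreal (d p) * ennreal ((norm (ifourier (evol a (fst p) q) (snd p)))\<^sup>2) = ennreal ((1 + (snd p $ i)\<^sup>2) powr (- s) * (norm (ifourier (evol a (fst p) q) (snd p)))\<^sup>2
        * exp (- (\<epsilon> * ((fst p)\<^sup>2 + (\<Sum>j\<in>-{i}. (snd p $ j)\<^sup>2))) / 2))"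
        using d0[of p] by (simp only: ennreal_mult[symmetric] zero_le_power2)
    qed
    finally show "(\<integral>\<^sup>+p. ennreal ((1 + (snd p $ i)\<^sup>2) powr (- s) * (norm (ifourier (evol a (fst p) q) (snd p)))\<^sup>2
        * exp (- (\<epsilon> * ((fst p)\<^sup>2 + (\<Sum>j\<in>-{i}. (snd p $ j)\<^sup>2))) / 2)) \<partial>lborel)
      \<le> ennreal ((LINT y|lborel. (1 + y\<^sup>2) powr (- s)) * (2 * pi / c) ^ CARD('n) * (LINT \<xi>|lborel. (norm (q \<xi>))\<^sup>2))"
      unfolding k_int A_def .
  qed auto
qed

definition smoothed :: "(real^'n \<Rightarrow> real) \<Rightarrow> real \<Rightarrow> (real^'n \<Rightarrow> complex) \<Rightarrow> real \<times> (real^'n) \<Rightarrow> complex"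
  where "smoothed a s q p = complex_of_real (\<langle>snd p\<rangle> powr (- s)) * ifourier (evol a (fst p) q) (snd p)"

lemma smoothed_measurable [measurable]:
  "a \<in> borel_measurable borel \<Longrightarrow> q \<in> borel_measurable borel \<Longrightarrow> smoothed a s q \<in> borel_measurable borel"
proof -
  assume [measurable]: "a \<in> borel_measurable borel" "q \<in> borel_measurable borel"
  have [measurable]: "(\<lambda>p. \<langle>snd p\<rangle>) \<in> borel_measurable (borel :: (real \<times> (real^'n)) measure)"
    by (intro borel_measurable_continuous_onI continuous_intros)
  show "smoothed a s q \<in> borel_measurable borel" unfolding smoothed_def by measurable
qed

text \<open>The squared isotropic weight satisfies \<langle>x\<rangle>^(-2s) \<le> (1 + x_i^2)^(-s)
  for every i, so one weight serves all pieces although the coordinate i varies with the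
  piece.\<close>

lemma smoothing_piece:
  fixes a :: "real^'n \<Rightarrow> real"
  assumes a[measurable]: "a \<in> borel_measurable borel" and s: "s > 1 / 2" and E: "transversal a E"
  shows "\<exists>C\<ge>0. \<forall>q. integrable lborel q \<longrightarrow> integrable lborel (\<lambda>\<xi>. (norm (q \<xi>))\<^sup>2) \<longrightarrow> (\<forall>\<xi>. \<xi> \<notin> E \<longrightarrow> q \<xi> = 0) \<longrightarrow>
    sqn (smoothed a s q) \<le> ennreal C * sqn q"
proof -
  obtain i c where c: "c > 0" and E: "\<And>\<xi> \<eta>. \<xi> \<in> E \<Longrightarrow> \<eta> \<in> E \<Longrightarrow>
      c\<^sup>2 * (norm (\<xi> - \<eta>))\<^sup>2 \<le> (a \<xi> - a \<eta>)\<^sup>2 + (\<Sum>j\<in>-{i}. (\<xi> $ j - \<eta> $ j)\<^sup>2)"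
    using E unfolding transversal_def by blast
  define C where "C = (LINT y|lborel. (1 + y\<^sup>2 :: real) powr (- s)) * (2 * pi / c) ^ CARD('n)"
  have C0: "C \<ge> 0" unfolding C_def using c by simp
  have "sqn (smoothed a s q) \<le> ennreal C * sqn q"
    if q: "integrable lborel q" "integrable lborel (\<lambda>\<xi>. (norm (q \<xi>))\<^sup>2)" "\<forall>\<xi>. \<xi> \<notin> E \<longrightarrow> q \<xi> = 0" for q
  proof -
    have "sqn (smoothed a s q) \<le> (\<integral>\<^sup>+p. ennreal ((1 + (snd p $ i)\<^sup>2) powr (- s) * (norm (ifourier (evol a (fst p) q) (snd p)))\<^sup>2) \<partial>lborel)"
      unfolding sqn_def smoothed_def norm_mult power_mult_distrib
    proof (intro nn_integral_mono ennreal_leI mult_right_mono)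
      fix p :: "real \<times> (real^'n)"
      have "(norm (complex_of_real (\<langle>snd p\<rangle> powr (- s))))\<^sup>2 = (\<langle>snd p\<rangle>\<^sup>2) powr (- s)"
        using japanese_pos[of "snd p"] by (simp add: power2_eq_square powr_mult)
      also have "\<dots> \<le> (1 + (snd p $ i)\<^sup>2) powr (- s)"
        using s by (intro powr_mono2' component_le_japanese) (auto simp: add_pos_nonneg)
      finally show "(norm (complex_of_real (\<langle>snd p\<rangle> powr (- s))))\<^sup>2 \<le> (1 + (snd p $ i)\<^sup>2) powr (- s)" .
    qed simp
    also have "\<dots> \<le> ennreal (C * (LINT \<xi>|lborel. (norm (q \<xi>))\<^sup>2))"
      unfolding C_def by (rule smoothing_piece_real[OF a s c E q(1,2)]) (use q(3) in auto)
    also have "\<dots> = ennreal C * sqn q"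
      unfolding sqn_def using q(2) C0 by (simp add: nn_integral_eq_integral ennreal_mult)
    finally show ?thesis .
  qed
  then show ?thesis using C0 by blast
qed

text \<open>The estimate on one piece asks only for integrability and square integrability of q, so
  frequency space may be cut sharply by indicator functions, without smooth partitions of unity.
  Each further piece costs a factor 2 from \<open>sqn_add_le\<close>.\<close>

lemma smoothing_cover:
  fixes a :: "real^'n \<Rightarrow> real"
  assumes a[measurable]: "a \<in> borel_measurable borel" and s: "s > 1 / 2" and "finite F"
    and "\<And>E. E \<in> F \<Longrightarrow> E \<in> sets borel \<and> transversal a E"
  shows "\<exists>C\<ge>0. \<forall>q. integrable lborel q \<longrightarrow> integrable lborel (\<lambda>\<xi>. (norm (q \<xi>))\<^sup>2) \<longrightarrow> (\<forall>\<xi>. \<xi> \<notin> \<Union>F \<longrightarrow> q \<xi> = 0) \<longrightarrow>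
    sqn (smoothed a s q) \<le> ennreal C * sqn q"
  using assms(3,4)
proof (induction F rule: finite_induct)
  case empty
  have "sqn (smoothed a s q) = 0" if "\<forall>\<xi>. q \<xi> = 0" for q
  proof -
    have "q = (\<lambda>\<xi>. 0)" using that by auto
    then show ?thesis by (simp add: sqn_def smoothed_def ifourier_def evol_def)
  qed
  then show ?case by (intro exI[of _ 0]) auto
next
  case (insert E F)
  obtain C where C: "C \<ge> 0" "\<And>q. integrable lborel q \<Longrightarrow> integrable lborel (\<lambda>\<xi>. (norm (q \<xi>))\<^sup>2) \<Longrightarrow> (\<forall>\<xi>. \<xi> \<notin> \<Union>F \<longrightarrow> q \<xi> = 0) \<Longrightarrow>
    sqn (smoothed a s q) \<le> ennreal C * sqn q" using insert by blast
  have E[measurable]: "E \<in> sets borel" "transversal a E" using insert by auto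
  obtain D where D: "D \<ge> 0" "\<And>q. integrable lborel q \<Longrightarrow> integrable lborel (\<lambda>\<xi>. (norm (q \<xi>))\<^sup>2) \<Longrightarrow> (\<forall>\<xi>. \<xi> \<notin> E \<longrightarrow> q \<xi> = 0) \<Longrightarrow>
    sqn (smoothed a s q) \<le> ennreal D * sqn q" using smoothing_piece[OF a s E(2)] by blast
  have "sqn (smoothed a s q) \<le> ennreal (2 * (C + D)) * sqn q"
    if q: "integrable lborel q" "integrable lborel (\<lambda>\<xi>. (norm (q \<xi>))\<^sup>2)" "\<forall>\<xi>. \<xi> \<notin> \<Union>(insert E F) \<longrightarrow> q \<xi> = 0" for q
  proof -
    have [measurable]: "q \<in> borel_measurable borel" using borel_measurable_integrable[OF q(1)] by simp
    \<comment> \<open>q is split into its restrictions to E and to the complement of E; the latter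
      is supported in the union of the remaining sets.\<close>
    define r where "r S \<xi> = (if \<xi> \<in> S then q \<xi> else 0)" for S \<xi>
    have [measurable]: "r S \<in> borel_measurable borel" if [measurable]: "S \<in> sets borel" for S unfolding r_def by measurable
    have r1: "integrable lborel (r S)" if [measurable]: "S \<in> sets borel" for S
      by (rule Bochner_Integration.integrable_bound[OF q(1)]) (auto simp: r_def)
    have r2: "integrable lborel (\<lambda>\<xi>. (norm (r S \<xi>))\<^sup>2)" if [measurable]: "S \<in> sets borel" for S
      by (rule Bochner_Integration.integrable_bound[OF q(2)]) (auto simp: r_def)
    have rq: "sqn (r S) \<le> sqn q" for S by (rule sqn_mono) (simp add: r_def)
    have cE: "- E \<in> sets borel" using E(1) by simp
    have ie: "integrable lborel (evol a t (r S))" if [measurable]: "S \<in> sets borel" for S t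
      by (rule Bochner_Integration.integrable_bound[OF r1[OF that]]) (auto simp: evol_def norm_mult)
    have "smoothed a s q = (\<lambda>p. smoothed a s (r E) p + smoothed a s (r (- E)) p)"
    proof
      fix p :: "real \<times> (real^'n)"
      have "evol a (fst p) q = (\<lambda>\<xi>. evol a (fst p) (r E) \<xi> + evol a (fst p) (r (- E)) \<xi>)"
        by (auto simp: evol_def r_def)
      then show "smoothed a s q p = smoothed a s (r E) p + smoothed a s (r (- E)) p"
        unfolding smoothed_def by (simp add: ifourier_add[OF ie[OF E(1)] ie[OF cE]] distrib_left)
    qed
    then have "sqn (smoothed a s q) \<le> 2 * sqn (smoothed a s (r E)) + 2 * sqn (smoothed a s (r (- E)))"
      by (simp only:) (rule sqn_add_le; measurable)
    also have "\<dots> \<le> 2 * (ennreal D * sqn q) + 2 * (ennreal C * sqn q)"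
    proof (intro add_mono mult_left_mono)
      have "\<forall>\<xi>. \<xi> \<notin> E \<longrightarrow> r E \<xi> = 0" by (auto simp: r_def)
      then show "sqn (smoothed a s (r E)) \<le> ennreal D * sqn q"
        using D(2)[OF r1[OF E(1)] r2[OF E(1)]] mult_left_mono[OF rq[of E], of "ennreal D"] by (auto intro: order.trans)
      have "\<forall>\<xi>. \<xi> \<notin> \<Union>F \<longrightarrow> r (- E) \<xi> = 0" using q(3) by (auto simp: r_def)
      then show "sqn (smoothed a s (r (- E))) \<le> ennreal C * sqn q"
        using C(2)[OF r1[OF cE] r2[OF cE]] mult_left_mono[OF rq[of "- E"], of "ennreal C"] by (auto intro: order.trans)
    qed auto
    also have "\<dots> = ennreal (2 * (C + D)) * sqn q"
    proof -
      have "ennreal (2 * (C + D)) = 2 * ennreal D + 2 * ennreal C"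
        using C(1) D(1) by (simp add: ennreal_mult distrib_left add.commute)
      then show ?thesis by (simp add: distrib_right mult.assoc)
    qed
    finally show ?thesis .
  qed
  then show ?case using C(1) D(1) by (intro exI[of _ "2 * (C + D)"]) auto
qed

subsection \<open>Dispersive symbols\<close>

lemma frechet_derivative_partials:
  fixes f :: "real^'n \<Rightarrow> real"
  assumes "f differentiable (at z)"
  shows "frechet_derivative f (at z) d = (\<Sum>j\<in>UNIV. d $ j * partial j f z)"
proof -
  have lin: "linear (frechet_derivative f (at z))" by (rule linear_frechet_derivative[OF assms])
  have "d = (\<Sum>j\<in>UNIV. d $ j *\<^sub>R axis j 1)" by (simp add: vec_eq_iff axis_def if_distrib cong: if_cong)
  then have "frechet_derivative f (at z) d = frechet_derivative f (at z) (\<Sum>j\<in>UNIV. d $ j *\<^sub>R axis j 1)" by (rule arg_cong)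
  also have "\<dots> = (\<Sum>j\<in>UNIV. d $ j * partial j f z)"
    by (simp add: linear_sum[OF lin] linear_cmul[OF lin] partial_def)
  finally show ?thesis .
qed

lemma mvt_partials:
  fixes f :: "real^'n \<Rightarrow> real"
  assumes d: "\<And>z. f differentiable (at z)"
  obtains z where "z \<in> closed_segment \<eta> \<xi>" "f \<xi> - f \<eta> = (\<Sum>j\<in>UNIV. (\<xi> $ j - \<eta> $ j) * partial j f z)"
proof -
  define \<gamma> where "\<gamma> t = \<eta> + t *\<^sub>R (\<xi> - \<eta>)" for t :: real
  have der: "((\<lambda>t. f (\<gamma> t)) has_derivative (\<lambda>h. frechet_derivative f (at (\<gamma> t)) (h *\<^sub>R (\<xi> - \<eta>)))) (at t within S)" for t S
  proof -
    have g: "(\<gamma> has_derivative (\<lambda>h. h *\<^sub>R (\<xi> - \<eta>))) (at t within S)" unfolding \<gamma>_def by (auto intro!: derivative_eq_intros)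
    have h: "(f has_derivative frechet_derivative f (at (\<gamma> t))) (at (\<gamma> t))" using d by (simp add: frechet_derivative_works)
    from has_derivative_compose[OF g h] show ?thesis .
  qed
  obtain t where t: "t \<in> {0<..<1}" "f (\<gamma> 1) - f (\<gamma> 0) = frechet_derivative f (at (\<gamma> t)) ((1 - 0) *\<^sub>R (\<xi> - \<eta>))"
    using mvt_simple[of 0 1 "\<lambda>t. f (\<gamma> t)" "\<lambda>t h. frechet_derivative f (at (\<gamma> t)) (h *\<^sub>R (\<xi> - \<eta>))"] der by auto
  have "\<gamma> t = (1 - t) *\<^sub>R \<eta> + t *\<^sub>R \<xi>" by (simp add: \<gamma>_def algebra_simps)
  then have "\<gamma> t \<in> closed_segment \<eta> \<xi>" using t(1) unfolding closed_segment_def by auto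
  moreover have "f \<xi> - f \<eta> = (\<Sum>j\<in>UNIV. (\<xi> $ j - \<eta> $ j) * partial j f (\<gamma> t))"
    using t(2) frechet_derivative_partials[OF d] by (simp add: \<gamma>_def)
  ultimately show ?thesis by (rule that)
qed

text \<open>Convexity keeps the intermediate point of the mean value theorem in E. There a(\<xi>) -
  a(\<eta>) = x_i p_i + r with |p_i| \<ge> c and r controlled by the other coordinates of \<xi> -
  \<eta>, so x_i is controlled by the difference of a together with these coordinates.\<close>

lemma transversal_convex:
  fixes a :: "real^'n \<Rightarrow> real"
  assumes d: "\<And>z. a differentiable (at z)" and E: "convex E" and c: "c > 0"
    and lo: "\<And>\<xi>. \<xi> \<in> E \<Longrightarrow> \<bar>partial i a \<xi>\<bar> \<ge> c" and M: "\<And>j \<xi>. \<bar>partial j a \<xi>\<bar> \<le> M"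
  shows "transversal a E"
proof -
  define L where "L = real CARD('n) * M\<^sup>2"
  have L0: "L \<ge> 0" unfolding L_def by simp
  \<comment> \<open>K dominates both coefficients that arise: 2 at the squared difference of a, and
    2L + c^2 at the squares of the other coordinates.\<close>
  define K where "K = 2 * L + c\<^sup>2 + 2"
  have K: "K > 0" unfolding K_def using L0 by (simp add: add_nonneg_pos)
  have "(c / sqrt K)\<^sup>2 * (norm (\<xi> - \<eta>))\<^sup>2 \<le> (a \<xi> - a \<eta>)\<^sup>2 + (\<Sum>j\<in>-{i}. (\<xi> $ j - \<eta> $ j)\<^sup>2)"
    if \<xi>: "\<xi> \<in> E" and \<eta>: "\<eta> \<in> E" for \<xi> \<eta>
  proof -
    define x where "x j = \<xi> $ j - \<eta> $ j" for j
    define y where "y = (\<Sum>j\<in>-{i}. (x j)\<^sup>2)"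
    have y0: "y \<ge> 0" unfolding y_def by (simp add: sum_nonneg)
    obtain z where z: "z \<in> closed_segment \<eta> \<xi>" "a \<xi> - a \<eta> = (\<Sum>j\<in>UNIV. x j * partial j a z)"
      unfolding x_def using mvt_partials[OF d] by blast
    define p where "p j = partial j a z" for j
    have zE: "z \<in> E" using z(1) closed_segment_subset[OF \<eta> \<xi> E] by blast
    define r where "r = (\<Sum>j\<in>-{i}. x j * p j)"
    have D: "a \<xi> - a \<eta> = x i * p i + r"
      unfolding z(2) r_def p_def by (subst sum.remove[OF finite UNIV_I[of i]]) (simp add: Compl_eq_Diff_UNIV)
    have r2: "r\<^sup>2 \<le> L * y"
    proof -
      have "r\<^sup>2 \<le> y * (\<Sum>j\<in>-{i}. (p j)\<^sup>2)" unfolding r_def y_def by (rule Cauchy_Schwarz_ineq_sum)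
      also have "\<dots> \<le> y * (\<Sum>j\<in>(UNIV::'n set). M\<^sup>2)"
      proof (rule mult_left_mono[OF _ y0])
        have "(\<Sum>j\<in>-{i}. (p j)\<^sup>2) \<le> (\<Sum>j\<in>(UNIV::'n set). (p j)\<^sup>2)" by (intro sum_mono2) auto
        also have "\<dots> \<le> (\<Sum>j\<in>(UNIV::'n set). M\<^sup>2)"
          unfolding p_def by (intro sum_mono abs_le_square_iff[THEN iffD1] order.trans[OF M abs_ge_self])
        finally show "(\<Sum>j\<in>-{i}. (p j)\<^sup>2) \<le> (\<Sum>j\<in>(UNIV::'n set). M\<^sup>2)" .
      qed
      finally show ?thesis by (simp add: L_def mult.commute)
    qed
    have "c\<^sup>2 \<le> (p i)\<^sup>2" using lo[OF zE] c unfolding p_def by (intro abs_le_square_iff[THEN iffD1]) auto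
    then have "(x i)\<^sup>2 * c\<^sup>2 \<le> (x i)\<^sup>2 * (p i)\<^sup>2" by (rule mult_left_mono) simp
    also have "\<dots> = (norm ((a \<xi> - a \<eta>) + (- r)))\<^sup>2" unfolding D by (simp add: power_mult_distrib)
    also have "\<dots> \<le> 2 * (norm (a \<xi> - a \<eta>))\<^sup>2 + 2 * (norm (- r))\<^sup>2" by (rule norm_add_square_le)
    also have "\<dots> \<le> 2 * (a \<xi> - a \<eta>)\<^sup>2 + 2 * (L * y)" using r2 by simp
    finally have A: "(x i)\<^sup>2 * c\<^sup>2 \<le> 2 * (a \<xi> - a \<eta>)\<^sup>2 + 2 * (L * y)" .
    have N: "(norm (\<xi> - \<eta>))\<^sup>2 = (x i)\<^sup>2 + y"
      unfolding norm_sq_vec y_def x_def by (subst sum.remove[OF finite UNIV_I[of i]]) (simp add: Compl_eq_Diff_UNIV)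
    have "c\<^sup>2 * (norm (\<xi> - \<eta>))\<^sup>2 = (x i)\<^sup>2 * c\<^sup>2 + c\<^sup>2 * y" unfolding N by (simp add: algebra_simps)
    also have "\<dots> \<le> 2 * (a \<xi> - a \<eta>)\<^sup>2 + 2 * (L * y) + c\<^sup>2 * y" using A by simp
    also have "\<dots> \<le> K * ((a \<xi> - a \<eta>)\<^sup>2 + y)"
    proof -
      have "K * ((a \<xi> - a \<eta>)\<^sup>2 + y) - (2 * (a \<xi> - a \<eta>)\<^sup>2 + 2 * (L * y) + c\<^sup>2 * y) = (2 * L + c\<^sup>2) * (a \<xi> - a \<eta>)\<^sup>2 + 2 * y"
        unfolding K_def by (simp add: algebra_simps)
      also have "\<dots> \<ge> 0" using L0 y0 by simp
      finally show ?thesis by simp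
    qed
    finally have "c\<^sup>2 * (norm (\<xi> - \<eta>))\<^sup>2 / K \<le> (a \<xi> - a \<eta>)\<^sup>2 + y" using K by (simp add: field_simps)
    then show ?thesis using K unfolding y_def x_def by (simp add: power_divide)
  qed
  moreover have "c / sqrt K > 0" using c K by simp
  ultimately show ?thesis unfolding transversal_def by blast
qed

text \<open>Compactness is used twice: on the unit sphere of directions, to cover a neighbourhood of
  infinity by finitely many truncated cones, and on the closed ball that remains.\<close>

lemma finite_conic_cover:
  fixes P :: "(real^'n) set \<Rightarrow> bool"
  assumes loc: "\<And>\<xi>. \<exists>r>0. P (ball \<xi> r)"
    and inf: "\<And>\<omega>. norm \<omega> = 1 \<Longrightarrow> \<exists>\<delta> R. \<delta> > 0 \<and> P {\<xi>. \<xi> \<bullet> \<omega> > R \<and> norm (\<xi> - (\<xi> \<bullet> \<omega>) *\<^sub>R \<omega>) < \<delta> * (\<xi> \<bullet> \<omega>)}"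
  shows "\<exists>F. finite F \<and> \<Union>F = UNIV \<and> (\<forall>E\<in>F. P E)"
proof -
  obtain r where "\<forall>\<xi>. r \<xi> > 0 \<and> P (ball \<xi> (r \<xi>))"
    using choice[of "\<lambda>\<xi> r. r > 0 \<and> P (ball \<xi> r)"] loc by blast
  then have r: "\<And>\<xi>. r \<xi> > 0" "\<And>\<xi>. P (ball \<xi> (r \<xi>))" by auto
  \<comment> \<open>The pair p encodes aperture and truncation, so a single choice function provides
    both.\<close>
  define C where "C \<omega> p = {\<xi>. \<xi> \<bullet> \<omega> > snd p \<and> norm (\<xi> - (\<xi> \<bullet> \<omega>) *\<^sub>R \<omega>) < fst p * (\<xi> \<bullet> \<omega>)}" for \<omega> :: "real^'n" and p :: "real \<times> real"
  have "\<forall>\<omega>\<in>sphere 0 1. \<exists>p. fst p > 0 \<and> P (C \<omega> p)"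
  proof
    fix \<omega> :: "real^'n" assume "\<omega> \<in> sphere 0 1"
    then obtain d R where "d > 0" "P {\<xi>. \<xi> \<bullet> \<omega> > R \<and> norm (\<xi> - (\<xi> \<bullet> \<omega>) *\<^sub>R \<omega>) < d * (\<xi> \<bullet> \<omega>)}"
      using inf[of \<omega>] by auto
    then show "\<exists>p. fst p > 0 \<and> P (C \<omega> p)" by (intro exI[of _ "(d, R)"]) (simp add: C_def)
  qed
  from bchoice[OF this] obtain f where f: "\<forall>\<omega>\<in>sphere 0 1. fst (f \<omega>) > 0 \<and> P (C \<omega> (f \<omega>))" by blast
  define \<delta> where "\<delta> \<omega> = fst (f \<omega>)" for \<omega>
  define R where "R \<omega> = snd (f \<omega>)" for \<omega>
  define S where "S \<omega> = C \<omega> (f \<omega>)" for \<omega>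
  have \<delta>: "\<delta> \<omega> > 0" if "norm \<omega> = 1" for \<omega> using f that by (simp add: \<delta>_def)
  have PS: "P (S \<omega>)" if "norm \<omega> = 1" for \<omega> using f that by (simp add: S_def)
  have S_def: "S \<omega> = {\<xi>. \<xi> \<bullet> \<omega> > R \<omega> \<and> norm (\<xi> - (\<xi> \<bullet> \<omega>) *\<^sub>R \<omega>) < \<delta> \<omega> * (\<xi> \<bullet> \<omega>)}" for \<omega>
    unfolding S_def C_def R_def \<delta>_def ..
  \<comment> \<open>The extra condition \<theta> \<bullet> \<omega> > 1/2 turns size into height
    over \<omega>: if |\<xi>| > 2 R1, then \<xi> \<bullet> \<omega> exceeds R1 and hence every
    truncation level R.\<close>
  define U where "U \<omega> = {\<theta>. \<theta> \<bullet> \<omega> > 1/2 \<and> norm (\<theta> - (\<theta> \<bullet> \<omega>) *\<^sub>R \<omega>) < \<delta> \<omega> * (\<theta> \<bullet> \<omega>)}" for \<omega>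
  have U_open: "open (U \<omega>)" for \<omega>
    unfolding U_def by (intro open_Collect_conj open_Collect_less continuous_intros)
  have U_in: "\<omega> \<in> U \<omega>" if "norm \<omega> = 1" for \<omega>
    using that \<delta>[OF that] by (simp add: U_def power2_norm_eq_inner[symmetric])
  have "compact (sphere (0::real^'n) 1)" by simp
  moreover have "sphere (0::real^'n) 1 \<subseteq> (\<Union>\<omega>\<in>sphere 0 1. U \<omega>)" using U_in by auto
  ultimately obtain T where T: "T \<subseteq> sphere 0 1" "finite T" "sphere (0::real^'n) 1 \<subseteq> (\<Union>\<omega>\<in>T. U \<omega>)"
    using U_open by (elim compactE_image) auto
  define R1 where "R1 = Max (insert 0 (R ` T))"
  have R1: "0 \<le> R1" "\<And>\<omega>. \<omega> \<in> T \<Longrightarrow> R \<omega> \<le> R1" unfolding R1_def using T(2) by auto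
  have far: "\<xi> \<in> (\<Union>\<omega>\<in>T. S \<omega>)" if "norm \<xi> > 2 * R1" for \<xi>
  proof -
    have n: "norm \<xi> > 0" using that R1(1) by linarith
    define \<theta> where "\<theta> = \<xi> /\<^sub>R norm \<xi>"
    have "norm \<theta> = 1" using n by (simp add: \<theta>_def)
    then obtain \<omega> where \<omega>: "\<omega> \<in> T" "\<theta> \<in> U \<omega>" using T(3) by auto
    have \<xi>: "\<xi> = norm \<xi> *\<^sub>R \<theta>" using n by (simp add: \<theta>_def)
    have in1: "\<xi> \<bullet> \<omega> = norm \<xi> * (\<theta> \<bullet> \<omega>)" by (subst \<xi>) simp
    have "norm \<xi> * (1 / 2) < norm \<xi> * (\<theta> \<bullet> \<omega>)" using \<omega>(2) n by (intro mult_strict_left_mono) (auto simp: U_def)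
    then have "\<xi> \<bullet> \<omega> > R \<omega>" using in1 that R1(2)[OF \<omega>(1)] by linarith
    moreover have "norm (\<xi> - (\<xi> \<bullet> \<omega>) *\<^sub>R \<omega>) < \<delta> \<omega> * (\<xi> \<bullet> \<omega>)"
    proof -
      have "\<xi> - (\<xi> \<bullet> \<omega>) *\<^sub>R \<omega> = norm \<xi> *\<^sub>R (\<theta> - (\<theta> \<bullet> \<omega>) *\<^sub>R \<omega>)"
        unfolding in1 using \<xi> by (simp add: scaleR_diff_right)
      then have "norm (\<xi> - (\<xi> \<bullet> \<omega>) *\<^sub>R \<omega>) = norm \<xi> * norm (\<theta> - (\<theta> \<bullet> \<omega>) *\<^sub>R \<omega>)" by simp
      also have "\<dots> < norm \<xi> * (\<delta> \<omega> * (\<theta> \<bullet> \<omega>))" using \<omega>(2) n by (intro mult_strict_left_mono) (auto simp: U_def)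
      finally show ?thesis unfolding in1 by (simp add: mult_ac)
    qed
    ultimately show ?thesis using \<omega>(1) by (auto simp: S_def)
  qed
  have "compact (cball (0::real^'n) (2 * R1))" by simp
  moreover have "cball (0::real^'n) (2 * R1) \<subseteq> (\<Union>\<xi>\<in>cball 0 (2 * R1). ball \<xi> (r \<xi>))" using r(1) by auto
  ultimately obtain T' where T': "finite T'" "cball (0::real^'n) (2 * R1) \<subseteq> (\<Union>\<xi>\<in>T'. ball \<xi> (r \<xi>))"
    by (elim compactE_image) auto
  let ?F = "S ` T \<union> (\<lambda>\<xi>. ball \<xi> (r \<xi>)) ` T'"
  have "finite ?F" using T T' by simp
  moreover have "\<Union>?F = UNIV"
  proof -
    have "\<xi> \<in> \<Union>?F" for \<xi>
    proof (cases "norm \<xi> > 2 * R1")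
      case True then show ?thesis using far by blast
    next
      case False then have "\<xi> \<in> cball 0 (2 * R1)" by simp
      then obtain \<zeta> where "\<zeta> \<in> T'" "\<xi> \<in> ball \<zeta> (r \<zeta>)" using T'(2) by (meson UN_E subsetD)
      then show ?thesis by (intro UnionI[of "ball \<zeta> (r \<zeta>)"]) auto
    qed
    then show ?thesis by blast
  qed
  moreover have "\<forall>E\<in>?F. P E" using PS r(2) T(1) by auto
  ultimately show ?thesis by blast
qed

text \<open>A half-space intersected with the set where a seminorm is smaller than a linear
  form.\<close>

lemma convex_cone_piece: "convex {\<xi>::real^'n. \<xi> \<bullet> \<omega> > R \<and> norm (\<xi> - (\<xi> \<bullet> \<omega>) *\<^sub>R \<omega>) < \<delta> * (\<xi> \<bullet> \<omega>)}"
proof (rule convexI, clarsimp, intro conjI)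
  fix x y :: "real^'n" and u v :: real
  assume x: "R < x \<bullet> \<omega>" "norm (x - (x \<bullet> \<omega>) *\<^sub>R \<omega>) < \<delta> * (x \<bullet> \<omega>)"
    and y: "R < y \<bullet> \<omega>" "norm (y - (y \<bullet> \<omega>) *\<^sub>R \<omega>) < \<delta> * (y \<bullet> \<omega>)"
    and uv: "0 \<le> u" "0 \<le> v" "u + v = 1"
  \<comment> \<open>One of u and v may vanish; as they add up to 1, strictness survives in the other
    term.\<close>
  have comb: "u * p + v * q < u * p' + v * q'" if "p < p'" "q < q'" for p q p' q' :: real
  proof (cases "u = 0")
    case True then show ?thesis using uv that by simp
  next
    case False
    then have "u * p < u * p'" using uv that by simp
    moreover have "v * q \<le> v * q'" using uv that by (intro mult_left_mono) auto
    ultimately show ?thesis by linarith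
  qed
  have "R = u * R + v * R" using uv(3) by (metis distrib_right mult_1)
  then show "R < (u *\<^sub>R x + v *\<^sub>R y) \<bullet> \<omega>" using comb[OF x(1) y(1)] by (simp add: inner_add_left)
  have "(u *\<^sub>R x + v *\<^sub>R y) - ((u *\<^sub>R x + v *\<^sub>R y) \<bullet> \<omega>) *\<^sub>R \<omega> = u *\<^sub>R (x - (x \<bullet> \<omega>) *\<^sub>R \<omega>) + v *\<^sub>R (y - (y \<bullet> \<omega>) *\<^sub>R \<omega>)"
    by (simp add: inner_add_left algebra_simps)
  then have "norm ((u *\<^sub>R x + v *\<^sub>R y) - ((u *\<^sub>R x + v *\<^sub>R y) \<bullet> \<omega>) *\<^sub>R \<omega>) \<le> u * norm (x - (x \<bullet> \<omega>) *\<^sub>R \<omega>) + v * norm (y - (y \<bullet> \<omega>) *\<^sub>R \<omega>)"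
    using norm_triangle_ineq[of "u *\<^sub>R (x - (x \<bullet> \<omega>) *\<^sub>R \<omega>)" "v *\<^sub>R (y - (y \<bullet> \<omega>) *\<^sub>R \<omega>)"] uv by simp
  also have "\<dots> < u * (\<delta> * (x \<bullet> \<omega>)) + v * (\<delta> * (y \<bullet> \<omega>))" by (rule comb[OF x(2) y(2)])
  finally show "norm ((u *\<^sub>R x + v *\<^sub>R y) - ((u *\<^sub>R x + v *\<^sub>R y) \<bullet> \<omega>) *\<^sub>R \<omega>) < \<delta> * ((u *\<^sub>R x + v *\<^sub>R y) \<bullet> \<omega>)"
    by (simp add: inner_add_left algebra_simps)
qed

section \<open>Homogeneous functions and their derivatives\<close>

lemma partial_homogeneous:
  fixes f :: "real^'n \<Rightarrow> real"
  assumes d: "\<And>\<xi>. \<xi> \<noteq> 0 \<Longrightarrow> f differentiable (at \<xi>)"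
    and h: "\<And>r \<xi>. r > 0 \<Longrightarrow> \<xi> \<noteq> 0 \<Longrightarrow> f (r *\<^sub>R \<xi>) = r powr m * f \<xi>"
    and r: "r > 0" and \<xi>: "\<xi> \<noteq> 0"
  shows "partial i f (r *\<^sub>R \<xi>) = r powr (m - 1) * partial i f \<xi>"
proof -
  have fd: "(f has_derivative frechet_derivative f (at z)) (at z)" if "z \<noteq> 0" for z
    using d[OF that] by (simp add: frechet_derivative_works)
  have z: "r *\<^sub>R \<xi> \<noteq> 0" using r \<xi> by simp
  have "((\<lambda>\<xi>. r *\<^sub>R \<xi>) has_derivative (\<lambda>h. r *\<^sub>R h)) (at \<xi>)" by (auto intro!: derivative_eq_intros)
  from has_derivative_compose[OF this fd[OF z]]
  have "partial i (\<lambda>y. f (r *\<^sub>R y)) \<xi> = frechet_derivative f (at (r *\<^sub>R \<xi>)) (r *\<^sub>R axis i 1)"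
    by (rule partial_eqI)
  also have "\<dots> = r * partial i f (r *\<^sub>R \<xi>)"
    using linear_cmul[OF linear_frechet_derivative[OF d[OF z]]] by (simp add: partial_def)
  finally have 1: "partial i (\<lambda>y. f (r *\<^sub>R y)) \<xi> = r * partial i f (r *\<^sub>R \<xi>)" .
  have "partial i (\<lambda>y. f (r *\<^sub>R y)) \<xi> = partial i (\<lambda>y. r powr m * f y) \<xi>"
    by (rule partial_cong_open[of "- {0}"]) (use \<xi> h r in auto)
  also have "\<dots> = r powr m * partial i f \<xi>"
    by (rule partial_bounded_linear[OF bounded_linear_mult_right d[OF \<xi>]])
  finally have "r * partial i f (r *\<^sub>R \<xi>) = r powr m * partial i f \<xi>" using 1 by simp
  then show ?thesis using r by (simp add: powr_diff field_simps)
qed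

text \<open>Each derivative lowers the degree by one. The exponent is a real \<open>powr\<close>
  because 1 - |\<alpha>| becomes negative.\<close>

lemma partials_homogeneous:
  fixes f :: "real^'n \<Rightarrow> real"
  assumes d: "smooth_on (- {0}) f" and h: "homogeneous_order_one f" and "r > 0" "\<xi> \<noteq> 0"
  shows "partials \<alpha> f (r *\<^sub>R \<xi>) = r powr (1 - real (length \<alpha>)) * partials \<alpha> f \<xi>"
  using assms(3,4)
proof (induction \<alpha> arbitrary: r \<xi>)
  case Nil
  then show ?case using h unfolding homogeneous_order_one_def by simp
next
  case (Cons i \<alpha>)
  have "partial i (partials \<alpha> f) (r *\<^sub>R \<xi>) = r powr ((1 - real (length \<alpha>)) - 1) * partial i (partials \<alpha> f) \<xi>"
    by (rule partial_homogeneous) (use d Cons in \<open>auto simp: smooth_on_def\<close>)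
  then show ?case by simp
qed

text \<open>For a nonempty multi-index the degree 1 - |\<alpha>| is at most 0, so a bound on the
  unit sphere persists outwards. This is where order one matters: the gradient of a symbol of higher
  order would grow.\<close>

lemma partials_homogeneous_bounded:
  fixes f :: "real^'n \<Rightarrow> real"
  assumes d: "smooth_on (- {0}) f" and h: "homogeneous_order_one f" and "\<alpha> \<noteq> []"
  shows "\<exists>C. \<forall>\<xi>. norm \<xi> \<ge> 1 \<longrightarrow> \<bar>partials \<alpha> f \<xi>\<bar> \<le> C"
proof -
  have "continuous_on (sphere 0 1) (partials \<alpha> f)"
  proof (intro continuous_at_imp_continuous_on ballI differentiable_imp_continuous_within)
    fix x :: "real^'n" assume "x \<in> sphere 0 1"
    then have "x \<in> - {0}" by auto
    then show "partials \<alpha> f differentiable (at x)" using d unfolding smooth_on_def by blast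
  qed
  then have "bounded (partials \<alpha> f ` sphere 0 1)"
    by (intro compact_imp_bounded compact_continuous_image) simp_all
  then obtain C where C: "\<forall>y\<in>partials \<alpha> f ` sphere 0 1. norm y \<le> C" unfolding bounded_iff by blast
  have "\<bar>partials \<alpha> f \<xi>\<bar> \<le> C" if "norm \<xi> \<ge> 1" for \<xi>
  proof -
    define \<theta> where "\<theta> = \<xi> /\<^sub>R norm \<xi>"
    have n: "norm \<xi> \<noteq> 0" using that by auto
    have \<xi>: "\<xi> = norm \<xi> *\<^sub>R \<theta>" and \<theta>: "\<theta> \<in> sphere 0 1" using n by (simp_all add: \<theta>_def)
    have "length \<alpha> \<ge> 1" using assms(3) by (cases \<alpha>) auto
    then have p: "norm \<xi> powr (1 - real (length \<alpha>)) \<le> norm \<xi> powr 0" using that by (intro powr_mono) auto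
    have "partials \<alpha> f \<xi> = norm \<xi> powr (1 - real (length \<alpha>)) * partials \<alpha> f \<theta>"
      by (subst \<xi>, rule partials_homogeneous[OF d h]) (use that \<theta> in auto)
    then have "\<bar>partials \<alpha> f \<xi>\<bar> = norm \<xi> powr (1 - real (length \<alpha>)) * \<bar>partials \<alpha> f \<theta>\<bar>" by (simp add: abs_mult)
    also have "\<dots> \<le> 1 * \<bar>partials \<alpha> f \<theta>\<bar>" using p n by (intro mult_right_mono) auto
    also have "\<dots> \<le> C" using C \<theta> by force
    finally show ?thesis .
  qed
  then show ?thesis by blast
qed

lemma partials_add_open:
  fixes f g h :: "real^'n \<Rightarrow> real"
  assumes S: "open S" "smooth_on S f" "smooth_on S g" and eq: "\<And>x. x \<in> S \<Longrightarrow> h x = f x + g x" and x: "x \<in> S"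
  shows "partials \<alpha> h x = partials \<alpha> f x + partials \<alpha> g x"
  using x
proof (induction \<alpha> arbitrary: x)
  case Nil then show ?case using eq by simp
next
  case (Cons i \<alpha>)
  have "partial i (partials \<alpha> h) x = partial i (\<lambda>y. partials \<alpha> f y + partials \<alpha> g y) x"
    by (rule partial_cong_open[OF S(1) Cons.prems Cons.IH])
  also have "\<dots> = partial i (partials \<alpha> f) x + partial i (partials \<alpha> g) x"
    by (rule partial_add) (use S Cons.prems in \<open>auto simp: smooth_on_def\<close>)
  finally show ?case by simp
qed

lemma japanese_powr_le: "\<langle>\<xi>\<rangle> powr (- real m) \<le> 1"
  using powr_mono[of "- real m" 0 "\<langle>\<xi>\<rangle>"] japanese_ge_1[of \<xi>] by simp

locale dispersive_symbol =
  fixes a a1 a0 :: "real ^ 'n \<Rightarrow> real"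
  assumes a_smooth: "smooth_on UNIV a"
    and a_grad: "\<And>\<xi>. grad a \<xi> \<noteq> 0"
    and a1_smooth: "smooth_on (- {0}) a1"
    and a1_hom: "homogeneous_order_one a1"
    and a1_grad: "\<And>\<xi>. \<xi> \<noteq> 0 \<Longrightarrow> grad a1 \<xi> \<noteq> 0"
    and a0_symbol: "symbol_order_zero a0"
    and a_eq: "\<forall>\<^sub>F \<xi> in at_infinity. a \<xi> = a1 \<xi> + a0 \<xi>"
begin

section \<open>Bounds for the symbol and its derivatives\<close>

lemma a_diff: "partials \<alpha> a differentiable (at \<xi>)"
  using a_smooth unfolding smooth_on_def by simp

lemma partials_a_cont: "continuous_on A (partials \<alpha> a)"
  by (intro continuous_at_imp_continuous_on ballI differentiable_imp_continuous_within a_diff)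

lemma a_eq_far: "\<exists>R>0. \<forall>\<alpha> \<xi>. norm \<xi> > R \<longrightarrow> partials \<alpha> a \<xi> = partials \<alpha> a1 \<xi> + partials \<alpha> a0 \<xi>"
proof -
  obtain R where R: "\<And>\<xi>. norm \<xi> \<ge> R \<Longrightarrow> a \<xi> = a1 \<xi> + a0 \<xi>" using a_eq unfolding eventually_at_infinity by blast
  \<comment> \<open>The maximum with 1 keeps the set away from the origin, where a1 need not be
    smooth; the strict inequality makes it open, so that the equation can be differentiated.\<close>
  have "partials \<alpha> a \<xi> = partials \<alpha> a1 \<xi> + partials \<alpha> a0 \<xi>" if "norm \<xi> > max R 1" for \<alpha> \<xi>
  proof (rule partials_add_open[of "{\<xi>. norm \<xi> > max R 1}"])
    show "open {\<xi>::real^'n. norm \<xi> > max R 1}" by (intro open_Collect_less continuous_intros)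
    have "{\<xi>::real^'n. norm \<xi> > max R 1} \<subseteq> - {0}" by auto
    then show "smooth_on {\<xi>. norm \<xi> > max R 1} a1" using a1_smooth unfolding smooth_on_def by blast
    show "smooth_on {\<xi>. norm \<xi> > max R 1} a0"
      using a0_symbol unfolding smooth_on_def symbol_order_zero_def by blast
  qed (use that R in auto)
  then show ?thesis by (intro exI[of _ "max R 1"]) auto
qed

lemma a0_bound: "\<exists>C>0. \<forall>\<xi>. \<bar>partials \<alpha> a0 \<xi>\<bar> \<le> C * \<langle>\<xi>\<rangle> powr (- real (length \<alpha>))"
  using a0_symbol unfolding symbol_order_zero_def by blast

text \<open>Far out, a1 contributes a term of degree at most 0 and a0 a bounded one; the remaining
  ball is compact. The empty multi-index is excluded because a itself may grow.\<close>

lemma partials_a_bounded: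
  assumes "\<alpha> \<noteq> []" shows "bdd_fun (partials \<alpha> a)"
proof -
  obtain R where R: "R > 0" "\<And>\<alpha> \<xi>. norm \<xi> > R \<Longrightarrow> partials \<alpha> a \<xi> = partials \<alpha> a1 \<xi> + partials \<alpha> a0 \<xi>"
    using a_eq_far by blast
  obtain C1 where C1: "\<And>\<xi>. norm \<xi> \<ge> 1 \<Longrightarrow> \<bar>partials \<alpha> a1 \<xi>\<bar> \<le> C1"
    using partials_homogeneous_bounded[OF a1_smooth a1_hom assms] by blast
  obtain C0 where C0: "C0 > 0" "\<And>\<xi>. \<bar>partials \<alpha> a0 \<xi>\<bar> \<le> C0 * \<langle>\<xi>\<rangle> powr (- real (length \<alpha>))"
    using a0_bound by blast
  have "bounded (partials \<alpha> a ` cball 0 (R + 1))"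
    by (intro compact_imp_bounded compact_continuous_image partials_a_cont) simp
  then obtain C where C: "\<forall>y\<in>partials \<alpha> a ` cball 0 (R + 1). norm y \<le> C" unfolding bounded_iff by blast
  have "norm (partials \<alpha> a \<xi>) \<le> max C (C1 + C0)" for \<xi>
  proof (cases "norm \<xi> \<le> R + 1")
    case True
    then have "norm (partials \<alpha> a \<xi>) \<le> C" using C by force
    then show ?thesis by simp
  next
    case False
    have "C0 * \<langle>\<xi>\<rangle> powr (- real (length \<alpha>)) \<le> C0 * 1" by (intro mult_left_mono japanese_powr_le) (use C0 in simp)
    then have "\<bar>partials \<alpha> a0 \<xi>\<bar> \<le> C0" using C0(2)[of \<xi>] by linarith
    moreover have "\<bar>partials \<alpha> a1 \<xi>\<bar> \<le> C1" using False R(1) by (intro C1) simp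
    ultimately have "norm (partials \<alpha> a \<xi>) \<le> C1 + C0" using R(2)[of \<xi> \<alpha>] False by auto
    then show ?thesis by simp
  qed
  then show ?thesis unfolding bdd_fun_def by blast
qed

lemma tame_partial_a: "smooth_with bdd_fun (partial i a)"
proof -
  have "partials \<beta> (partial i a) = partials (\<beta> @ [i]) a" for \<beta> by (simp add: partials_append)
  then show ?thesis unfolding smooth_with_def using a_diff partials_a_bounded by simp
qed

text \<open>Linear growth of a follows from its bounded gradient by the mean value theorem; the
  derivatives are even bounded.\<close>

lemma a_slow: "smooth_with poly_fun a"
proof -
  have d: "a differentiable (at z)" for z using a_diff[of "[]"] by simp
  have "\<exists>M. \<forall>\<xi>. \<bar>partial j a \<xi>\<bar> \<le> M" for j
    using smooth_withD(2)[OF tame_partial_a[of j]] by (auto simp: bdd_fun_def)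
  then obtain M where M: "\<And>j \<xi>. \<bar>partial j a \<xi>\<bar> \<le> M j" by metis
  define C where "C = \<bar>a 0\<bar> + (\<Sum>j\<in>UNIV. M j)"
  have "norm (a \<xi>) \<le> C * \<langle>\<xi>\<rangle> ^ 1" for \<xi>
  proof -
    obtain z where z: "a \<xi> - a 0 = (\<Sum>j\<in>UNIV. (\<xi> $ j - 0 $ j) * partial j a z)" using mvt_partials[OF d, of 0 \<xi>] by auto
    have "\<bar>\<Sum>j\<in>UNIV. (\<xi> $ j - 0 $ j) * partial j a z\<bar> \<le> (\<Sum>j\<in>UNIV. \<langle>\<xi>\<rangle> * M j)"
    proof (rule order.trans[OF sum_abs sum_mono])
      fix j
      have "\<bar>\<xi> $ j\<bar> \<le> \<langle>\<xi>\<rangle>" using component_le_norm_cart[of \<xi> j] japanese_ge_norm[of \<xi>] by linarith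
      then show "\<bar>(\<xi> $ j - 0 $ j) * partial j a z\<bar> \<le> \<langle>\<xi>\<rangle> * M j"
        unfolding abs_mult using M[of j z] japanese_nonneg[of \<xi>] by (intro mult_mono) auto
    qed
    moreover have "\<bar>a 0\<bar> \<le> \<bar>a 0\<bar> * \<langle>\<xi>\<rangle>" using mult_left_mono[OF japanese_ge_1[of \<xi>], of "\<bar>a 0\<bar>"] by simp
    moreover have "(\<Sum>j\<in>UNIV. \<langle>\<xi>\<rangle> * M j) = (\<Sum>j\<in>UNIV. M j) * \<langle>\<xi>\<rangle>" by (simp add: sum_distrib_left[symmetric] mult.commute)
    moreover have "C * \<langle>\<xi>\<rangle> ^ 1 = \<bar>a 0\<bar> * \<langle>\<xi>\<rangle> + (\<Sum>j\<in>UNIV. M j) * \<langle>\<xi>\<rangle>" by (simp add: C_def distrib_right)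
    ultimately show ?thesis using z unfolding real_norm_def by linarith
  qed
  then have p: "poly_fun a" unfolding poly_fun_def by blast
  show ?thesis unfolding smooth_with_def
  proof (intro allI conjI)
    show "poly_fun (partials \<alpha> a)" for \<alpha>
      by (cases "\<alpha> = []") (simp add: p, intro poly_fun_bdd_fun partials_a_bounded)
  qed (rule a_diff)
qed

section \<open>Lower bounds for the gradient\<close>

lemma partial_near_nonzero:
  "\<exists>r>0. \<exists>i c. c > 0 \<and> (\<forall>\<xi>\<in>ball \<xi>0 r. \<bar>partial i a \<xi>\<bar> \<ge> c)"
proof -
  obtain i where i: "partial i a \<xi>0 \<noteq> 0" using a_grad[of \<xi>0] by (auto simp: grad_def vec_eq_iff)
  define c where "c = \<bar>partial i a \<xi>0\<bar> / 2"
  have c: "c > 0" using i by (simp add: c_def)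
  have "isCont (partial i a) \<xi>0" using partials_a_cont[of UNIV "[i]"] by (simp add: continuous_on_eq_continuous_at)
  then obtain r where r: "r > 0" "\<And>\<xi>. dist \<xi> \<xi>0 < r \<Longrightarrow> dist (partial i a \<xi>) (partial i a \<xi>0) < c"
    using c unfolding continuous_at_eps_delta by blast
  have "\<bar>partial i a \<xi>\<bar> \<ge> c" if "\<xi> \<in> ball \<xi>0 r" for \<xi>
  proof -
    have "dist (partial i a \<xi>) (partial i a \<xi>0) < c" using that by (intro r(2)) (simp add: dist_commute)
    then show ?thesis unfolding c_def dist_real_def by linarith
  qed
  then show ?thesis using r(1) c by blast
qed

text \<open>The partial derivatives of a1 are homogeneous of degree 0, so a lower bound near
  \<omega> extends to a cone around it, while those of a0 decay like 1/\<langle>\<xi>\<rangle> and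
  become negligible beyond some height R.\<close>

lemma partial_cone_nonzero:
  assumes \<omega>: "norm \<omega> = 1"
  shows "\<exists>\<delta> R. \<delta> > 0 \<and> (\<exists>i c. c > 0 \<and>
    (\<forall>\<xi>. \<xi> \<bullet> \<omega> > R \<and> norm (\<xi> - (\<xi> \<bullet> \<omega>) *\<^sub>R \<omega>) < \<delta> * (\<xi> \<bullet> \<omega>) \<longrightarrow> \<bar>partial i a \<xi>\<bar> \<ge> c))"
proof -
  have \<omega>0: "\<omega> \<noteq> 0" using \<omega> by auto
  obtain i where i: "partial i a1 \<omega> \<noteq> 0" using a1_grad[OF \<omega>0] by (auto simp: grad_def vec_eq_iff)
  \<comment> \<open>Of |\<partial>_i a1(\<omega>)| = 4c, one c is lost by moving away from \<omega>
    and another to a0, which leaves more than the required c.\<close>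
  define c where "c = \<bar>partial i a1 \<omega>\<bar> / 4"
  have c: "c > 0" using i by (simp add: c_def)
  have "partials [i] a1 differentiable (at \<omega>)" using a1_smooth \<omega>0 unfolding smooth_on_def by blast
  then have "isCont (partial i a1) \<omega>" using differentiable_imp_continuous_within by auto
  then obtain r where r: "r > 0" "\<And>\<xi>. dist \<xi> \<omega> < r \<Longrightarrow> dist (partial i a1 \<xi>) (partial i a1 \<omega>) < c"
    using c unfolding continuous_at_eps_delta by blast
  obtain R0 where R0: "R0 > 0" "\<And>\<alpha> \<xi>. norm \<xi> > R0 \<Longrightarrow> partials \<alpha> a \<xi> = partials \<alpha> a1 \<xi> + partials \<alpha> a0 \<xi>"
    using a_eq_far by blast
  obtain C0 where C0: "C0 > 0" "\<And>\<xi>. \<bar>partials [i] a0 \<xi>\<bar> \<le> C0 * \<langle>\<xi>\<rangle> powr (- real (length [i]))"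
    using a0_bound by blast
  \<comment> \<open>Beyond \<open>R0\<close> the decomposition of a holds, and beyond C0 / c the
    derivative of a0 is at most c.\<close>
  define R where "R = max R0 (C0 / c)"
  have "\<bar>partial i a \<xi>\<bar> \<ge> c" if \<xi>: "\<xi> \<bullet> \<omega> > R" "norm (\<xi> - (\<xi> \<bullet> \<omega>) *\<^sub>R \<omega>) < r * (\<xi> \<bullet> \<omega>)" for \<xi>
  proof -
    define \<rho> where "\<rho> = \<xi> \<bullet> \<omega>"
    have \<rho>: "\<rho> > R0" "\<rho> > C0 / c" "\<rho> > 0" using \<xi>(1) R0(1) by (auto simp: \<rho>_def R_def)
    have n\<xi>: "norm \<xi> \<ge> \<rho>" using Cauchy_Schwarz_ineq2[of \<xi> \<omega>] \<omega> unfolding \<rho>_def by simp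
    have "\<langle>\<xi>\<rangle> > C0 / c" using n\<xi> \<rho>(2) japanese_ge_norm[of \<xi>] by linarith
    then have "C0 < c * \<langle>\<xi>\<rangle>" using c by (simp add: field_simps)
    then have "C0 * \<langle>\<xi>\<rangle> powr (- real (length [i])) \<le> c"
      using japanese_pos[of \<xi>] by (simp add: powr_minus powr_one field_simps)
    then have 0: "\<bar>partial i a0 \<xi>\<bar> \<le> c" using C0(2)[of \<xi>] by simp
    \<comment> \<open>Dividing by \<rho> = \<xi> \<bullet> \<omega> rather than by |\<xi>| moves
      \<xi> to the hyperplane through \<omega> orthogonal to \<omega>, on which the cone condition
      says exactly that the distance to \<omega> is less than r.\<close>
    have "norm (\<xi> /\<^sub>R \<rho> - \<omega>) = norm (\<xi> - \<rho> *\<^sub>R \<omega>) / \<rho>"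
    proof -
      have "\<xi> /\<^sub>R \<rho> - \<omega> = inverse \<rho> *\<^sub>R (\<xi> - \<rho> *\<^sub>R \<omega>)" using \<rho>(3) by (simp add: scaleR_diff_right)
      then show ?thesis using \<rho>(3) by (simp add: divide_inverse mult.commute)
    qed
    also have "\<dots> < r" using \<xi>(2) \<rho>(3) unfolding \<rho>_def by (simp add: field_simps)
    finally have "dist (partial i a1 (\<xi> /\<^sub>R \<rho>)) (partial i a1 \<omega>) < c" by (intro r(2)) (simp add: dist_norm)
    then have 1: "\<bar>partial i a1 (\<xi> /\<^sub>R \<rho>)\<bar> \<ge> 3 * c" unfolding c_def dist_real_def by linarith
    have \<xi>0: "\<xi> \<noteq> 0" using n\<xi> \<rho>(3) by auto
    have "partials [i] a1 (inverse \<rho> *\<^sub>R \<xi>) = inverse \<rho> powr (1 - real (length [i])) * partials [i] a1 \<xi>"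
      by (rule partials_homogeneous[OF a1_smooth a1_hom]) (use \<rho> \<xi>0 in auto)
    then have "partial i a1 (\<xi> /\<^sub>R \<rho>) = partial i a1 \<xi>" using \<rho>(3) by simp
    moreover have "partial i a \<xi> = partial i a1 \<xi> + partial i a0 \<xi>" using R0(2)[of \<xi> "[i]"] n\<xi> \<rho>(1) by simp
    ultimately show ?thesis using 0 1 c by linarith
  qed
  then show ?thesis using r(1) c by blast
qed

text \<open>The bound for a partial derivative, from which transversality is derived, is recorded as
  well: it gives the lower bound for |\<nabla>a| needed for the time weights.\<close>

lemma transversal_cover:
  "\<exists>F. finite F \<and> \<Union>F = UNIV \<and> (\<forall>E\<in>F. E \<in> sets borel \<and> transversal a E \<and> (\<exists>i c. c > 0 \<and> (\<forall>\<xi>\<in>E. \<bar>partial i a \<xi>\<bar> \<ge> c)))"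
proof (rule finite_conic_cover)
  have d: "a differentiable (at z)" for z using a_diff[of "[]"] by simp
  have "\<exists>M. \<forall>\<xi>. \<bar>partial j a \<xi>\<bar> \<le> M" for j
    using smooth_withD(2)[OF tame_partial_a[of j]] by (auto simp: bdd_fun_def)
  then obtain m where m: "\<And>j \<xi>. \<bar>partial j a \<xi>\<bar> \<le> m j" by metis
  define M where "M = Max (range m)"
  have M: "\<bar>partial j a \<xi>\<bar> \<le> M" for j \<xi>
    unfolding M_def by (rule order.trans[OF m Max_ge]) auto
  have good: "E \<in> sets borel \<and> transversal a E \<and> (\<exists>i c. c > 0 \<and> (\<forall>\<xi>\<in>E. \<bar>partial i a \<xi>\<bar> \<ge> c))"
    if "open E" "convex E" "c > 0" "\<forall>\<xi>\<in>E. \<bar>partial i a \<xi>\<bar> \<ge> c" for E i c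
    using that borel_open[OF that(1)] transversal_convex[OF d that(2,3) _ M, of i] by blast
  show "\<exists>r>0. ball \<xi> r \<in> sets borel \<and> transversal a (ball \<xi> r) \<and> (\<exists>i c. c > 0 \<and> (\<forall>\<xi>\<in>ball \<xi> r. \<bar>partial i a \<xi>\<bar> \<ge> c))" for \<xi>
    using partial_near_nonzero[of \<xi>] good[OF open_ball convex_ball] by blast
  fix \<omega> :: "real^'n" assume \<omega>: "norm \<omega> = 1"
  obtain \<delta> R i c where *: "\<delta> > 0" "c > 0"
    "\<And>\<xi>. \<xi> \<bullet> \<omega> > R \<and> norm (\<xi> - (\<xi> \<bullet> \<omega>) *\<^sub>R \<omega>) < \<delta> * (\<xi> \<bullet> \<omega>) \<Longrightarrow> \<bar>partial i a \<xi>\<bar> \<ge> c"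
    using partial_cone_nonzero[OF \<omega>] by blast
  let ?S = "{\<xi>. \<xi> \<bullet> \<omega> > R \<and> norm (\<xi> - (\<xi> \<bullet> \<omega>) *\<^sub>R \<omega>) < \<delta> * (\<xi> \<bullet> \<omega>)}"
  have "open ?S" by (intro open_Collect_conj open_Collect_less continuous_intros)
  from good[OF this convex_cone_piece *(2), of i]
  show "\<exists>\<delta> R. \<delta> > 0 \<and> {\<xi>. \<xi> \<bullet> \<omega> > R \<and> norm (\<xi> - (\<xi> \<bullet> \<omega>) *\<^sub>R \<omega>) < \<delta> * (\<xi> \<bullet> \<omega>)} \<in> sets borel \<and>
    transversal a {\<xi>. \<xi> \<bullet> \<omega> > R \<and> norm (\<xi> - (\<xi> \<bullet> \<omega>) *\<^sub>R \<omega>) < \<delta> * (\<xi> \<bullet> \<omega>)} \<and>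
    (\<exists>i c. c > 0 \<and> (\<forall>\<xi>\<in>{\<xi>. \<xi> \<bullet> \<omega> > R \<and> norm (\<xi> - (\<xi> \<bullet> \<omega>) *\<^sub>R \<omega>) < \<delta> * (\<xi> \<bullet> \<omega>)}. \<bar>partial i a \<xi>\<bar> \<ge> c))"
    using * by (intro exI[of _ \<delta>] exI[of _ R]) auto
qed

section \<open>The vector field \<nabla>a / |\<nabla>a|^2\<close>

definition speed_sq :: "real^'n \<Rightarrow> real"
  where "speed_sq \<xi> = (\<Sum>j\<in>UNIV. (partial j a \<xi>)\<^sup>2)"

text \<open>The finite cover turns pointwise nonvanishing of the gradient into a uniform bound: the
  smallest of the finitely many constants works everywhere.\<close>

lemma speed_sq_bounded_below: "\<exists>c>0. \<forall>\<xi>. speed_sq \<xi> \<ge> c"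
proof -
  from transversal_cover obtain F where F: "finite F" "\<Union>F = UNIV"
    "\<forall>E\<in>F. E \<in> sets borel \<and> transversal a E \<and> (\<exists>i c. c > 0 \<and> (\<forall>\<xi>\<in>E. \<bar>partial i a \<xi>\<bar> \<ge> c))"
    by (elim exE conjE)
  have "\<forall>E\<in>F. \<exists>p. snd p > 0 \<and> (\<forall>\<xi>\<in>E. \<bar>partial (fst p) a \<xi>\<bar> \<ge> snd p)"
    using F(3) by force
  from bchoice[OF this] obtain f
    where f: "\<forall>E\<in>F. snd (f E) > 0 \<and> (\<forall>\<xi>\<in>E. \<bar>partial (fst (f E)) a \<xi>\<bar> \<ge> snd (f E))" by (elim exE)
  define i where "i E = fst (f E)" for E
  define c where "c E = snd (f E)" for E
  have ic: "c E > 0 \<and> (\<forall>\<xi>\<in>E. \<bar>partial (i E) a \<xi>\<bar> \<ge> c E)" if "E \<in> F" for E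
    using f that by (simp add: i_def c_def)
  have F0: "F \<noteq> {}" using F(2) by auto
  define m where "m = Min (c ` F)"
  have m: "m > 0" unfolding m_def using F(1) F0 ic by simp
  have "speed_sq \<xi> \<ge> m\<^sup>2" for \<xi>
  proof -
    obtain E where E: "E \<in> F" "\<xi> \<in> E" using F(2) by blast
    have "m \<le> c E" unfolding m_def using F(1) E(1) by simp
    then have "m \<le> \<bar>partial (i E) a \<xi>\<bar>" using ic E by force
    then have "m\<^sup>2 \<le> (partial (i E) a \<xi>)\<^sup>2" using m by (intro abs_le_square_iff[THEN iffD1]) auto
    also have "\<dots> \<le> speed_sq \<xi>" unfolding speed_sq_def by (rule member_le_sum) auto
    finally show ?thesis .
  qed
  then show ?thesis using m by (intro exI[of _ "m\<^sup>2"]) auto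
qed

lemma tame_sum: "(\<And>i. i \<in> I \<Longrightarrow> smooth_with bdd_fun (f i)) \<Longrightarrow> smooth_with bdd_fun (\<lambda>x. \<Sum>i\<in>I. f i x)"
  by (induction I rule: infinite_finite_induct) (auto intro!: tame_add smooth_with_const simp: bdd_fun_def)

text \<open>A component of \<nabla>a / |\<nabla>a|^2, the multiple of the group velocity \<nabla>a
  whose product with \<nabla>a is 1. It is complex valued in order to act on g.\<close>

definition velocity :: "'n \<Rightarrow> real^'n \<Rightarrow> complex"
  where "velocity i \<xi> = complex_of_real (partial i a \<xi> * inverse (speed_sq \<xi>))"

lemma tame_velocity: "smooth_with bdd_fun (velocity i)"
proof -
  have s: "smooth_with bdd_fun speed_sq" unfolding speed_sq_def power2_eq_square
    by (intro tame_sum tame_mult tame_partial_a)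
  obtain c where "c > 0" "\<And>\<xi>. speed_sq \<xi> \<ge> c" using speed_sq_bounded_below by blast
  from tame_inverse[OF s this] show ?thesis
    unfolding velocity_def by (intro tame_of_real tame_mult tame_partial_a)
qed

lemma velocity_sum: "(\<Sum>i\<in>UNIV. velocity i \<xi> * complex_of_real (partial i a \<xi>)) = 1"
proof -
  obtain c where "c > 0" "\<And>\<xi>. speed_sq \<xi> \<ge> c" using speed_sq_bounded_below by blast
  then have "speed_sq \<xi> \<noteq> 0" by (metis less_le_not_le)
  have "(\<Sum>i\<in>UNIV. velocity i \<xi> * complex_of_real (partial i a \<xi>)) = complex_of_real (speed_sq \<xi> * inverse (speed_sq \<xi>))"
    unfolding velocity_def speed_sq_def by (simp add: sum_distrib_right power2_eq_square mult_ac)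
  then show ?thesis using \<open>speed_sq \<xi> \<noteq> 0\<close> by simp
qed

lemma smoothing_estimate:
  assumes s: "s > 1 / 2"
  shows "\<exists>C\<ge>0. \<forall>g. schwartz g \<longrightarrow> sqn (smoothed a s g) \<le> ennreal C * sqn g"
proof -
  from transversal_cover obtain F where F: "finite F" "\<Union>F = UNIV"
    "\<forall>E\<in>F. E \<in> sets borel \<and> transversal a E \<and> (\<exists>i c. c > 0 \<and> (\<forall>\<xi>\<in>E. \<bar>partial i a \<xi>\<bar> \<ge> c))"
    by (elim exE conjE)
  have F3: "E \<in> sets borel \<and> transversal a E" if "E \<in> F" for E using F(3) that by simp
  have "a \<in> borel_measurable borel" by (rule smooth_with_measurable[OF a_slow])
  from smoothing_cover[OF this s F(1) F3] obtain C where "C \<ge> 0"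
    "\<And>q. integrable lborel q \<Longrightarrow> integrable lborel (\<lambda>\<xi>. (norm (q \<xi>))\<^sup>2) \<Longrightarrow> sqn (smoothed a s q) \<le> ennreal C * sqn q"
    unfolding F(2) by auto
  then show ?thesis using schwartz_integrable schwartz_square_integrable by blast
qed

end

subsection \<open>Weights in time\<close>

text \<open>A squared Sobolev norm of order k on the frequency side, with derivatives counted
  repeatedly; the recursion matches induction on k. Derivatives of g correspond to weights on the
  data.\<close>

primrec sobolev :: "nat \<Rightarrow> (real^'n \<Rightarrow> complex) \<Rightarrow> ennreal"
  where
    "sobolev 0 g = sqn g"
  | "sobolev (Suc k) g = sobolev k g + (\<Sum>i\<in>UNIV. sobolev k (partial i g))"

lemma sobolev_le_Suc: "sobolev k g \<le> sobolev (Suc k) g"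
  by simp

lemma sobolev_partial_le: "sobolev k (partial i g) \<le> sobolev (Suc k) g"
proof -
  have "sobolev k (partial i g) \<le> (\<Sum>i\<in>UNIV. sobolev k (partial i g))" by (rule member_le_sum) auto
  also have "\<dots> \<le> sobolev (Suc k) g" by simp
  finally show ?thesis .
qed

lemma partial_add_schwartz:
  "schwartz f \<Longrightarrow> schwartz g \<Longrightarrow> partial i (\<lambda>x. f x + g x) = (\<lambda>x. partial i f x + partial i g x)"
  by (intro ext partial_add schwartz_differentiable)

lemma partial_mult_schwartz:
  "smooth_with bdd_fun b \<Longrightarrow> schwartz g \<Longrightarrow> partial i (\<lambda>x. b x * g x) = (\<lambda>x. b x * partial i g x + partial i b x * g x)"
  by (intro ext partial_mult schwartz_differentiable smooth_withD(1))

lemma sobolev_add_le: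
  "schwartz f \<Longrightarrow> schwartz g \<Longrightarrow> sobolev k (\<lambda>x. f x + g x) \<le> 2 * (sobolev k f + sobolev k g)"
proof (induction k arbitrary: f g)
  case 0
  then show ?case using sqn_add_le[OF schwartz_measurable schwartz_measurable] by (simp add: distrib_left)
next
  case (Suc k)
  have "sobolev (Suc k) (\<lambda>x. f x + g x) \<le> 2 * (sobolev k f + sobolev k g) + (\<Sum>i\<in>UNIV. 2 * (sobolev k (partial i f) + sobolev k (partial i g)))"
    unfolding sobolev.simps(2) partial_add_schwartz[OF Suc.prems]
    by (intro add_mono sum_mono Suc.IH schwartz_partial Suc.prems)
  also have "\<dots> = 2 * (sobolev (Suc k) f + sobolev (Suc k) g)"
    by (simp add: sum.distrib distrib_left sum_distrib_left[symmetric] add_ac)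
  finally show ?case .
qed

lemma schwartz_tame_mult: "smooth_with bdd_fun b \<Longrightarrow> schwartz g \<Longrightarrow> schwartz (\<lambda>x. b x * g x)"
  by (intro schwartz_slow_mult slow_tame)

text \<open>By the Leibniz rule and induction on k for all tame b at once, since the step needs the
  claim for the derivatives of b as well. The constant depends on b and k but not on g.\<close>

lemma sobolev_mult_le:
  fixes b :: "real^'n \<Rightarrow> complex"
  shows "smooth_with bdd_fun b \<Longrightarrow> \<exists>C\<ge>0. \<forall>g. schwartz g \<longrightarrow> sobolev k (\<lambda>x. b x * g x) \<le> ennreal C * sobolev k g"
proof (induction k arbitrary: b)
  case 0
  obtain C where C: "C > 0" "\<And>x. norm (b x) \<le> C" using smooth_withD(2)[OF 0] bdd_funE by blast
  have "sqn (\<lambda>x. b x * g x) \<le> ennreal (C\<^sup>2) * sqn g" if "schwartz g" for g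
  proof -
    have "sqn (\<lambda>x. b x * g x) \<le> sqn (\<lambda>x. complex_of_real C * g x)"
      using C by (intro sqn_mono) (auto simp: norm_mult intro!: mult_right_mono)
    also have "\<dots> = ennreal (C\<^sup>2) * sqn g" using sqn_cmult[OF schwartz_measurable[OF that], of "complex_of_real C"] C(1) by simp
    finally show ?thesis .
  qed
  then show ?case by (intro exI[of _ "C\<^sup>2"]) auto
next
  case (Suc k)
  note b = Suc.prems
  obtain C where C: "C \<ge> 0" "\<And>g. schwartz g \<Longrightarrow> sobolev k (\<lambda>x. b x * g x) \<le> ennreal C * sobolev k g"
    using Suc.IH[OF b] by blast
  have "\<forall>i. \<exists>D\<ge>0. \<forall>g. schwartz g \<longrightarrow> sobolev k (\<lambda>x. partial i b x * g x) \<le> ennreal D * sobolev k g"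
    using Suc.IH[OF smooth_with_partial[OF b]] by blast
  from choice[OF this] obtain D where D: "\<And>i. D i \<ge> 0"
    "\<And>i g. schwartz g \<Longrightarrow> sobolev k (\<lambda>x. partial i b x * g x) \<le> ennreal (D i) * sobolev k g" by blast
  define K where "K = C + (\<Sum>i\<in>(UNIV::'n set). 2 * (C + D i))"
  have K0: "K \<ge> 0" unfolding K_def using C D by (intro add_nonneg_nonneg sum_nonneg) auto
  have "sobolev (Suc k) (\<lambda>x. b x * g x) \<le> ennreal K * sobolev (Suc k) g" if g: "schwartz g" for g
  proof -
    let ?S = "sobolev (Suc k) g"
    have 1: "sobolev k (\<lambda>x. b x * g x) \<le> ennreal C * ?S"
      by (rule order.trans[OF C(2)[OF g] mult_left_mono[OF sobolev_le_Suc]]) simp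
    have 2: "sobolev k (partial i (\<lambda>x. b x * g x)) \<le> ennreal (2 * (C + D i)) * ?S" for i
    proof -
      have "sobolev k (partial i (\<lambda>x. b x * g x)) \<le> 2 * (sobolev k (\<lambda>x. b x * partial i g x) + sobolev k (\<lambda>x. partial i b x * g x))"
        unfolding partial_mult_schwartz[OF b g]
        by (intro sobolev_add_le schwartz_tame_mult b smooth_with_partial schwartz_partial g)
      also have "\<dots> \<le> 2 * (ennreal C * ?S + ennreal (D i) * ?S)"
        by (intro mult_left_mono add_mono order.trans[OF C(2)[OF schwartz_partial[OF g]] mult_left_mono[OF sobolev_partial_le]]
            order.trans[OF D(2)[OF g] mult_left_mono[OF sobolev_le_Suc]]) auto
      also have "\<dots> = ennreal (2 * (C + D i)) * ?S"
        using C(1) D(1)[of i] by (simp only: ennreal_mult' zero_le_numeral ennreal_numeral ennreal_plus distrib_right mult.assoc)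
      finally show ?thesis .
    qed
    have "sobolev (Suc k) (\<lambda>x. b x * g x) \<le> ennreal C * ?S + (\<Sum>i\<in>UNIV. ennreal (2 * (C + D i)) * ?S)"
      unfolding sobolev.simps(2)[of k "\<lambda>x. b x * g x"] by (intro add_mono sum_mono 1 2)
    also have "\<dots> = ennreal K * ?S"
    proof -
      have "ennreal K = ennreal C + (\<Sum>i\<in>UNIV. ennreal (2 * (C + D i)))"
      proof -
        have "(\<Sum>i\<in>(UNIV::'n set). ennreal (2 * (C + D i))) = ennreal (\<Sum>i\<in>UNIV. 2 * (C + D i))"
          by (rule sum_ennreal) (use C(1) D(1) in simp)
        then show ?thesis
          unfolding K_def using C(1) D(1) by (simp only:) (intro ennreal_plus sum_nonneg; simp)
      qed
      then show ?thesis by (simp only: distrib_right sum_distrib_right)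
    qed
    finally show ?thesis .
  qed
  then show ?case using K0 by blast
qed

text \<open>A derivative of g multiplies \<open>ifourier g\<close> by -i x_i, which costs at most
  one factor \<langle>x\<rangle>. The base case is Plancherel's identity together with (2\<pi>)^n
  \<ge> 1.\<close>

lemma sobolev_le_weighted:
  "\<exists>C\<ge>0. \<forall>g::real^'n \<Rightarrow> complex. schwartz g \<longrightarrow> sobolev k g \<le> ennreal C * sqn (\<lambda>x. complex_of_real (\<langle>x\<rangle> ^ k) * ifourier g x)"
proof (induction k)
  case 0
  have "sqn g \<le> sqn (ifourier g)" if g: "schwartz g" for g :: "real^'n \<Rightarrow> complex"
  proof -
    have "1 * (L2_norm lborel g)\<^sup>2 \<le> (2 * pi) ^ CARD('n) * (L2_norm lborel g)\<^sup>2"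
      using pi_ge_two by (intro mult_right_mono one_le_power) auto
    then have "(L2_norm lborel g)\<^sup>2 \<le> (L2_norm lborel (ifourier g))\<^sup>2" using L2_norm_ifourier[OF g] by simp
    then have "ennreal ((L2_norm lborel g)\<^sup>2) \<le> ennreal ((L2_norm lborel (ifourier g))\<^sup>2)" by (rule ennreal_leI)
    then show ?thesis by (simp add: L2_norm_sq in_L2_schwartz schwartz_ifourier g)
  qed
  then show ?case by (intro exI[of _ 1]) simp
next
  case (Suc k)
  then obtain C where C: "C \<ge> 0" "\<And>g::real^'n \<Rightarrow> complex. schwartz g \<Longrightarrow> sobolev k g \<le> ennreal C * sqn (\<lambda>x. complex_of_real (\<langle>x\<rangle> ^ k) * ifourier g x)"
    by blast
  define K where "K = C + (\<Sum>i\<in>(UNIV::'n set). C)"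
  have "sobolev (Suc k) g \<le> ennreal K * sqn (\<lambda>x. complex_of_real (\<langle>x\<rangle> ^ Suc k) * ifourier g x)" if g: "schwartz g" for g :: "real^'n \<Rightarrow> complex"
  proof -
    let ?S = "sqn (\<lambda>x. complex_of_real (\<langle>x\<rangle> ^ Suc k) * ifourier g x)"
    have "sqn (\<lambda>x. complex_of_real (\<langle>x\<rangle> ^ k) * ifourier g x) \<le> ?S"
    proof (rule sqn_mono)
      fix x :: "real^'n"
      have "\<langle>x\<rangle> ^ k \<le> \<langle>x\<rangle> ^ Suc k" by (intro power_increasing japanese_ge_1) simp
      then show "norm (complex_of_real (\<langle>x\<rangle> ^ k) * ifourier g x) \<le> norm (complex_of_real (\<langle>x\<rangle> ^ Suc k) * ifourier g x)"
        unfolding norm_mult norm_of_real by (intro mult_right_mono) (simp_all add: japanese_nonneg)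
    qed
    from order.trans[OF C(2)[OF g] mult_left_mono[OF this]]
    have 1: "sobolev k g \<le> ennreal C * ?S" by simp
    have 2: "sobolev k (partial i g) \<le> ennreal C * ?S" for i
    proof -
      have "sqn (\<lambda>x. complex_of_real (\<langle>x\<rangle> ^ k) * ifourier (partial i g) x) \<le> ?S"
      proof (rule sqn_mono)
        fix x :: "real^'n"
        have "\<bar>x $ i\<bar> \<le> \<langle>x\<rangle>" using component_le_norm_cart[of x i] japanese_ge_norm[of x] by linarith
        then have "\<langle>x\<rangle> ^ k * (\<bar>x $ i\<bar> * norm (ifourier g x)) \<le> \<langle>x\<rangle> ^ k * (\<langle>x\<rangle> * norm (ifourier g x))"
          by (intro mult_left_mono mult_right_mono) (simp_all add: japanese_nonneg)
        then show "norm (complex_of_real (\<langle>x\<rangle> ^ k) * ifourier (partial i g) x) \<le> norm (complex_of_real (\<langle>x\<rangle> ^ Suc k) * ifourier g x)"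
          by (simp add: ifourier_partial[OF g] norm_mult norm_power japanese_nonneg mult_ac)
      qed
      from order.trans[OF C(2)[OF schwartz_partial[OF g]] mult_left_mono[OF this]]
      show ?thesis by simp
    qed
    have "sobolev (Suc k) g \<le> ennreal C * ?S + (\<Sum>i\<in>(UNIV::'n set). ennreal C * ?S)"
      unfolding sobolev.simps(2) by (intro add_mono sum_mono 1 2)
    also have "\<dots> = ennreal K * ?S"
    proof -
      have "ennreal K = ennreal C + (\<Sum>i\<in>(UNIV::'n set). ennreal C)"
      proof -
        have "(\<Sum>i\<in>(UNIV::'n set). ennreal C) = ennreal (\<Sum>i\<in>(UNIV::'n set). C)"
          by (rule sum_ennreal) (rule C(1))
        then show ?thesis
          unfolding K_def using C(1) by (simp only:) (intro ennreal_plus sum_nonneg; simp)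
      qed
      then show ?thesis by (simp only: distrib_right sum_distrib_right)
    qed
    finally show ?thesis .
  qed
  moreover have "K \<ge> 0" unfolding K_def using C(1) by (intro add_nonneg_nonneg sum_nonneg)
  ultimately show ?case by blast
qed

lemma sqn_sum_le:
  assumes "finite I" and [measurable]: "\<And>i. i \<in> I \<Longrightarrow> f i \<in> borel_measurable borel"
  shows "sqn (\<lambda>x. \<Sum>i\<in>I. f i x) \<le> of_nat (card I) * (\<Sum>i\<in>I. sqn (f i))"
proof -
  have "sqn (\<lambda>x. \<Sum>i\<in>I. f i x) \<le> (\<integral>\<^sup>+x. of_nat (card I) * (\<Sum>i\<in>I. ennreal ((norm (f i x))\<^sup>2)) \<partial>lborel)"
    unfolding sqn_def
  proof (intro nn_integral_mono)
    fix x
    have "(norm (\<Sum>i\<in>I. f i x))\<^sup>2 \<le> (\<Sum>i\<in>I. 1 * norm (f i x))\<^sup>2"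
      by (intro power_mono) (simp_all add: norm_sum)
    also have "\<dots> \<le> (\<Sum>i\<in>I. 1\<^sup>2) * (\<Sum>i\<in>I. (norm (f i x))\<^sup>2)" by (rule Cauchy_Schwarz_ineq_sum)
    finally have "ennreal ((norm (\<Sum>i\<in>I. f i x))\<^sup>2) \<le> ennreal (real (card I) * (\<Sum>i\<in>I. (norm (f i x))\<^sup>2))"
      by (intro ennreal_leI) simp
    also have "\<dots> = of_nat (card I) * (\<Sum>i\<in>I. ennreal ((norm (f i x))\<^sup>2))"
      by (simp add: ennreal_mult sum_nonneg ennreal_of_nat_eq_real_of_nat)
    finally show "ennreal ((norm (\<Sum>i\<in>I. f i x))\<^sup>2) \<le> of_nat (card I) * (\<Sum>i\<in>I. ennreal ((norm (f i x))\<^sup>2))" .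
  qed
  also have "\<dots> = of_nat (card I) * (\<Sum>i\<in>I. sqn (f i))"
    unfolding sqn_def by (subst nn_integral_cmult, measurable, subst nn_integral_sum) auto
  finally show ?thesis .
qed

context dispersive_symbol
begin

section \<open>Trading powers of t for powers of x and derivatives\<close>

lemma partial_evol:
  assumes g: "schwartz g"
  shows "partial i (evol a t g) \<xi> = evol a t (partial i g) \<xi> + - \<i> * complex_of_real t * (complex_of_real (partial i a \<xi>) * evol a t g \<xi>)"
proof -
  have ad: "(a has_derivative frechet_derivative a (at \<xi>)) (at \<xi>)"
    using smooth_withD(1)[OF a_slow] by (simp add: frechet_derivative_works)
  have "((\<lambda>\<xi>. \<i> * complex_of_real (- t * a \<xi>)) has_derivative (\<lambda>h. \<i> * complex_of_real (- t * frechet_derivative a (at \<xi>) h))) (at \<xi>)"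
    by (intro has_derivative_mult_right has_derivative_of_real ad)
  from has_derivative_compose[OF this, of exp "\<lambda>h. h * exp (\<i> * complex_of_real (- t * a \<xi>))"]
  have c: "((\<lambda>\<xi>. cis (- t * a \<xi>)) has_derivative (\<lambda>h. \<i> * complex_of_real (- t * frechet_derivative a (at \<xi>) h) * cis (- t * a \<xi>))) (at \<xi>)"
    unfolding cis_eq_iexp
    by (simp add: mult_ac has_field_derivative_imp_has_derivative[OF DERIV_exp, unfolded mult.commute[of "exp _"]])
  have cd: "(\<lambda>\<xi>. cis (- t * a \<xi>)) differentiable (at \<xi>)" using c unfolding differentiable_def by blast
  have "partial i (\<lambda>\<xi>. cis (- t * a \<xi>) * g \<xi>) \<xi> =
      cis (- t * a \<xi>) * partial i g \<xi> + (\<i> * complex_of_real (- t * partial i a \<xi>) * cis (- t * a \<xi>)) * g \<xi>"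
    unfolding partial_mult[OF cd schwartz_differentiable[OF g]] partial_eqI[OF c] by (simp add: partial_def)
  then show ?thesis unfolding evol_def by (simp add: algebra_simps)
qed

text \<open>Multiply \<open>\<nabla> exp(-ita) = -it (\<nabla>a) exp(-ita)\<close> by \<open>\<nabla>a / |\<nabla>a|\<^sup>2\<close> and integrate by parts.\<close>

lemma time_factor:
  assumes g: "schwartz g"
  shows "complex_of_real t * ifourier (evol a t g) x =
    (\<Sum>i\<in>UNIV. complex_of_real (x $ i) * ifourier (evol a t (\<lambda>\<xi>. velocity i \<xi> * g \<xi>)) x
      + - \<i> * ifourier (evol a t (partial i (\<lambda>\<xi>. velocity i \<xi> * g \<xi>))) x)"
proof -
  define f where "f i = (\<lambda>\<xi>. velocity i \<xi> * g \<xi>)" for i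
  have f: "schwartz (f i)" for i unfolding f_def by (intro schwartz_tame_mult tame_velocity g)
  have S: "schwartz (evol a t h)" if "schwartz h" for h by (rule schwartz_evol[OF a_slow that])
  have pS: "schwartz (\<lambda>\<xi>. - \<i> * complex_of_real t * (complex_of_real (partial i a \<xi>) * evol a t (f i) \<xi>))" for i
    by (intro schwartz_cmult schwartz_slow_mult slow_of_real slow_tame tame_partial_a S f)
  have "- \<i> * complex_of_real (x $ i) * ifourier (evol a t (f i)) x = ifourier (evol a t (partial i (f i))) x
      + ifourier (\<lambda>\<xi>. - \<i> * complex_of_real t * (complex_of_real (partial i a \<xi>) * evol a t (f i) \<xi>)) x" for i
  proof -
    have "partial i (evol a t (f i)) = (\<lambda>\<xi>. evol a t (partial i (f i)) \<xi> + - \<i> * complex_of_real t * (complex_of_real (partial i a \<xi>) * evol a t (f i) \<xi>))"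
      by (rule ext) (rule partial_evol[OF f])
    then show ?thesis
      unfolding ifourier_partial[OF S[OF f], symmetric]
      by (simp only: ifourier_add schwartz_integrable S schwartz_partial f pS)
  qed
  then have "(\<Sum>i\<in>UNIV. - \<i> * complex_of_real (x $ i) * ifourier (evol a t (f i)) x) =
     (\<Sum>i\<in>UNIV. ifourier (evol a t (partial i (f i))) x)
     + (\<Sum>i\<in>UNIV. ifourier (\<lambda>\<xi>. - \<i> * complex_of_real t * (complex_of_real (partial i a \<xi>) * evol a t (f i) \<xi>)) x)"
    by (simp only: sum.distrib)
  also have "(\<Sum>i\<in>UNIV. ifourier (\<lambda>\<xi>. - \<i> * complex_of_real t * (complex_of_real (partial i a \<xi>) * evol a t (f i) \<xi>)) x) =
      ifourier (\<lambda>\<xi>. \<Sum>i\<in>UNIV. - \<i> * complex_of_real t * (complex_of_real (partial i a \<xi>) * evol a t (f i) \<xi>)) x"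
    by (rule ifourier_sum[symmetric, OF finite]) (rule schwartz_integrable[OF pS])
  \<comment> \<open>Summation over i collapses because the field is normalised so that its product
    with \<nabla>a is 1 (\<open>velocity_sum\<close>).\<close>
  also have "(\<lambda>\<xi>. \<Sum>i\<in>UNIV. - \<i> * complex_of_real t * (complex_of_real (partial i a \<xi>) * evol a t (f i) \<xi>)) =
      (\<lambda>\<xi>. - \<i> * complex_of_real t * evol a t g \<xi>)"
  proof
    fix \<xi>
    have "(\<Sum>i\<in>UNIV. - \<i> * complex_of_real t * (complex_of_real (partial i a \<xi>) * evol a t (f i) \<xi>)) =
       (\<Sum>i\<in>UNIV. velocity i \<xi> * complex_of_real (partial i a \<xi>)) * (- \<i> * complex_of_real t * evol a t g \<xi>)"
      unfolding sum_distrib_right f_def evol_def by (intro sum.cong refl) (simp add: mult_ac)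
    then show "(\<Sum>i\<in>UNIV. - \<i> * complex_of_real t * (complex_of_real (partial i a \<xi>) * evol a t (f i) \<xi>)) = - \<i> * complex_of_real t * evol a t g \<xi>"
      unfolding velocity_sum by simp
  qed
  also have "ifourier (\<lambda>\<xi>. - \<i> * complex_of_real t * evol a t g \<xi>) x = - \<i> * complex_of_real t * ifourier (evol a t g) x"
    by (rule ifourier_cmult)
  finally have eq: "(\<Sum>i\<in>UNIV. - \<i> * complex_of_real (x $ i) * ifourier (evol a t (f i)) x) - (\<Sum>i\<in>UNIV. ifourier (evol a t (partial i (f i))) x)
     = - \<i> * complex_of_real t * ifourier (evol a t g) x" by simp
  have "complex_of_real t * ifourier (evol a t g) x = \<i> * (- \<i> * complex_of_real t * ifourier (evol a t g) x)"
    by (simp flip: mult.assoc)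
  also have "\<dots> = (\<Sum>i\<in>UNIV. \<i> * (- \<i> * complex_of_real (x $ i) * ifourier (evol a t (f i)) x - ifourier (evol a t (partial i (f i))) x))"
    unfolding eq[symmetric] sum_subtractf[symmetric] sum_distrib_left ..
  also have "\<dots> = (\<Sum>i\<in>UNIV. complex_of_real (x $ i) * ifourier (evol a t (f i)) x + - \<i> * ifourier (evol a t (partial i (f i))) x)"
    by (intro sum.cong refl) (simp add: right_diff_distrib flip: mult.assoc)
  finally show ?thesis unfolding f_def .
qed

definition weighted_flow :: "real \<Rightarrow> nat \<Rightarrow> (real^'n \<Rightarrow> complex) \<Rightarrow> real \<times> (real^'n) \<Rightarrow> complex"
  where "weighted_flow s k g p = complex_of_real (fst p ^ k * \<langle>snd p\<rangle> powr (- real k) * \<langle>snd p\<rangle> powr (- s)) * ifourier (evol a (fst p) g) (snd p)"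

lemma a_measurable [measurable]: "a \<in> borel_measurable borel"
  by (rule smooth_with_measurable[OF a_slow])

lemma pair_measurable [measurable]:
  "(\<lambda>p. \<langle>snd p\<rangle>) \<in> borel_measurable (borel :: (real \<times> (real^'n)) measure)"
  "(fst :: real \<times> (real^'n) \<Rightarrow> real) \<in> borel_measurable borel"
  "(\<lambda>p. snd p $ i) \<in> borel_measurable (borel :: (real \<times> (real^'n)) measure)"
  by (intro borel_measurable_continuous_onI continuous_intros)+

lemma weighted_flow_measurable [measurable]:
  "g \<in> borel_measurable borel \<Longrightarrow> weighted_flow s k g \<in> borel_measurable borel"
  unfolding weighted_flow_def by measurable

text \<open>One factor t is combined with one factor 1/\<langle>x\<rangle> of the weight: after
  \<open>time_factor\<close> the coefficients are x_i/\<langle>x\<rangle> and 1/\<langle>x\<rangle>,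
  both bounded by 1, in front of flows with one power of time less.\<close>

lemma weighted_flow_Suc:
  assumes g: "schwartz g"
  shows "weighted_flow s (Suc k) g p =
    (\<Sum>i\<in>UNIV. complex_of_real (snd p $ i / \<langle>snd p\<rangle>) * weighted_flow s k (\<lambda>\<xi>. velocity i \<xi> * g \<xi>) p
      + - \<i> * complex_of_real (1 / \<langle>snd p\<rangle>) * weighted_flow s k (partial i (\<lambda>\<xi>. velocity i \<xi> * g \<xi>)) p)"
proof -
  define W where "W = complex_of_real (fst p ^ k * \<langle>snd p\<rangle> powr (- real k) * \<langle>snd p\<rangle> powr (- s))"
  define J where "J = complex_of_real (1 / \<langle>snd p\<rangle>)"
  have "\<langle>snd p\<rangle> powr (- real (Suc k)) = \<langle>snd p\<rangle> powr (- real k) * (1 / \<langle>snd p\<rangle>)"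
  proof -
    have "- real (Suc k) = - real k - 1" by simp
    then show ?thesis unfolding powr_diff using japanese_nonneg[of "snd p"] by (simp only: powr_diff powr_one) simp
  qed
  then have "weighted_flow s (Suc k) g p = J * W * (complex_of_real (fst p) * ifourier (evol a (fst p) g) (snd p))"
    unfolding weighted_flow_def W_def J_def by (simp add: mult_ac)
  also have "\<dots> = (\<Sum>i\<in>UNIV. complex_of_real (snd p $ i) * J * (W * ifourier (evol a (fst p) (\<lambda>\<xi>. velocity i \<xi> * g \<xi>)) (snd p))
      + - \<i> * J * (W * ifourier (evol a (fst p) (partial i (\<lambda>\<xi>. velocity i \<xi> * g \<xi>))) (snd p)))"
    unfolding time_factor[OF g] sum_distrib_left by (intro sum.cong refl) (simp add: algebra_simps)
  finally show ?thesis unfolding weighted_flow_def W_def J_def by simp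
qed

text \<open>Each power of t costs at most one derivative of g. The case k = 0 is the smoothing
  estimate, and the multiplications by \<open>velocity\<close> are absorbed by
  \<open>sobolev_mult_le\<close>.\<close>

lemma weighted_flow_sobolev:
  assumes s: "s > 1 / 2"
  shows "\<exists>C\<ge>0. \<forall>g. schwartz g \<longrightarrow> sqn (weighted_flow s k g) \<le> ennreal C * sobolev k g"
proof (induction k)
  case 0
  have "weighted_flow s 0 g = smoothed a s g" for g
    unfolding weighted_flow_def smoothed_def using japanese_pos by (intro ext) (simp add: less_imp_neq[symmetric])
  then show ?case using smoothing_estimate[OF s] by simp
next
  case (Suc k)
  then obtain C where C: "C \<ge> 0" "\<And>g. schwartz g \<Longrightarrow> sqn (weighted_flow s k g) \<le> ennreal C * sobolev k g" by blast
  have "\<forall>i. \<exists>D\<ge>0. \<forall>g. schwartz g \<longrightarrow> sobolev (Suc k) (\<lambda>x. velocity i x * g x) \<le> ennreal D * sobolev (Suc k) g"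
    using sobolev_mult_le[OF tame_velocity] by blast
  from choice[OF this] obtain D where D: "\<And>i. D i \<ge> 0"
    "\<And>i g. schwartz g \<Longrightarrow> sobolev (Suc k) (\<lambda>x. velocity i x * g x) \<le> ennreal (D i) * sobolev (Suc k) g" by blast
  \<comment> \<open>The factor n comes from Cauchy-Schwarz for the sum over i, the 4 from two terms
    each with a factor 2, and D from multiplication by \<open>velocity\<close>.\<close>
  define K where "K = real CARD('n) * (\<Sum>i\<in>UNIV. 4 * C * D i)"
  have K0: "K \<ge> 0" unfolding K_def using C(1) D(1) by (intro mult_nonneg_nonneg sum_nonneg) auto
  have "sqn (weighted_flow s (Suc k) g) \<le> ennreal K * sobolev (Suc k) g" if g: "schwartz g" for g
  proof -
    let ?S = "sobolev (Suc k) g"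
    define f where "f i = (\<lambda>\<xi>. velocity i \<xi> * g \<xi>)" for i
    have f: "schwartz (f i)" for i unfolding f_def by (intro schwartz_tame_mult tame_velocity g)
    note [measurable] = schwartz_measurable[OF f] schwartz_measurable[OF schwartz_partial[OF f]]
    define A where "A i p = complex_of_real (snd p $ i / \<langle>snd p\<rangle>) * weighted_flow s k (f i) p" for i p
    define B where "B i p = - \<i> * complex_of_real (1 / \<langle>snd p\<rangle>) * weighted_flow s k (partial i (f i)) p" for i p
    have AB[measurable]: "A i \<in> borel_measurable borel" "B i \<in> borel_measurable borel" for i
      unfolding A_def B_def by measurable
    have piece: "sqn (\<lambda>p. A i p + B i p) \<le> ennreal (4 * C * D i) * ?S" for i
    proof -
      have "sqn (A i) \<le> sqn (weighted_flow s k (f i))"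
      proof (rule sqn_mono)
        fix p :: "real \<times> (real^'n)"
        have "\<bar>snd p $ i\<bar> \<le> \<langle>snd p\<rangle>" using component_le_norm_cart[of "snd p" i] japanese_ge_norm[of "snd p"] by linarith
        then have "\<bar>snd p $ i / \<langle>snd p\<rangle>\<bar> \<le> 1" using japanese_pos[of "snd p"] by (simp add: abs_divide)
        then show "norm (A i p) \<le> norm (weighted_flow s k (f i) p)"
          unfolding A_def norm_mult norm_of_real by (intro mult_left_le_one_le) auto
      qed
      also have "\<dots> \<le> ennreal C * sobolev k (f i)" by (rule C(2)[OF f])
      also have "\<dots> \<le> ennreal C * sobolev (Suc k) (f i)" by (intro mult_left_mono sobolev_le_Suc) simp
      finally have 1: "sqn (A i) \<le> ennreal C * sobolev (Suc k) (f i)" .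
      have "sqn (B i) \<le> sqn (weighted_flow s k (partial i (f i)))"
      proof (rule sqn_mono)
        fix p :: "real \<times> (real^'n)"
        have "norm (- \<i> * complex_of_real (1 / \<langle>snd p\<rangle>)) \<le> 1"
          using japanese_ge_1[of "snd p"] by (simp add: norm_divide)
        then show "norm (B i p) \<le> norm (weighted_flow s k (partial i (f i)) p)"
          unfolding B_def norm_mult[of "- \<i> * complex_of_real (1 / \<langle>snd p\<rangle>)"] by (intro mult_left_le_one_le) auto
      qed
      also have "\<dots> \<le> ennreal C * sobolev k (partial i (f i))" by (rule C(2)[OF schwartz_partial[OF f]])
      also have "\<dots> \<le> ennreal C * sobolev (Suc k) (f i)" by (intro mult_left_mono sobolev_partial_le) simp
      finally have 2: "sqn (B i) \<le> ennreal C * sobolev (Suc k) (f i)" .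
      have "sqn (\<lambda>p. A i p + B i p) \<le> 2 * sqn (A i) + 2 * sqn (B i)" by (rule sqn_add_le) measurable
      also have "\<dots> \<le> 2 * (ennreal C * sobolev (Suc k) (f i)) + 2 * (ennreal C * sobolev (Suc k) (f i))"
        by (intro add_mono mult_left_mono 1 2) auto
      also have "\<dots> = (4 * ennreal C) * sobolev (Suc k) (f i)"
        unfolding mult.assoc[symmetric] distrib_right[symmetric] by simp
      also have "\<dots> \<le> (4 * ennreal C) * (ennreal (D i) * ?S)"
        unfolding f_def by (intro mult_left_mono D(2)[OF g]) simp
      also have "\<dots> = ennreal (4 * C * D i) * ?S"
        using C(1) D(1)[of i] by (simp add: ennreal_mult mult.assoc)
      finally show ?thesis .
    qed
    have "weighted_flow s (Suc k) g = (\<lambda>p. \<Sum>i\<in>UNIV. A i p + B i p)"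
      unfolding A_def B_def f_def by (rule ext) (rule weighted_flow_Suc[OF g])
    then have "sqn (weighted_flow s (Suc k) g) \<le> of_nat CARD('n) * (\<Sum>i\<in>UNIV. sqn (\<lambda>p. A i p + B i p))"
      by (simp only:) (rule sqn_sum_le; measurable)
    also have "\<dots> \<le> of_nat CARD('n) * (\<Sum>i\<in>UNIV. ennreal (4 * C * D i) * ?S)"
      by (intro mult_left_mono sum_mono piece) simp
    also have "\<dots> = ennreal K * ?S"
    proof -
      have "ennreal K = of_nat CARD('n) * (\<Sum>i\<in>UNIV. ennreal (4 * C * D i))"
        unfolding K_def using C(1) D(1) by (subst ennreal_mult) (auto intro!: sum_nonneg simp: ennreal_of_nat_eq_real_of_nat)
      then show ?thesis by (simp only: sum_distrib_right mult.assoc)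
    qed
    finally show ?thesis .
  qed
  then show ?case using K0 by blast
qed

lemma weighted_flow_estimate:
  assumes s: "s > 1 / 2"
  shows "\<exists>C\<ge>0. \<forall>g. schwartz g \<longrightarrow> sqn (weighted_flow s k g) \<le> ennreal C * sqn (\<lambda>x. complex_of_real (\<langle>x\<rangle> ^ k) * ifourier g x)"
proof -
  obtain C where C: "C \<ge> 0" "\<And>g. schwartz g \<Longrightarrow> sqn (weighted_flow s k g) \<le> ennreal C * sobolev k g"
    using weighted_flow_sobolev[OF s] by blast
  obtain D where D: "D \<ge> 0" "\<And>g::real^'n \<Rightarrow> complex. schwartz g \<Longrightarrow> sobolev k g \<le> ennreal D * sqn (\<lambda>x. complex_of_real (\<langle>x\<rangle> ^ k) * ifourier g x)"
    using sobolev_le_weighted[of k, where 'n = 'n] by blast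
  have "sqn (weighted_flow s k g) \<le> ennreal (C * D) * sqn (\<lambda>x. complex_of_real (\<langle>x\<rangle> ^ k) * ifourier g x)" if "schwartz g" for g
    using order.trans[OF C(2)[OF that] mult_left_mono[OF D(2)[OF that], of "ennreal C"]] C(1) D(1)
    by (simp add: ennreal_mult mult.assoc)
  then show ?thesis using C(1) D(1) by (intro exI[of _ "C * D"]) simp
qed

text \<open>On a strip |t| \<le> T the space-time weight is at most T^k, so closeness in L2 at each
  time gives closeness in the weighted norm. Making the approximation fine depending on T leaves a
  bound independent of T, and T \<rightarrow> \<infinity> follows by Fatou.\<close>

lemma solution_estimate:
  assumes s: "s > 1 / 2"
    and C: "C \<ge> 0" "\<And>g. schwartz g \<Longrightarrow> sqn (weighted_flow s k g) \<le> ennreal C * sqn (\<lambda>x. complex_of_real (\<langle>x\<rangle> ^ k) * ifourier g x)"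
    and u: "cauchy_solution a u0 u" and u0: "in_L2 lborel (\<lambda>x. complex_of_real (\<langle>x\<rangle> ^ k) * u0 x)"
  shows "sqn (\<lambda>p. complex_of_real (fst p ^ k * \<langle>snd p\<rangle> powr (- real k) * \<langle>snd p\<rangle> powr (- s)) * u (fst p) (snd p))
    \<le> ennreal (4 * C) * sqn (\<lambda>x. complex_of_real (\<langle>x\<rangle> ^ k) * u0 x)"
proof -
  define W where "W p = fst p ^ k * \<langle>snd p\<rangle> powr (- real k) * \<langle>snd p\<rangle> powr (- s)" for p :: "real \<times> (real^'n)"
  have W_meas[measurable]: "W \<in> borel_measurable borel" unfolding W_def by measurable
  have u_meas[measurable]: "(\<lambda>p. u (fst p) (snd p)) \<in> borel_measurable borel"
    using u unfolding cauchy_solution_def by (simp add: case_prod_unfold)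
  have ut[measurable]: "u t \<in> borel_measurable borel" for t using u unfolding cauchy_solution_def in_L2_def by simp
  define Q where "Q = sqn (\<lambda>x. complex_of_real (\<langle>x\<rangle> ^ k) * u0 x)"
  have Qfin: "Q < \<infinity>" and m0: "(\<lambda>x. complex_of_real (\<langle>x\<rangle> ^ k) * u0 x) \<in> borel_measurable borel"
    using u0 unfolding Q_def by (auto simp: in_L2_sqn)
  \<comment> \<open>Measurability is given for the weighted datum; the weight never vanishes and can
    be divided out.\<close>
  have u0_meas[measurable]: "u0 \<in> borel_measurable borel"
  proof -
    have m: "(\<lambda>x. complex_of_real (\<langle>x\<rangle> ^ k) * u0 x / complex_of_real (\<langle>x\<rangle> ^ k)) \<in> borel_measurable borel"
      using m0 by measurable
    have nz: "complex_of_real (\<langle>x\<rangle> ^ k) \<noteq> 0" for x :: "real^'n" using japanese_pos[of x] by simp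
    show ?thesis using m unfolding nonzero_mult_div_cancel_left[OF nz] .
  qed
  have W_le: "\<bar>W p\<bar> \<le> T ^ k" if "\<bar>fst p\<bar> \<le> T" for p T
  proof -
    have "\<bar>W p\<bar> = \<bar>fst p\<bar> ^ k * (\<langle>snd p\<rangle> powr (- real k) * \<langle>snd p\<rangle> powr (- s))"
      unfolding W_def by (simp add: abs_mult power_abs mult.assoc)
    also have "\<dots> \<le> T ^ k * (1 * 1)"
    proof (intro mult_mono power_mono that)
      show "\<langle>snd p\<rangle> powr (- s) \<le> 1" using s powr_mono[of "- s" 0 "\<langle>snd p\<rangle>"] japanese_ge_1[of "snd p"] by simp
      show "0 \<le> T ^ k" using that by (intro zero_le_power) linarith
    qed (auto simp: japanese_powr_le)
    finally show ?thesis by simp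
  qed
  have trunc: "(\<integral>\<^sup>+p. ennreal ((norm (complex_of_real (W p) * u (fst p) (snd p)))\<^sup>2 * indicator {-T..T} (fst p)) \<partial>lborel) \<le> ennreal (4 * C) * Q"
    if T: "T \<ge> 0" for T
  proof (rule ennreal_le_epsilon)
    fix e :: real assume e: "e > 0"
    \<comment> \<open>M collects the coefficients of d in the final sum: 4C from the smooth flow and
      2 * 4 * 2T * (T^k)^2 from the error. The 1 makes M positive.\<close>
    define M where "M = 4 * C + 16 * (T ^ k)\<^sup>2 * T + 1"
    have M: "M > 0" unfolding M_def using C(1) T by (intro add_nonneg_pos add_nonneg_nonneg mult_nonneg_nonneg) auto
    define d where "d = e / M"
    have d: "d > 0" using e M by (simp add: d_def)
    obtain g where g: "schwartz g" and gd: "sqn (\<lambda>x. complex_of_real (\<langle>x\<rangle> ^ k) * (u0 x - ifourier g x)) < ennreal d"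
      using schwartz_dense[OF u0_meas, of k "ennreal d"] Qfin d unfolding Q_def by auto
    note [measurable] = schwartz_measurable[OF g] schwartz_measurable[OF schwartz_ifourier[OF g]]
    \<comment> \<open>One of the two factors 2 in the final 4C arises here, in passing from u0 to
      its approximation; the other comes from splitting u into A and B.\<close>
    have P_le: "sqn (\<lambda>x. complex_of_real (\<langle>x\<rangle> ^ k) * ifourier g x) \<le> 2 * Q + 2 * ennreal d"
    proof -
      have "sqn (\<lambda>x. complex_of_real (\<langle>x\<rangle> ^ k) * ifourier g x) =
        sqn (\<lambda>x. complex_of_real (\<langle>x\<rangle> ^ k) * u0 x + (-1) * (complex_of_real (\<langle>x\<rangle> ^ k) * (u0 x - ifourier g x)))"
        by (simp add: algebra_simps)
      also have "\<dots> \<le> 2 * Q + 2 * sqn (\<lambda>x. (-1) * (complex_of_real (\<langle>x\<rangle> ^ k) * (u0 x - ifourier g x)))"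
        unfolding Q_def by (rule sqn_add_le) measurable
      also have "\<dots> \<le> 2 * Q + 2 * ennreal d"
        using gd by (intro add_left_mono mult_left_mono) (auto simp: sqn_def norm_mult)
      finally show ?thesis .
    qed
    have diff_le: "sqn (\<lambda>x. u t x - ifourier (evol a t g) x) \<le> 4 * ennreal d" for t
    proof -
      have "sqn (\<lambda>x. u0 x - ifourier g x) \<le> sqn (\<lambda>x. complex_of_real (\<langle>x\<rangle> ^ k) * (u0 x - ifourier g x))"
      proof (rule sqn_mono)
        fix x :: "real^'n"
        have "1 \<le> \<langle>x\<rangle> ^ k" by (intro one_le_power japanese_ge_1)
        then show "norm (u0 x - ifourier g x) \<le> norm (complex_of_real (\<langle>x\<rangle> ^ k) * (u0 x - ifourier g x))"
          unfolding norm_mult norm_of_real by (intro mult_le_cancel_right1[THEN iffD2]) auto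
      qed
      then have "sqn (\<lambda>x. u0 x - ifourier g x) \<le> ennreal d" using gd by (rule order.trans[OF _ less_imp_le])
      then have "4 * sqn (\<lambda>x. u0 x - ifourier g x) \<le> 4 * ennreal d" by (rule mult_left_mono) simp
      then show ?thesis using solution_close[OF a_slow u g, of t] by (rule order.trans[rotated])
    qed
    define v where "v p = ifourier (evol a (fst p) g) (snd p)" for p
    have v_meas[measurable]: "v \<in> borel_measurable borel" unfolding v_def by measurable
    define I where "I p = complex_of_real (indicator {-T..T} (fst p))" for p :: "real \<times> (real^'n)"
    have I_meas[measurable]: "I \<in> borel_measurable borel" unfolding I_def by measurable
    have I_le: "norm (I p) \<le> 1" for p unfolding I_def by (simp add: indicator_def)
    \<comment> \<open>A is the smooth flow, controlled on all of space-time by C; B is the error,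
      controlled one time slice after another.\<close>
    define A where "A p = I p * (complex_of_real (W p) * v p)" for p
    define B where "B p = I p * (complex_of_real (W p) * (u (fst p) (snd p) - v p))" for p
    have [measurable]: "A \<in> borel_measurable borel" "B \<in> borel_measurable borel" unfolding A_def B_def by measurable
    have A_le: "sqn A \<le> ennreal C * (2 * Q + 2 * ennreal d)"
    proof -
      have "sqn A \<le> sqn (weighted_flow s k g)"
      proof (rule sqn_mono)
        fix p
        show "norm (A p) \<le> norm (weighted_flow s k g p)"
          unfolding A_def weighted_flow_def W_def[symmetric] v_def[symmetric] norm_mult[of "I p"]
          by (intro mult_left_le_one_le I_le) auto
      qed
      also have "\<dots> \<le> ennreal C * (2 * Q + 2 * ennreal d)"
        by (rule order.trans[OF C(2)[OF g] mult_left_mono[OF P_le]]) simp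
      finally show ?thesis .
    qed
    \<comment> \<open>The squared weight is at most (T^k)^2, each time slice contributes at most 4d,
      and the interval of times has length 2T.\<close>
    have B_le: "sqn B \<le> ennreal ((T ^ k)\<^sup>2) * (4 * ennreal d) * ennreal (2 * T)"
    proof -
      have "sqn B = (\<integral>\<^sup>+p. ennreal ((norm (B p))\<^sup>2) \<partial>(lborel \<Otimes>\<^sub>M lborel))"
        unfolding sqn_def lborel_prod ..
      also have "\<dots> = (\<integral>\<^sup>+t. (\<integral>\<^sup>+x. ennreal ((norm (B (t, x)))\<^sup>2) \<partial>lborel) \<partial>lborel)"
      proof (rule lborel.nn_integral_fst[symmetric])
        show "(\<lambda>p. ennreal ((norm (B p))\<^sup>2)) \<in> borel_measurable (lborel \<Otimes>\<^sub>M lborel)" unfolding lborel_prod by measurable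
      qed
      also have "\<dots> \<le> (\<integral>\<^sup>+t. ennreal ((T ^ k)\<^sup>2) * (4 * ennreal d) * indicator {-T..T} t \<partial>lborel)"
      proof (rule nn_integral_mono)
        fix t :: real
        show "(\<integral>\<^sup>+x. ennreal ((norm (B (t, x)))\<^sup>2) \<partial>lborel) \<le> ennreal ((T ^ k)\<^sup>2) * (4 * ennreal d) * indicator {-T..T} t"
        proof (cases "t \<in> {-T..T}")
          case False
          then show ?thesis by (simp add: B_def I_def)
        next
          case True
          have [measurable]: "ifourier (evol a t g) \<in> borel_measurable borel"
            by (intro schwartz_measurable schwartz_ifourier schwartz_evol a_slow g)
          have "(\<integral>\<^sup>+x. ennreal ((norm (B (t, x)))\<^sup>2) \<partial>lborel) \<le> sqn (\<lambda>x. complex_of_real (T ^ k) * (u t x - ifourier (evol a t g) x))"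
            unfolding sqn_def
          proof (intro nn_integral_mono ennreal_leI power_mono)
            fix x
            have "\<bar>W (t, x)\<bar> \<le> T ^ k" using True by (intro W_le) auto
            moreover have "T ^ k \<ge> 0" using T by simp
            ultimately show "norm (B (t, x)) \<le> norm (complex_of_real (T ^ k) * (u t x - ifourier (evol a t g) x))"
              unfolding B_def I_def v_def norm_mult norm_of_real using True by (auto intro!: mult_right_mono)
          qed simp
          also have "\<dots> = ennreal ((norm (complex_of_real (T ^ k)))\<^sup>2) * sqn (\<lambda>x. u t x - ifourier (evol a t g) x)"
            by (rule sqn_cmult) measurable
          also have "(norm (complex_of_real (T ^ k)))\<^sup>2 = (T ^ k)\<^sup>2" by (simp only: norm_of_real power2_abs)
          also have "ennreal ((T ^ k)\<^sup>2) * sqn (\<lambda>x. u t x - ifourier (evol a t g) x) \<le> ennreal ((T ^ k)\<^sup>2) * (4 * ennreal d)"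
            by (intro mult_left_mono diff_le) simp
          finally show ?thesis using True by simp
        qed
      qed
      also have "\<dots> = ennreal ((T ^ k)\<^sup>2) * (4 * ennreal d) * ennreal (2 * T)"
        using T by (subst nn_integral_cmult_indicator) auto
      finally show ?thesis .
    qed
    have "(\<integral>\<^sup>+p. ennreal ((norm (complex_of_real (W p) * u (fst p) (snd p)))\<^sup>2 * indicator {-T..T} (fst p)) \<partial>lborel) = sqn (\<lambda>p. A p + B p)"
      unfolding sqn_def A_def B_def I_def
      by (intro nn_integral_cong arg_cong[where f = ennreal]) (auto simp: indicator_def algebra_simps)
    also have "\<dots> \<le> 2 * sqn A + 2 * sqn B" by (rule sqn_add_le) measurable
    also have "\<dots> \<le> 2 * (ennreal C * (2 * Q + 2 * ennreal d)) + 2 * (ennreal ((T ^ k)\<^sup>2) * (4 * ennreal d) * ennreal (2 * T))"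
      by (intro add_mono mult_left_mono A_le B_le) auto
    also have "\<dots> \<le> ennreal (4 * C) * Q + ennreal e"
    proof -
      obtain q where q: "q \<ge> 0" "Q = ennreal q" using Qfin by (cases Q rule: ennreal_cases) auto
      have "2 * (ennreal C * (2 * Q + 2 * ennreal d)) + 2 * (ennreal ((T ^ k)\<^sup>2) * (4 * ennreal d) * ennreal (2 * T))
        = ennreal (2 * (C * (2 * q + 2 * d)) + 2 * ((T ^ k)\<^sup>2 * (4 * d) * (2 * T)))"
        unfolding q(2) using q(1) C(1) T less_imp_le[OF d]
        by (simp only: ennreal_plus ennreal_mult ennreal_numeral mult_nonneg_nonneg add_nonneg_nonneg zero_le_numeral zero_le_power2)
      also have "\<dots> \<le> ennreal (4 * C * q + M * d)"
        using d unfolding M_def by (intro ennreal_leI) (simp add: algebra_simps)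
      also have "M * d = e" using M by (simp add: d_def)
      finally show ?thesis unfolding q(2) using q(1) C(1) e by (simp add: ennreal_mult ennreal_plus)
    qed
    finally show "(\<integral>\<^sup>+p. ennreal ((norm (complex_of_real (W p) * u (fst p) (snd p)))\<^sup>2 * indicator {-T..T} (fst p)) \<partial>lborel) \<le> ennreal (4 * C) * Q + ennreal e" .
  qed
  have "(\<integral>\<^sup>+p. ennreal ((norm (complex_of_real (W p) * u (fst p) (snd p)))\<^sup>2) \<partial>lborel) \<le> ennreal (4 * C) * Q"
  proof (rule nn_integral_weight_limit[where r = "\<lambda>m p. indicator {-real m..real m} (fst p)"])
    fix p :: "real \<times> (real^'n)"
    obtain N :: nat where N: "\<bar>fst p\<bar> \<le> real N" using real_arch_simple by blast
    have "\<forall>\<^sub>F m in sequentially. indicator {-real m..real m} (fst p) = (1::real)"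
      using eventually_ge_at_top[of N] by eventually_elim (use N in \<open>auto simp: indicator_def\<close>)
    then show "(\<lambda>m. indicator {-real m..real m} (fst p)) \<longlonglongrightarrow> (1::real)" by (rule tendsto_eventually)
  next
    show "(\<integral>\<^sup>+p. ennreal ((norm (complex_of_real (W p) * u (fst p) (snd p)))\<^sup>2 * indicator {-real m..real m} (fst p)) \<partial>lborel) \<le> ennreal (4 * C) * Q" for m
      by (rule trunc) simp
  qed measurable
  then have "sqn (\<lambda>p. complex_of_real (W p) * u (fst p) (snd p)) \<le> ennreal (4 * C) * Q"
    by (simp only: sqn_def[of "\<lambda>p. complex_of_real (W p) * u (fst p) (snd p)"])
  then show ?thesis unfolding W_def Q_def .
qed

end

theorem theorem4p1:
  fixes a a1 a0 :: "real ^ 'n \<Rightarrow> real"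
    and s :: real and k :: nat
  assumes "smooth_on UNIV a"
    and "\<And>\<xi>. grad a \<xi> \<noteq> 0"
    and "smooth_on (- {0}) a1"
    and "homogeneous_order_one a1"
    and "\<And>\<xi>. \<xi> \<noteq> 0 \<Longrightarrow> grad a1 \<xi> \<noteq> 0"
    and "symbol_order_zero a0"
    and "\<forall>\<^sub>F \<xi> in at_infinity. a \<xi> = a1 \<xi> + a0 \<xi>"
    and "s > 1 / 2"
  shows "\<exists>C>0. \<forall>u0 u.
    in_L2 lborel (\<lambda>x. complex_of_real (\<langle>x\<rangle> ^ k) * u0 x) \<longrightarrow>
    cauchy_solution a u0 u \<longrightarrow>
      in_L2 lborel (\<lambda>(t, x).
        complex_of_real (t ^ k * \<langle>x\<rangle> powr (- real k) * \<langle>x\<rangle> powr (- s)) * u t x) \<and>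
      L2_norm lborel (\<lambda>(t, x).
        complex_of_real (t ^ k * \<langle>x\<rangle> powr (- real k) * \<langle>x\<rangle> powr (- s)) * u t x)
      \<le> C * L2_norm lborel (\<lambda>x. complex_of_real (\<langle>x\<rangle> ^ k) * u0 x)"
proof -
  interpret dispersive_symbol a a1 a0 by (unfold_locales; fact assms)
  obtain C where C: "C \<ge> 0" "\<And>g. schwartz g \<Longrightarrow> sqn (weighted_flow s k g) \<le> ennreal C * sqn (\<lambda>x. complex_of_real (\<langle>x\<rangle> ^ k) * ifourier g x)"
    using weighted_flow_estimate[OF assms(8), of k] by blast
  \<comment> \<open>The square root passes from squared norms to norms; the 1 ensures positivity, as
    C may be 0.\<close>
  define K where "K = sqrt (4 * C + 1)"
  have K: "K > 0" unfolding K_def using C(1) by simp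
  have "in_L2 lborel F \<and> L2_norm lborel F \<le> K * L2_norm lborel G"
    if G: "in_L2 lborel G" and u: "cauchy_solution a u0 u"
      and G_def: "G = (\<lambda>x. complex_of_real (\<langle>x\<rangle> ^ k) * u0 x)"
      and F_def: "F = (\<lambda>(t, x). complex_of_real (t ^ k * \<langle>x\<rangle> powr (- real k) * \<langle>x\<rangle> powr (- s)) * u t x)"
    for u0 u F G
  proof -
    have F_eq: "F = (\<lambda>p. complex_of_real (fst p ^ k * \<langle>snd p\<rangle> powr (- real k) * \<langle>snd p\<rangle> powr (- s)) * u (fst p) (snd p))"
      unfolding F_def by (simp add: case_prod_unfold)
    have [measurable]: "(\<lambda>p. u (fst p) (snd p)) \<in> borel_measurable borel"
      using u unfolding cauchy_solution_def by (simp add: case_prod_unfold)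
    have F_meas: "F \<in> borel_measurable borel" unfolding F_eq by measurable
    have le: "sqn F \<le> ennreal (4 * C) * sqn G"
      unfolding F_eq G_def by (rule solution_estimate[OF assms(8) C u G[unfolded G_def]])
    also have "\<dots> < \<infinity>" using G by (auto simp: in_L2_sqn ennreal_mult_less_top)
    finally have F: "in_L2 lborel F" using F_meas by (simp add: in_L2_sqn)
    have "ennreal ((L2_norm lborel F)\<^sup>2) \<le> ennreal (4 * C * (L2_norm lborel G)\<^sup>2)"
      using le C(1) by (simp add: L2_norm_sq[symmetric] F G ennreal_mult)
    then have "(L2_norm lborel F)\<^sup>2 \<le> 4 * C * (L2_norm lborel G)\<^sup>2"
      by (rule ennreal_le_iff[THEN iffD1, rotated]) (use C(1) in simp)
    also have "\<dots> \<le> (4 * C + 1) * (L2_norm lborel G)\<^sup>2" by (rule mult_right_mono) simp_all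
    also have "\<dots> = (K * L2_norm lborel G)\<^sup>2" unfolding K_def power_mult_distrib using C(1) by simp
    finally have "L2_norm lborel F \<le> K * L2_norm lborel G"
      by (rule power2_le_imp_le) (intro mult_nonneg_nonneg less_imp_le K L2_norm_nonneg)
    then show ?thesis using F by simp
  qed
  then show ?thesis using K by blast
qed

end
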